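(* Consider an additive orthogonal regression code with parameters $\{(c_l,\omega_l)\}_{l=1}^L$ under correlation-based greedy encoding, where the design matrix $A\in\mathbb{R}^{n\times N}$ has i.i.d. $\mathcal{N}(0,1)$ entries and $n>2$. Let $\sigma>0$, and for $0\le l\le L$ define $$\Delta_l^{\mathrm{corr}}=\sigma^2\prod_{k=1}^l\frac{n}{n+\omega_k^2},\qquad \epsilon_l=1-\prod_{k=1}^l\frac{(n-2)(n+\omega_k^2)}{n(n-2+\omega_k^2)}.$$ Then $\epsilon_l\le\frac2n\sum_{k=1}^l\frac{\omega_k^2}{n-2+\omega_k^2}$, and the following hold for every $l\in\{1,\dots,L\}$. (Upper bound) Under the power allocation $$c_j^2=\frac{\sigma^2\omega_j^2}{n+\omega_j^2}\prod_{k=1}^j\frac{n}{n+\omega_k^2},\qquad j=1,\dots,L,$$ the deterministic centering satisfies $$D_l\le\Delta_l^{\mathrm{corr}}+2(\sigma^2-\Delta_l^{\mathrm{corr}})\,\epsilon_{l-1}.$$ (Lower bound) Conversely, for any power allocation $c_1,\dots,c_L$, $$D_l\ge\Delta_l^{\mathrm{corr}}(1-\epsilon_l).$$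
   Context: $\|\cdot\|$ is the Euclidean norm; empty products equal $1$. Additive orthogonal regression code: nonempty finite sets $\mathcal{B}_1,\dots,\mathcal{B}_L\subset\mathbb{R}^N$ that are mutually orthogonal ($\langle b,b'\rangle=0$ for $b\in\mathcal{B}_l$, $b'\in\mathcal{B}_{l'}$, $l\ne l'$), with $\|b\|=c_l$ for every $b\in\mathcal{B}_l$, where $c_l>0$ is a constant. The codebook is $\{A\beta: \beta\in\mathcal{B}_1+\cdots+\mathcal{B}_L\}\subset\mathbb{R}^n$. The sequence $(c_l)$ is called the power allocation. Normalized Gaussian width: $\omega_l=\mathbb{E}\big[\max_{b\in\mathcal{B}_l}\langle z,b\rangle/\|b\|\big]$ with $z\sim\mathcal{N}(0,I_N)$; it depends only on the directions of the vectors in $\mathcal{B}_l$, not on $c_l$. Correlation-based greedy encoding of a source vector $x\in\mathbb{R}^n$: set $\beta_0=0$, $r_0=x$, and for $l=1,\dots,L$, $$b_l\in\operatorname{arg\,max}_{b\in\mathcal{B}_l}\langle r_{l-1},Ab\rangle,\quad \beta_l=\beta_{l-1}+b_l,\quad r_l=x-A\beta_l,$$ with ties broken by a fixed measurable rule that is a function of $(r_{l-1},(Ab)_{b\in\mathcal{B}_l})$ (for nonzero $x$, ties occur with probability zero). Deterministic centering: $D_l=\frac1n\big(\mathbb{E}\|r_l\|\big)^2$, where the encoder is run on a deterministic source $x\in\mathbb{R}^n$ with $\|x\|=\sqrt n\,\sigma$, e.g. $x=\sqrt n\,\sigma e_1$ (the value does not depend on which such $x$ is used). *)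

theory Defs
  imports "HOL-Probability.Probability"
begin

definition additive_orthogonal_code ::
    "nat \<Rightarrow> (nat \<Rightarrow> real) \<Rightarrow> (nat \<Rightarrow> (real ^ 'N) set) \<Rightarrow> bool" where
  "additive_orthogonal_code L c B \<longleftrightarrow>
     (\<forall>l\<in>{1..L}. finite (B l) \<and> B l \<noteq> {} \<and> c l > 0 \<and> (\<forall>b\<in>B l. norm b = c l)) \<and>
     (\<forall>l\<in>{1..L}. \<forall>l'\<in>{1..L}. l \<noteq> l' \<longrightarrow> (\<forall>b\<in>B l. \<forall>b'\<in>B l'. b \<bullet> b' = 0))"

definition std_gaussian :: "(real ^ 'N) measure" where
  "std_gaussian = distr (Pi\<^sub>M UNIV (\<lambda>_. std_normal_distribution)) borel (\<lambda>f. \<chi> i. f i)"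

definition gaussian_width :: "(real ^ 'N) set \<Rightarrow> real" where
  "gaussian_width S = (\<integral>z. Max ((\<lambda>b. (z \<bullet> b) / norm b) ` S) \<partial>std_gaussian)"

definition gaussian_design :: "'w measure \<Rightarrow> ('w \<Rightarrow> real ^ 'N ^ 'n) \<Rightarrow> bool" where
  "gaussian_design M A \<longleftrightarrow>
     prob_space M \<and>
     prob_space.indep_vars M (\<lambda>_. borel) (\<lambda>(i, j) w. A w $ i $ j) UNIV \<and>
     (\<forall>i j. distributed M lborel (\<lambda>w. A w $ i $ j) std_normal_density)"

text \<open>
  A tie-breaking rule \<open>sel l\<close> receives the current residual \<open>r\<close> and the family \<open>g\<close> of the
  vectors \<open>A b\<close>, indexed by \<open>b \<in> B l\<close> (an element of the product space, hence extensional).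
  It has no other access to \<open>A\<close>.
\<close>

definition greedy_rule ::
    "nat \<Rightarrow> (nat \<Rightarrow> (real ^ 'N) set) \<Rightarrow>
     (nat \<Rightarrow> real ^ 'n \<Rightarrow> (real ^ 'N \<Rightarrow> real ^ 'n) \<Rightarrow> real ^ 'N) \<Rightarrow> bool" where
  "greedy_rule L B sel \<longleftrightarrow>
     (\<forall>l\<in>{1..L}.
        (\<lambda>(r, g). sel l r g) \<in>
          borel \<Otimes>\<^sub>M (\<Pi>\<^sub>M b\<in>B l. borel) \<rightarrow>\<^sub>M count_space (B l) \<and>
        (\<forall>r. \<forall>g\<in>B l \<rightarrow>\<^sub>E UNIV. is_arg_max (\<lambda>b. r \<bullet> g b) (\<lambda>b. b \<in> B l) (sel l r g)))"

primrec greedy_beta ::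
    "(nat \<Rightarrow> (real ^ 'N) set) \<Rightarrow>
     (nat \<Rightarrow> real ^ 'n \<Rightarrow> (real ^ 'N \<Rightarrow> real ^ 'n) \<Rightarrow> real ^ 'N) \<Rightarrow>
     real ^ 'N ^ 'n \<Rightarrow> real ^ 'n \<Rightarrow> nat \<Rightarrow> real ^ 'N" where
  "greedy_beta B sel A x 0 = 0"
| "greedy_beta B sel A x (Suc l) =
     greedy_beta B sel A x l +
     sel (Suc l) (x - A *v greedy_beta B sel A x l) (restrict (\<lambda>b. A *v b) (B (Suc l)))"

definition residual ::
    "(nat \<Rightarrow> (real ^ 'N) set) \<Rightarrow>
     (nat \<Rightarrow> real ^ 'n \<Rightarrow> (real ^ 'N \<Rightarrow> real ^ 'n) \<Rightarrow> real ^ 'N) \<Rightarrow>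
     real ^ 'N ^ 'n \<Rightarrow> real ^ 'n \<Rightarrow> nat \<Rightarrow> real ^ 'n" where
  "residual B sel A x l = x - A *v greedy_beta B sel A x l"

definition det_centering ::
    "'w measure \<Rightarrow> ('w \<Rightarrow> real ^ 'N ^ 'n) \<Rightarrow> (nat \<Rightarrow> (real ^ 'N) set) \<Rightarrow>
     (nat \<Rightarrow> real ^ 'n \<Rightarrow> (real ^ 'N \<Rightarrow> real ^ 'n) \<Rightarrow> real ^ 'N) \<Rightarrow>
     real ^ 'n \<Rightarrow> nat \<Rightarrow> real" where
  "det_centering M A B sel x l =
     (1 / real CARD('n)) * (\<integral>w. norm (residual B sel (A w) x l) \<partial>M)\<^sup>2"

definition Delta_corr :: "nat \<Rightarrow> real \<Rightarrow> (nat \<Rightarrow> real) \<Rightarrow> nat \<Rightarrow> real" where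
  "Delta_corr n \<sigma> \<omega> l = \<sigma>\<^sup>2 * (\<Prod>k=1..l. real n / (real n + (\<omega> k)\<^sup>2))"

definition eps_corr :: "nat \<Rightarrow> (nat \<Rightarrow> real) \<Rightarrow> nat \<Rightarrow> real" where
  "eps_corr n \<omega> l =
     1 - (\<Prod>k=1..l. ((real n - 2) * (real n + (\<omega> k)\<^sup>2)) / (real n * (real n - 2 + (\<omega> k)\<^sup>2)))"

end

theory Submission
  imports Defs "HOL-Real_Asymp.Real_Asymp"
begin

text \<open>
  Given the residual \<open>r\<close>, put \<open>u = r / |r|\<close>. The codewords in \<open>B\<^sub>l\<close> are orthogonal to the ones used
  before, so \<open>A\<close> acts on them like an independent Gaussian matrix \<open>A'\<close>, and the next residual has
  component \<open>|r| - c m\<close> along \<open>u\<close>, where \<open>m\<close> is the maximum whose mean is \<open>\<omega>\<close>, and an independent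
  orthogonal component distributed like \<open>c g\<close> with \<open>g\<close> Gaussian of dimension \<open>n - 1\<close>. The Gaussian
  Poincare inequality bounds the variances of \<open>m\<close> and of \<open>|g|\<close> by one, so that \<open>E m\<^sup>2 \<le> \<omega>\<^sup>2 + 1\<close> and
  \<open>(E |g|)\<^sup>2 \<ge> n - 2\<close>. With \<open>R\<^sub>l = E |r\<^sub>l|\<close> and \<open>V\<^sub>l = E |r\<^sub>l|\<^sup>2\<close> this gives
  \<open>R\<^sub>l\<^sup>2 \<ge> R\<^sub>l\<^sub>-\<^sub>1\<^sup>2 (n - 2) / (n - 2 + \<omega>\<^sup>2)\<close> for every power allocation, which is the lower bound, and
  \<open>V\<^sub>l \<le> V\<^sub>l\<^sub>-\<^sub>1 - 2 c \<omega> R\<^sub>l\<^sub>-\<^sub>1 + c\<^sup>2 (\<omega>\<^sup>2 + n)\<close>. Inserting the lower bound for \<open>R\<^sub>l\<^sub>-\<^sub>1\<close> into the latter and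
  summing up yields the upper bound, since \<open>R\<^sub>l\<^sup>2 \<le> V\<^sub>l\<close>.
\<close>

subsection \<open>Standard Gaussian measures on Euclidean spaces\<close>

text \<open>The obstacle is that the choice of a codeword is a function of the same design that
  produces the next residual, and the tie-breaking rule may inspect all the vectors
  \<open>A b\<close> of the block. Conditioning is avoided: independence is obtained by mixing two
  independent Gaussian matrices with a linear coisometry, which leaves the law \<open>gauss\<close>
  unchanged (\<open>gauss_coisometry\<close>). This is why \<open>gauss\<close> is defined on every
  Euclidean space: it serves for reals, vectors, matrices and pairs of matrices. The orthogonal
  component is independent of the choice only outside ties, hence the almost sure statements
  \<open>AE_no_ties\<close> and \<open>AE_res_nonzero\<close>. The 2 in \<open>n - 2\<close> is one
  dimension lost to \<open>u\<close> plus one unit of variance. The error \<open>eps_corr\<close>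
  measures how far the guaranteed shrinkage \<open>(n - 2) / (n - 2 + w^2)\<close> of the squared
  mean stays below the ideal factor \<open>n / (n + w^2)\<close>.\<close>

definition gauss :: "'a::euclidean_space measure" where
  "gauss = distr (\<Pi>\<^sub>M b\<in>Basis. std_normal_distribution) borel (\<lambda>f. \<Sum>b\<in>Basis. f b *\<^sub>R b)"

lemma sets_gauss [simp, measurable_cong]: "sets gauss = sets borel"
  and space_gauss [simp]: "space gauss = UNIV"
  by (simp_all add: gauss_def)

lemma prob_space_std_normal: "prob_space std_normal_distribution"
  by (rule prob_space_normal_density) simp

lemma prob_space_gauss: "prob_space (gauss :: 'a::euclidean_space measure)"
proof -
  interpret prob_space "\<Pi>\<^sub>M b\<in>(Basis::'a set). std_normal_distribution"
    by (intro prob_space_PiM prob_space_std_normal)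
  show ?thesis
    unfolding gauss_def by (intro prob_space_distr) measurable
qed

lemma prod_std_normal_density:
  fixes z :: "'a::euclidean_space"
  shows "(\<Prod>b\<in>Basis. std_normal_density (z \<bullet> b)) = exp (- (norm z)\<^sup>2 / 2) / sqrt (2 * pi) ^ DIM('a)"
proof -
  have "(\<Prod>b\<in>Basis. std_normal_density (z \<bullet> b))
      = (\<Prod>b\<in>Basis. exp (- (z \<bullet> b)\<^sup>2 / 2)) / sqrt (2 * pi) ^ DIM('a)"
    by (simp add: std_normal_density_def prod_dividef field_simps)
  also have "(\<Prod>b\<in>Basis. exp (- (z \<bullet> b)\<^sup>2 / 2)) = exp (- (norm z)\<^sup>2 / 2)"
    unfolding power2_norm_eq_inner euclidean_inner[of z z]
    by (simp add: exp_sum[symmetric] power2_eq_square sum_divide_distrib[symmetric] sum_negf)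
  finally show ?thesis .
qed

text \<open>On coordinates, the product of the one-dimensional laws and the measure with the product
  density agree on boxes; the coordinate map carries this to the space. The density depends on
  \<open>norm z\<close> alone, which makes rotation invariance accessible.\<close>

lemma gauss_density:
  "(gauss :: 'a::euclidean_space measure) =
     density lborel (\<lambda>z. ennreal (exp (- (norm z)\<^sup>2 / 2) / sqrt (2 * pi) ^ DIM('a)))"
proof -
  let ?B = "Basis :: 'a set"
  interpret N: product_sigma_finite "\<lambda>_::'a. std_normal_distribution"
    by (simp add: product_sigma_finite_def prob_space_std_normal prob_space_imp_sigma_finite)
  interpret P: product_sigma_finite "\<lambda>_::'a. lborel :: real measure"
    by standard
  have "density (\<Pi>\<^sub>M b\<in>?B. lborel) (\<lambda>f. \<Prod>b\<in>?B. ennreal (std_normal_density (f b)))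
      = (\<Pi>\<^sub>M b\<in>?B. std_normal_distribution)"
  proof (rule N.PiM_eqI)
    show "sets (density (\<Pi>\<^sub>M b\<in>?B. lborel) (\<lambda>f. \<Prod>b\<in>?B. ennreal (std_normal_density (f b))))
        = sets (\<Pi>\<^sub>M b\<in>?B. std_normal_distribution)"
      by (simp cong: sets_PiM_cong)
  next
    fix A :: "'a \<Rightarrow> real set" assume A: "\<And>i. i \<in> ?B \<Longrightarrow> A i \<in> sets std_normal_distribution"
    then have [measurable]: "i \<in> ?B \<Longrightarrow> A i \<in> sets borel" for i by simp
    have [measurable]: "Pi\<^sub>E ?B A \<in> sets (\<Pi>\<^sub>M b\<in>?B. lborel)"
      using A by (intro sets_PiM_I_finite) auto
    have "emeasure (density (\<Pi>\<^sub>M b\<in>?B. lborel) (\<lambda>f. \<Prod>b\<in>?B. ennreal (std_normal_density (f b)))) (Pi\<^sub>E ?B A)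
        = (\<integral>\<^sup>+f. (\<Prod>b\<in>?B. ennreal (std_normal_density (f b))) * indicator (Pi\<^sub>E ?B A) f \<partial>(\<Pi>\<^sub>M b\<in>?B. lborel))"
      by (subst emeasure_density) simp_all
    also have "\<dots> = (\<integral>\<^sup>+f. (\<Prod>b\<in>?B. ennreal (std_normal_density (f b)) * indicator (A b) (f b)) \<partial>(\<Pi>\<^sub>M b\<in>?B. lborel))"
    proof (rule nn_integral_cong)
      fix f assume "f \<in> space (\<Pi>\<^sub>M b\<in>?B. lborel :: real measure)"
      then have "f \<in> extensional ?B" by (simp add: space_PiM PiE_def)
      then have "indicator (Pi\<^sub>E ?B A) f = (\<Prod>b\<in>?B. indicator (A b) (f b) :: ennreal)"
        by (auto simp: indicator_def PiE_def Pi_def)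
      then show "(\<Prod>b\<in>?B. ennreal (std_normal_density (f b))) * indicator (Pi\<^sub>E ?B A) f
          = (\<Prod>b\<in>?B. ennreal (std_normal_density (f b)) * indicator (A b) (f b))"
        by (simp add: prod.distrib)
    qed
    also have "\<dots> = (\<Prod>b\<in>?B. \<integral>\<^sup>+t. ennreal (std_normal_density t) * indicator (A b) t \<partial>lborel)"
      by (rule P.product_nn_integral_prod) auto
    also have "\<dots> = (\<Prod>b\<in>?B. emeasure std_normal_distribution (A b))"
      by (intro prod.cong refl) (simp add: emeasure_density)
    finally show "emeasure (density (\<Pi>\<^sub>M b\<in>?B. lborel) (\<lambda>f. \<Prod>b\<in>?B. ennreal (std_normal_density (f b)))) (Pi\<^sub>E ?B A)
        = (\<Prod>b\<in>?B. emeasure std_normal_distribution (A b))" .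
  qed simp
  note * = this
  \<comment> \<open>\<open>lborel\<close> is itself the image of a product of one-dimensional
    Lebesgue measures under the same coordinate map, so the density can be pulled back to
    coordinates.\<close>
  have "density lborel (\<lambda>z::'a. ennreal (exp (- (norm z)\<^sup>2 / 2) / sqrt (2 * pi) ^ DIM('a)))
     = density (distr (\<Pi>\<^sub>M b\<in>?B. lborel) borel (\<lambda>f. \<Sum>b\<in>?B. f b *\<^sub>R b)) (\<lambda>z. \<Prod>b\<in>?B. ennreal (std_normal_density (z \<bullet> b)))"
    by (subst lborel_eq) (simp only: prod_std_normal_density[symmetric] prod_ennreal normal_density_nonneg)
  also have "\<dots> = distr (density (\<Pi>\<^sub>M b\<in>?B. lborel) (\<lambda>f. \<Prod>b\<in>?B. ennreal (std_normal_density ((\<Sum>b\<in>?B. f b *\<^sub>R b) \<bullet> b))))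
      borel (\<lambda>f. \<Sum>b\<in>?B. f b *\<^sub>R b)"
    by (subst density_distr) simp_all
  also have "\<dots> = distr (density (\<Pi>\<^sub>M b\<in>?B. lborel) (\<lambda>f. \<Prod>b\<in>?B. ennreal (std_normal_density (f b))))
      borel (\<lambda>f. \<Sum>b\<in>?B. f b *\<^sub>R b)"
    by simp
  finally show ?thesis
    unfolding gauss_def * by simp
qed

section \<open>Rotation invariance of Lebesgue and Gaussian measure\<close>

lemma lborel_distr_translate:
  "distr lborel borel (\<lambda>x. a + x) = (lborel :: 'a::euclidean_space measure)"
  using lborel_affine[of 1 a] by (simp add: density_1)

lemma lborel_distr_reflect:
  "distr lborel borel (\<lambda>x. a - x) = (lborel :: 'a::euclidean_space measure)"
  using lborel_affine[of "-1" a] by (simp add: density_1)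

text \<open>Uniqueness of Haar measure: both sides of the product formula are
  \<open>\<integral>\<integral> 1\<^sub>A(x) 1\<^sub>C(x + y)\<close>, integrated in either order.\<close>

lemma translation_invariant_exchange:
  fixes \<mu> :: "'a::euclidean_space measure"
  assumes sf: "sigma_finite_measure \<mu>" and [simp, measurable_cong]: "sets \<mu> = sets borel"
    and inv: "\<And>a. distr \<mu> borel (\<lambda>x. a + x) = \<mu>"
    and [measurable]: "A \<in> sets borel" "C \<in> sets borel"
  shows "emeasure \<mu> A * emeasure lborel C = emeasure \<mu> C * emeasure lborel A"
proof -
  interpret \<mu>: sigma_finite_measure \<mu> by fact
  interpret pair_sigma_finite \<mu> "lborel :: 'a measure" ..
  have "emeasure \<mu> A * emeasure lborel C
      = (\<integral>\<^sup>+x. \<integral>\<^sup>+y. indicator A x * indicator C y \<partial>lborel \<partial>\<mu>)"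
    by (simp add: nn_integral_cmult nn_integral_multc)
  also have "\<dots> = (\<integral>\<^sup>+x. \<integral>\<^sup>+y. indicator A x * indicator C (x + y) \<partial>lborel \<partial>\<mu>)"
  proof (rule nn_integral_cong)
    fix x :: 'a
    have "(\<integral>\<^sup>+y. indicator A x * indicator C y \<partial>lborel)
       = (\<integral>\<^sup>+y. indicator A x * indicator C y \<partial>distr lborel borel (\<lambda>y. x + y))"
      by (simp add: lborel_distr_translate)
    also have "\<dots> = (\<integral>\<^sup>+y. indicator A x * indicator C (x + y) \<partial>lborel)"
      by (subst nn_integral_distr) simp_all
    finally show "(\<integral>\<^sup>+y. indicator A x * indicator C y \<partial>lborel)
       = (\<integral>\<^sup>+y. indicator A x * indicator C (x + y) \<partial>lborel)" .
  qed
  also have "\<dots> = (\<integral>\<^sup>+y. \<integral>\<^sup>+x. indicator A x * indicator C (x + y) \<partial>\<mu> \<partial>lborel)"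
    by (subst Fubini') simp_all
  \<comment> \<open>For fixed \<open>y\<close>, translation invariance of \<open>\<mu>\<close>
    shifts the argument by \<open>y\<close>, which moves the translate from \<open>C\<close> to
    \<open>A\<close>.\<close>
  also have "\<dots> = (\<integral>\<^sup>+y. \<integral>\<^sup>+x. indicator A (x - y) * indicator C x \<partial>\<mu> \<partial>lborel)"
  proof (rule nn_integral_cong)
    fix y :: 'a
    have "(\<integral>\<^sup>+x. indicator A (x - y) * indicator C x \<partial>\<mu>)
       = (\<integral>\<^sup>+x. indicator A (x - y) * indicator C x \<partial>distr \<mu> borel (\<lambda>x. y + x))"
      by (simp add: inv)
    also have "\<dots> = (\<integral>\<^sup>+x. indicator A x * indicator C (x + y) \<partial>\<mu>)"
      by (subst nn_integral_distr) (simp_all add: add.commute)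
    finally show "(\<integral>\<^sup>+x. indicator A x * indicator C (x + y) \<partial>\<mu>)
       = (\<integral>\<^sup>+x. indicator A (x - y) * indicator C x \<partial>\<mu>)" ..
  qed
  also have "\<dots> = (\<integral>\<^sup>+x. \<integral>\<^sup>+y. indicator A (x - y) * indicator C x \<partial>lborel \<partial>\<mu>)"
    by (subst Fubini') simp_all
  also have "\<dots> = (\<integral>\<^sup>+x. \<integral>\<^sup>+y. indicator A y * indicator C x \<partial>lborel \<partial>\<mu>)"
  proof (rule nn_integral_cong)
    fix x :: 'a
    have "(\<integral>\<^sup>+y. indicator A y * indicator C x \<partial>lborel)
       = (\<integral>\<^sup>+y. indicator A y * indicator C x \<partial>distr lborel borel (\<lambda>y. x - y))"
      by (simp add: lborel_distr_reflect)
    also have "\<dots> = (\<integral>\<^sup>+y. indicator A (x - y) * indicator C x \<partial>lborel)"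
      by (subst nn_integral_distr) simp_all
    finally show "(\<integral>\<^sup>+y. indicator A (x - y) * indicator C x \<partial>lborel)
       = (\<integral>\<^sup>+y. indicator A y * indicator C x \<partial>lborel)" ..
  qed
  also have "\<dots> = emeasure \<mu> C * emeasure lborel A"
    by (simp add: nn_integral_cmult nn_integral_multc mult.commute)
  finally show ?thesis .
qed

text \<open>The image measure is again translation invariant, because
  \<open>a + T x = T (S a + x)\<close> for the inverse \<open>S\<close>. The exchange formula with
  the unit ball, which \<open>T\<close> maps onto itself and whose volume is finite and positive,
  then cancels to equality.\<close>

lemma lborel_distr_orthogonal:
  fixes T :: "'a::euclidean_space \<Rightarrow> 'a"
  assumes T: "orthogonal_transformation T"
  shows "distr lborel borel T = lborel"
proof -
  have lin: "linear T" and nrm: "\<And>x. norm (T x) = norm x"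
    using T by (auto simp: orthogonal_transformation)
  have [measurable]: "T \<in> borel_measurable borel"
    using lin by (simp add: borel_measurable_continuous_onI linear_continuous_on linear_linear)
  obtain S where S: "orthogonal_transformation S" "\<And>x. S (T x) = x" "\<And>x. T (S x) = x"
    using T by (metis orthogonal_transformation_inv orthogonal_transformation_bij bij_inv_eq_iff)
  have linS: "linear S" using S(1) by (simp add: orthogonal_transformation)
  then have S_meas [measurable]: "S \<in> borel_measurable borel"
    by (simp add: borel_measurable_continuous_onI linear_continuous_on linear_linear)
  let ?\<mu> = "distr lborel borel T"
  have inv: "distr ?\<mu> borel (\<lambda>x. a + x) = ?\<mu>" for a
  proof -
    have "distr ?\<mu> borel (\<lambda>x. a + x) = distr lborel borel (\<lambda>x. T (S a + x))"
      by (subst distr_distr) (simp_all add: comp_def linear_add[OF lin] S(3))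
    also have "\<dots> = distr (distr lborel borel (\<lambda>x. S a + x)) borel T"
      by (subst distr_distr) (simp_all add: comp_def)
    finally show ?thesis by (simp add: lborel_distr_translate)
  qed
  \<comment> \<open>Pushing the image measure forward along the inverse \<open>S\<close> gives back
    \<open>lborel\<close>, and sigma-finiteness transfers from an image to its source.\<close>
  have sf: "sigma_finite_measure ?\<mu>"
  proof -
    have "sigma_finite_measure (distr ?\<mu> lborel S)"
      by (subst distr_distr) (simp_all add: comp_def S(2) distr_id2 lborel.sigma_finite_measure_axioms)
    then show ?thesis
      by (rule sigma_finite_measure_distr) simp
  qed
  have ball: "emeasure ?\<mu> (ball 0 1) = emeasure lborel (ball 0 1 :: 'a set)"
  proof -
    have "T -` ball 0 1 = (ball 0 1 :: 'a set)"
      by (auto simp: nrm)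
    then show ?thesis by (simp add: emeasure_distr)
  qed
  show ?thesis
  proof (rule measure_eqI)
    fix A assume "A \<in> sets ?\<mu>"
    then have [measurable]: "A \<in> sets borel" by simp
    have "emeasure ?\<mu> A * emeasure lborel (ball 0 1 :: 'a set) = emeasure lborel (ball 0 1 :: 'a set) * emeasure lborel A"
      using translation_invariant_exchange[OF sf _ inv, of A "ball 0 1"] ball by simp
    moreover have "emeasure lborel (ball 0 1 :: 'a set) \<noteq> 0" "emeasure lborel (ball 0 1 :: 'a set) \<noteq> \<infinity>"
    proof -
      show "emeasure lborel (ball 0 1 :: 'a set) \<noteq> \<infinity>"
        by (metis bounded_ball emeasure_bounded_finite less_irrefl infinity_ennreal_def)
      show "emeasure lborel (ball 0 1 :: 'a set) \<noteq> 0"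
        using emeasure_lborel_ball_finite 
        by (metis content_ball_pos emeasure_eq_ennreal_measure ennreal_eq_0_iff less_le_not_le measure_def enn2real_0 zero_less_one less_irrefl)
    qed
    ultimately show "emeasure ?\<mu> A = emeasure lborel A"
      by (metis ennreal_mult_cancel_left mult.commute infinity_ennreal_def)
  qed simp
qed

lemma gauss_orthogonal:
  fixes T :: "'a::euclidean_space \<Rightarrow> 'a"
  assumes T: "orthogonal_transformation T"
  shows "distr gauss borel T = gauss"
proof -
  have lin: "linear T" and nrm: "\<And>x. norm (T x) = norm x"
    using T by (auto simp: orthogonal_transformation)
  have [measurable]: "T \<in> borel_measurable borel"
    using lin by (simp add: borel_measurable_continuous_onI linear_continuous_on linear_linear)
  let ?d = "\<lambda>z::'a. ennreal (exp (- (norm z)\<^sup>2 / 2) / sqrt (2 * pi) ^ DIM('a))"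
  have "gauss = density (distr lborel borel T) ?d"
    by (simp add: gauss_density lborel_distr_orthogonal[OF T])
  also have "\<dots> = distr (density lborel (\<lambda>x. ?d (T x))) borel T"
    by (rule density_distr) simp_all
  also have "\<dots> = distr gauss borel T"
    by (simp add: gauss_density nrm)
  finally show ?thesis ..
qed

section \<open>Gaussian measures on products and their linear images\<close>

lemma gauss_prod:
  "(gauss :: ('a::euclidean_space \<times> 'b::euclidean_space) measure) = gauss \<Otimes>\<^sub>M gauss"
proof -
  have sf: "sigma_finite_measure (density lborel (\<lambda>z::'b. ennreal (exp (- (norm z)\<^sup>2 / 2) / sqrt (2 * pi) ^ DIM('b))))"
    unfolding gauss_density[symmetric] by (rule prob_space_imp_sigma_finite[OF prob_space_gauss])
  have "(gauss :: 'a measure) \<Otimes>\<^sub>M (gauss :: 'b measure)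
    = density (lborel \<Otimes>\<^sub>M lborel) (\<lambda>(x::'a,y::'b). ennreal (exp (- (norm x)\<^sup>2 / 2) / sqrt (2 * pi) ^ DIM('a))
         * ennreal (exp (- (norm y)\<^sup>2 / 2) / sqrt (2 * pi) ^ DIM('b)))"
    unfolding gauss_density
    by (rule pair_measure_density[OF _ _ lborel.sigma_finite_measure_axioms sf]) simp_all
  also have "(\<lambda>(x::'a,y::'b). ennreal (exp (- (norm x)\<^sup>2 / 2) / sqrt (2 * pi) ^ DIM('a))
         * ennreal (exp (- (norm y)\<^sup>2 / 2) / sqrt (2 * pi) ^ DIM('b)))
      = (\<lambda>z. ennreal (exp (- (norm z)\<^sup>2 / 2) / sqrt (2 * pi) ^ DIM('a \<times> 'b)))"
    by (auto simp: fun_eq_iff ennreal_mult'[symmetric] norm_Pair mult_exp_exp power_add add_divide_distrib)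
  finally show ?thesis
    by (simp only: lborel_prod gauss_density)
qed

lemma distr_gauss_snd:
  "distr gauss borel (snd :: 'a::euclidean_space \<times> 'b::euclidean_space \<Rightarrow> 'b) = gauss"
proof (rule measure_eqI)
  interpret A: prob_space "gauss :: 'a measure" by (rule prob_space_gauss)
  interpret B: prob_space "gauss :: 'b measure" by (rule prob_space_gauss)
  fix A assume "A \<in> sets (distr gauss borel (snd :: 'a \<times> 'b \<Rightarrow> 'b))"
  then have [measurable]: "A \<in> sets borel" by simp
  have "emeasure (distr gauss borel (snd :: 'a \<times> 'b \<Rightarrow> 'b)) A = emeasure (gauss \<Otimes>\<^sub>M gauss) ((UNIV :: 'a set) \<times> A)"
    by (subst emeasure_distr) (auto simp: gauss_prod vimage_snd intro!: arg_cong2[where f=emeasure])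
  also have "\<dots> = emeasure gauss A"
    using A.emeasure_space_1 by (subst B.emeasure_pair_measure_Times) simp_all
  finally show "emeasure (distr gauss borel (snd :: 'a \<times> 'b \<Rightarrow> 'b)) A = emeasure gauss A" .
qed simp

text \<open>Apply the rotation \<open>(y, a) \<mapsto> (T a, a - T' T a + T' y)\<close> of the product space and
  project to the second factor.\<close>

lemma gauss_coisometry:
  fixes T :: "'a::euclidean_space \<Rightarrow> 'b::euclidean_space"
  assumes lin: "linear T" and adj: "\<And>a y. T a \<bullet> y = a \<bullet> T' y" and co: "\<And>y. T (T' y) = y"
  shows "distr gauss borel T = gauss"
proof -
  interpret B: prob_space "gauss :: 'b measure" by (rule prob_space_gauss)
  interpret A: prob_space "gauss :: 'a measure" by (rule prob_space_gauss)
  have linT': "linear T'"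
    by (metis adj adjoint_unique adjoint_linear lin inner_commute)
  have [measurable]: "T \<in> borel_measurable borel"
    using lin by (simp add: borel_measurable_continuous_onI linear_continuous_on linear_linear)
  define R :: "'b \<times> 'a \<Rightarrow> 'b \<times> 'a" where "R = (\<lambda>(y, a). (T a, a - T' (T a) + T' y))"
  have "orthogonal_transformation R"
  proof -
    have "linear R"
      unfolding R_def
      by (rule linearI) (auto simp: linear_add[OF lin] linear_add[OF linT'] linear_scale[OF lin]
          linear_scale[OF linT'] algebra_simps)
    moreover have "R v \<bullet> R v = v \<bullet> v" for v
    proof (cases v)
      case (Pair y a)
      \<comment> \<open>\<open>T T' = id\<close> makes \<open>T'\<close> isometric, so
        \<open>T' (T a)\<close> is the orthogonal projection of \<open>a\<close> to the range of
        \<open>T'\<close>; what remains of \<open>a\<close> is orthogonal to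
        \<open>T' y\<close>.\<close>
      have 1: "T' z \<bullet> T' w = z \<bullet> w" for z w
        using adj[of "T' z" w] co[of z] by simp
      have 2: "a \<bullet> T' z = T a \<bullet> z" "T' z \<bullet> a = T a \<bullet> z" for z
        using adj[of a z] by (simp_all add: inner_commute)
      show ?thesis
        by (simp add: Pair R_def inner_simps 1 2 inner_commute[of y "T a"])
    qed
    ultimately show ?thesis
      by (simp add: orthogonal_transformation norm_eq_sqrt_inner)
  qed
  moreover from this have [measurable]: "R \<in> borel_measurable borel"
    by (simp add: orthogonal_transformation borel_measurable_continuous_onI linear_continuous_on linear_linear)
  moreover have fst_gauss: "distr gauss borel (fst :: 'b \<times> 'a \<Rightarrow> 'b) = gauss"
    using A.distr_pair_fst[of "gauss :: 'b measure"]
    by (simp add: gauss_prod cong: distr_cong)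
  \<comment> \<open>\<open>fst\<close> after \<open>R\<close> is \<open>T\<close> applied to the
    second coordinate; since \<open>R\<close> preserves the law, the image under \<open>T\<close> is
    the first marginal of a Gaussian pair.\<close>
  ultimately have "gauss = distr (distr gauss borel R) borel (fst :: 'b \<times> 'a \<Rightarrow> 'b)"
    by (simp add: gauss_orthogonal)
  also have "\<dots> = distr gauss borel (\<lambda>v :: 'b \<times> 'a. T (snd v))"
  proof -
    have "fst (R v) = T (snd v)" for v
      by (simp add: R_def case_prod_beta)
    then show ?thesis
      by (subst distr_distr) (simp_all add: comp_def borel_measurable_continuous_onI continuous_on_fst)
  qed
  also have "\<dots> = distr (distr gauss borel (snd :: 'b \<times> 'a \<Rightarrow> 'a)) borel T"
    by (subst distr_distr) (simp_all add: comp_def borel_measurable_continuous_onI continuous_on_snd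
        measurable_cong_sets[OF sets_gauss refl])
  finally show ?thesis
    by (simp add: distr_gauss_snd)
qed

subsection \<open>The Gaussian Poincare inequality\<close>

abbreviation (input) "std_normal \<equiv> (std_normal_distribution :: real measure)"

lemma integral_std_normal:
  fixes g :: "real \<Rightarrow> real"
  assumes [measurable]: "g \<in> borel_measurable borel"
  shows "(\<integral>t. g t \<partial>std_normal) = (\<integral>t. std_normal_density t * g t \<partial>lborel)"
    and "integrable std_normal g \<longleftrightarrow> integrable lborel (\<lambda>t. std_normal_density t * g t)"
  by (simp_all add: integral_density integrable_density)

lemma integrable_std_normal_power: "integrable std_normal (\<lambda>t. t ^ k)"
  by (simp add: integral_std_normal integrable_std_normal_moment)

text \<open>Gaussian integration by parts: as \<open>\<phi>' = - t \<phi>\<close>, the derivative of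
  \<open>\<phi> H\<close> is the difference of the two integrands. Linear growth of \<open>H\<close>
  removes the boundary terms and makes the left integrand integrable through the second
  moment.\<close>

lemma std_normal_stein:
  fixes H h :: "real \<Rightarrow> real"
  assumes H: "\<And>t. (H has_real_derivative h t) (at t)"
    and cont: "continuous_on UNIV h"
    and bnd: "\<And>t. \<bar>h t\<bar> \<le> C" and bndH: "\<And>t. \<bar>H t\<bar> \<le> C * \<bar>t\<bar>"
  shows "(\<integral>t. t * H t \<partial>std_normal) = (\<integral>t. h t \<partial>std_normal)"
proof -
  let ?\<phi> = std_normal_density
  have C: "0 \<le> C" using bnd[of 0] by linarith
  have contH: "continuous_on UNIV H"
    using H by (meson DERIV_isCont continuous_at_imp_continuous_on)
  have [measurable]: "H \<in> borel_measurable borel" "h \<in> borel_measurable borel"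
    using contH cont by (auto intro: borel_measurable_continuous_onI)
  have int1: "integrable lborel (\<lambda>t. ?\<phi> t * h t)"
    by (rule Bochner_Integration.integrable_bound[of _ "\<lambda>t. C * ?\<phi> t"])
       (use bnd C in \<open>auto simp: abs_mult mult.commute intro!: mult_right_mono\<close>)
  have int2: "integrable lborel (\<lambda>t. ?\<phi> t * (t * H t))"
  proof (rule Bochner_Integration.integrable_bound[of _ "\<lambda>t. C * (?\<phi> t * t ^ 2)"])
    show "AE t in lborel. norm (?\<phi> t * (t * H t)) \<le> norm (C * (?\<phi> t * t\<^sup>2))"
    proof (rule AE_I2)
      fix t
      have "\<bar>t * H t\<bar> \<le> C * t\<^sup>2"
        using mult_left_mono[OF bndH[of t], of "\<bar>t\<bar>"]
        by (simp add: abs_mult power2_eq_square mult.left_commute[of "\<bar>t\<bar>" C])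
      then have "?\<phi> t * \<bar>t * H t\<bar> \<le> ?\<phi> t * (C * t\<^sup>2)"
        by (intro mult_left_mono) auto
      then show "norm (?\<phi> t * (t * H t)) \<le> norm (C * (?\<phi> t * t\<^sup>2))"
        using C by (simp add: abs_mult mult_ac)
    qed
  qed (simp_all add: integrable_std_normal_moment)
  define F where "F = (\<lambda>t. ?\<phi> t * H t)"
  define f where "f = (\<lambda>t. ?\<phi> t * h t - ?\<phi> t * (t * H t))"
  have contphi: "continuous_on UNIV ?\<phi>"
    unfolding std_normal_density_def by (intro continuous_intros) auto
  have dphi: "(?\<phi> has_real_derivative (- t * ?\<phi> t)) (at t)" for t
  proof -
    have "((\<lambda>t. 1 / sqrt (2 * pi) * exp (- t\<^sup>2 / 2)) has_real_derivative
        1 / sqrt (2 * pi) * (exp (- t\<^sup>2 / 2) * (- t))) (at t)"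
      by (rule DERIV_cmult) (auto intro!: derivative_eq_intros)
    moreover have "?\<phi> = (\<lambda>t. 1 / sqrt (2 * pi) * exp (- t\<^sup>2 / 2))"
      by (simp add: fun_eq_iff std_normal_density_def)
    ultimately show ?thesis
      by (simp add: mult_ac)
  qed
  have "((\<lambda>t::real. t * exp (- t\<^sup>2 / 2)) \<longlongrightarrow> 0) at_bot" "((\<lambda>t::real. t * exp (- t\<^sup>2 / 2)) \<longlongrightarrow> 0) at_top"
    by real_asymp+
  then have "((\<lambda>t. C * (\<bar>t * exp (- t\<^sup>2 / 2)\<bar> / sqrt (2 * pi))) \<longlongrightarrow> 0) at_bot"
    "((\<lambda>t. C * (\<bar>t * exp (- t\<^sup>2 / 2)\<bar> / sqrt (2 * pi))) \<longlongrightarrow> 0) at_top"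
    by (intro tendsto_mult_right_zero tendsto_divide_zero tendsto_rabs_zero; simp)+
  then have lim_bot: "((\<lambda>t. C * (\<bar>t\<bar> * ?\<phi> t)) \<longlongrightarrow> 0) at_bot" and lim_top: "((\<lambda>t. C * (\<bar>t\<bar> * ?\<phi> t)) \<longlongrightarrow> 0) at_top"
    by (simp_all add: std_normal_density_def abs_mult)
  have F_le: "norm (F t) \<le> C * (\<bar>t\<bar> * ?\<phi> t)" for t
    using mult_left_mono[OF bndH[of t], of "?\<phi> t"] by (simp add: F_def abs_mult mult_ac)
  have F_top: "(F \<longlongrightarrow> 0) at_top"
    by (rule Lim_null_comparison[OF always_eventually[OF allI[OF F_le]] lim_top])
  have F_bot: "(F \<longlongrightarrow> 0) at_bot"
    by (rule Lim_null_comparison[OF always_eventually[OF allI[OF F_le]] lim_bot])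
  have "(LBINT t=-\<infinity>..\<infinity>. f t) = 0 - 0"
  proof (rule interval_integral_FTC_integrable[of _ _ F])
    show "(F has_vector_derivative f t) (at t)" for t
      unfolding F_def f_def has_real_derivative_iff_has_vector_derivative[symmetric]
      by (auto intro!: derivative_eq_intros dphi H simp: algebra_simps)
    show "isCont f t" for t
      unfolding f_def using contH cont contphi
      by (intro continuous_intros) (auto simp: continuous_on_eq_continuous_at)
    show "set_integrable lborel (einterval (-\<infinity>) \<infinity>) f"
      unfolding f_def set_integrable_def using int1 int2 by simp
    show "((F \<circ> real_of_ereal) \<longlongrightarrow> 0) (at_right (-\<infinity>))"
      using F_bot by (simp add: ereal_tendsto_simps1)
    show "((F \<circ> real_of_ereal) \<longlongrightarrow> 0) (at_left \<infinity>)"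
      using F_top by (simp add: ereal_tendsto_simps1)
  qed simp
  then have "(\<integral>t. f t \<partial>lborel) = 0"
    by (simp add: interval_integral_to_infinity_eq interval_lebesgue_integral_def set_lebesgue_integral_def)
  then show ?thesis
    using int1 int2 by (simp add: f_def integral_std_normal)
qed

text \<open>Chernoff's argument: with \<open>H(t) = \<integral>\<^sub>0\<^sup>t g'\<^sup>2\<close>, Cauchy--Schwarz gives
  \<open>(g t - g 0)\<^sup>2 \<le> t * H t\<close>, and the mean of \<open>t * H t\<close> equals that of \<open>H'\<close>.\<close>

lemma std_normal_poincare:
  fixes g g' :: "real \<Rightarrow> real"
  assumes g: "\<And>t. (g has_real_derivative g' t) (at t)"
    and cont: "continuous_on UNIV g'" and bnd: "\<And>t. \<bar>g' t\<bar> \<le> 1"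
  shows "(\<integral>t. (g t)\<^sup>2 \<partial>std_normal) - (\<integral>t. g t \<partial>std_normal)\<^sup>2 \<le> (\<integral>t. (g' t)\<^sup>2 \<partial>std_normal)"
proof -
  interpret N: prob_space std_normal by (rule prob_space_std_normal)
  have contg: "continuous_on UNIV g"
    using g by (meson DERIV_isCont continuous_at_imp_continuous_on)
  have [measurable]: "g \<in> borel_measurable borel" "g' \<in> borel_measurable borel"
    using contg cont by (auto intro: borel_measurable_continuous_onI)
  have sq1: "(g' t)\<^sup>2 \<le> 1" for t
    using bnd[of t] by (simp add: abs_square_le_1)
  obtain H0 where "\<forall>t. -\<infinity> < ereal t \<longrightarrow> ereal t < \<infinity> \<longrightarrow> (H0 has_vector_derivative (g' t)\<^sup>2) (at t)"
    using einterval_antiderivative[of "-\<infinity>" "\<infinity>" "\<lambda>t. (g' t)\<^sup>2"] cont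
    by (auto simp: continuous_on_eq_continuous_at)
  then have H0: "(H0 has_real_derivative (g' t)\<^sup>2) (at t)" for t
    by (simp add: has_real_derivative_iff_has_vector_derivative)
  define H where "H = (\<lambda>t. H0 t - H0 0)"
  have H: "(H has_real_derivative (g' t)\<^sup>2) (at t)" for t
    unfolding H_def by (auto intro!: derivative_eq_intros H0)
  have [simp]: "H 0 = 0" by (simp add: H_def)
  have mono: "mono f" if "\<And>t. (f has_real_derivative f' t) (at t)" "\<And>t. 0 \<le> f' t" for f f' :: "real \<Rightarrow> real"
  proof (rule monoI)
    fix x y :: real assume "x \<le> y"
    then show "f x \<le> f y"
      by (rule DERIV_nonneg_imp_nondecreasing) (use that in blast)
  qed
  have key: "(g t - g 0)\<^sup>2 \<le> t * H t" for t
  proof (cases "t = 0")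
    case False
    define a where "a = (g t - g 0) / t"
    \<comment> \<open>The derivative is \<open>(g' s - a)\<^sup>2\<close> with \<open>a\<close> the
      mean slope of \<open>g\<close> between 0 and \<open>t\<close>. Nonnegativity of its integral
      is Cauchy-Schwarz; multiplying by \<open>t\<close> afterwards covers both signs of
      \<open>t\<close>.\<close>
    have "mono (\<lambda>s. H s - 2 * a * (g s - g 0) + s * a\<^sup>2)"
      by (rule mono[of _ "\<lambda>s. (g' s - a)\<^sup>2"])
         (auto intro!: derivative_eq_intros H g simp: power2_diff sum_squares_bound)
    then have "0 \<le> t \<Longrightarrow> 0 \<le> H t - 2 * a * (g t - g 0) + t * a\<^sup>2"
      and "t \<le> 0 \<Longrightarrow> H t - 2 * a * (g t - g 0) + t * a\<^sup>2 \<le> 0"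
      using monoD[of _ 0 t] monoD[of _ t 0] by fastforce+
    then have "0 \<le> t * (H t - 2 * a * (g t - g 0) + t * a\<^sup>2)"
      by (cases "0 \<le> t") (auto intro: mult_nonpos_nonpos mult_nonneg_nonneg)
    also have "\<dots> = t * H t - (g t - g 0)\<^sup>2"
      using False by (simp add: a_def field_simps power2_eq_square)
    finally show ?thesis by simp
  qed simp
  have bndH: "\<bar>H t\<bar> \<le> 1 * \<bar>t\<bar>" for t
  proof -
    have "mono H"
      by (rule mono[OF H]) simp
    moreover have "mono (\<lambda>s. s - H s)"
      by (rule mono[of _ "\<lambda>s. 1 - (g' s)\<^sup>2"]) (auto intro!: derivative_eq_intros H simp: sq1)
    ultimately show ?thesis
      using monoD[of H 0 t] monoD[of H t 0] monoD[of "\<lambda>s. s - H s" 0 t] monoD[of "\<lambda>s. s - H s" t 0]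
      by (cases "0 \<le> t") auto
  qed
  have stein: "(\<integral>t. t * H t \<partial>std_normal) = (\<integral>t. (g' t)\<^sup>2 \<partial>std_normal)"
    by (rule std_normal_stein[OF H _ _ bndH]) (use cont sq1 in \<open>auto intro!: continuous_intros\<close>)
  define G where "G = (\<lambda>t. g t - g 0)"
  have [measurable]: "G \<in> borel_measurable borel" by (simp add: G_def)
  have G_le: "(G t)\<^sup>2 \<le> t * H t" for t
    using key[of t] by (simp add: G_def)
  have tH_le: "\<bar>t * H t\<bar> \<le> t\<^sup>2" for t
    using mult_left_mono[OF bndH[of t], of "\<bar>t\<bar>"] by (simp add: abs_mult power2_eq_square)
  have intH: "integrable std_normal (\<lambda>t. t * H t)"
  proof (rule Bochner_Integration.integrable_bound[OF integrable_std_normal_power[of 2]])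
    have "continuous_on UNIV H"
      using H by (meson DERIV_isCont continuous_at_imp_continuous_on)
    then have "H \<in> borel_measurable borel" by (rule borel_measurable_continuous_onI)
    then show "(\<lambda>t. t * H t) \<in> borel_measurable std_normal" by simp
  qed (simp add: tH_le)
  have intG2: "integrable std_normal (\<lambda>t. (G t)\<^sup>2)"
    by (rule Bochner_Integration.integrable_bound[OF intH]) (simp_all add: order_trans[OF G_le abs_ge_self])
  then have intG: "integrable std_normal G"
    by (rule N.square_integrable_imp_integrable[rotated]) simp
  have "(\<integral>t. (g t)\<^sup>2 \<partial>std_normal) = (\<integral>t. (G t)\<^sup>2 + 2 * g 0 * G t + (g 0)\<^sup>2 \<partial>std_normal)"
    by (intro Bochner_Integration.integral_cong) (auto simp: G_def power2_eq_square algebra_simps)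
  also have "\<dots> = (\<integral>t. (G t)\<^sup>2 \<partial>std_normal) + 2 * g 0 * (\<integral>t. G t \<partial>std_normal) + (g 0)\<^sup>2"
    using intG intG2 N.prob_space by simp
  finally have 1: "(\<integral>t. (g t)\<^sup>2 \<partial>std_normal) = (\<integral>t. (G t)\<^sup>2 \<partial>std_normal) + 2 * g 0 * (\<integral>t. G t \<partial>std_normal) + (g 0)\<^sup>2" .
  have "(\<integral>t. g t \<partial>std_normal) = (\<integral>t. G t + g 0 \<partial>std_normal)"
    by (intro Bochner_Integration.integral_cong) (auto simp: G_def)
  also have "\<dots> = (\<integral>t. G t \<partial>std_normal) + g 0"
    using intG N.prob_space by simp
  finally have 2: "(\<integral>t. g t \<partial>std_normal) = (\<integral>t. G t \<partial>std_normal) + g 0" .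
  \<comment> \<open>Shifting by \<open>g 0\<close> does not change the variance, and the variance of
    \<open>G\<close> is at most its second moment.\<close>
  have "(\<integral>t. (g t)\<^sup>2 \<partial>std_normal) - (\<integral>t. g t \<partial>std_normal)\<^sup>2 \<le> (\<integral>t. (G t)\<^sup>2 \<partial>std_normal)"
    unfolding 1 2 by (simp add: power2_eq_square algebra_simps)
  also have "\<dots> \<le> (\<integral>t. t * H t \<partial>std_normal)"
    by (intro integral_mono intG2 intH G_le)
  finally show ?thesis by (simp add: stein)
qed

section \<open>Tensorization of the variance\<close>

lemma (in prob_space) expectation_square_le:
  fixes X :: "'a \<Rightarrow> real"
  assumes "integrable M (\<lambda>x. (X x)\<^sup>2)" and [measurable]: "X \<in> borel_measurable M"
  shows "(expectation X)\<^sup>2 \<le> expectation (\<lambda>x. (X x)\<^sup>2)"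
  using variance_positive[of X] variance_eq[of X] square_integrable_imp_integrable[of X] assms by simp

lemma (in pair_prob_space) integrable_comp_snd:
  fixes f :: "'b \<Rightarrow> real"
  assumes f: "integrable M2 f"
  shows "integrable (M1 \<Otimes>\<^sub>M M2) (\<lambda>p. f (snd p))"
proof (rule Fubini_integrable)
  have [measurable]: "f \<in> borel_measurable M2" using f by auto
  show "(\<lambda>p. f (snd p)) \<in> borel_measurable (M1 \<Otimes>\<^sub>M M2)" by simp
  show "integrable M1 (\<lambda>x. \<integral>y. norm (f (snd (x, y))) \<partial>M2)" by simp
  show "AE x in M1. integrable M2 (\<lambda>y. f (snd (x, y)))" using f by simp
qed

lemma (in pair_prob_space) integrable_comp_fst:
  fixes f :: "'a \<Rightarrow> real"
  assumes f: "integrable M1 f"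
  shows "integrable (M1 \<Otimes>\<^sub>M M2) (\<lambda>p. f (fst p))"
proof (rule Fubini_integrable)
  have [measurable]: "f \<in> borel_measurable M1" using f by auto
  show "(\<lambda>p. f (fst p)) \<in> borel_measurable (M1 \<Otimes>\<^sub>M M2)" by simp
  show "integrable M1 (\<lambda>x. \<integral>y. norm (f (fst (x, y))) \<partial>M2)" 
    using f by (simp add: M2.prob_space)
  show "AE x in M1. integrable M2 (\<lambda>y. f (fst (x, y)))" by simp
qed

text \<open>With \<open>h y\<close> the mean of the slice at \<open>y\<close>,
  \<open>g x - m\<close> is the \<open>y\<close>-average of \<open>f x y - h y\<close>. Jensen in
  \<open>y\<close> and an exchange of the integrals turn its second moment into the average of the
  slice variances.\<close>

lemma (in pair_prob_space) variance_of_mean_le: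
  fixes f :: "'a \<Rightarrow> 'b \<Rightarrow> real"
  assumes [measurable]: "case_prod f \<in> borel_measurable (M1 \<Otimes>\<^sub>M M2)"
    and i2: "integrable (M1 \<Otimes>\<^sub>M M2) (\<lambda>(x, y). (f x y)\<^sup>2)"
    and ix: "\<And>x. x \<in> space M1 \<Longrightarrow> integrable M2 (\<lambda>y. (f x y)\<^sup>2)"
    and iy: "\<And>y. y \<in> space M2 \<Longrightarrow> integrable M1 (\<lambda>x. (f x y)\<^sup>2)"
  shows "(\<integral>x. (\<integral>y. f x y \<partial>M2)\<^sup>2 \<partial>M1) - (\<integral>x. \<integral>y. f x y \<partial>M2 \<partial>M1)\<^sup>2
     \<le> (\<integral>y. (\<integral>x. (f x y)\<^sup>2 \<partial>M1) - (\<integral>x. f x y \<partial>M1)\<^sup>2 \<partial>M2)"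
proof -
  define g where "g = (\<lambda>x. \<integral>y. f x y \<partial>M2)"
  define h where "h = (\<lambda>y. \<integral>x. f x y \<partial>M1)"
  define m where "m = (\<integral>x. g x \<partial>M1)"
  have [measurable]: "g \<in> borel_measurable M1" "h \<in> borel_measurable M2"
    unfolding g_def h_def by measurable
  have i2': "integrable (M1 \<Otimes>\<^sub>M M2) (\<lambda>p. (case_prod f p)\<^sup>2)"
    using i2 by (simp add: case_prod_beta')
  have i1: "integrable (M1 \<Otimes>\<^sub>M M2) (\<lambda>(x, y). f x y)"
    by (rule P.square_integrable_imp_integrable[OF _ i2']) simp
  have ix1: "integrable M2 (f x)" if "x \<in> space M1" for x
    by (rule M2.square_integrable_imp_integrable[OF _ ix[OF that]]) (use that in simp)
  have iy1: "integrable M1 (\<lambda>x. f x y)" if "y \<in> space M2" for y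
    by (rule M1.square_integrable_imp_integrable[OF _ iy[OF that]]) (use that in simp)
  have h_int: "integrable M2 h" and g_int: "integrable M1 g"
    unfolding h_def g_def using integrable_snd[OF i1] integrable_fst[OF i1] by simp_all
  have h_m: "(\<integral>y. h y \<partial>M2) = m"
    unfolding h_def g_def m_def by (rule Fubini_integral[OF i1])
  have h2: "integrable M2 (\<lambda>y. (h y)\<^sup>2)"
  proof (rule Bochner_Integration.integrable_bound[OF integrable_snd[OF i2]])
    show "AE y in M2. norm ((h y)\<^sup>2) \<le> norm (\<integral>x. (f x y)\<^sup>2 \<partial>M1)"
    proof (rule AE_I2)
      fix y assume "y \<in> space M2"
      then have "(h y)\<^sup>2 \<le> (\<integral>x. (f x y)\<^sup>2 \<partial>M1)"
        unfolding h_def by (intro M1.expectation_square_le iy) simp_all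
      then show "norm ((h y)\<^sup>2) \<le> norm (\<integral>x. (f x y)\<^sup>2 \<partial>M1)" by simp
    qed
  qed simp
  have g2: "integrable M1 (\<lambda>x. (g x)\<^sup>2)"
  proof (rule Bochner_Integration.integrable_bound[OF integrable_fst[OF i2]])
    show "AE x in M1. norm ((g x)\<^sup>2) \<le> norm (\<integral>y. (f x y)\<^sup>2 \<partial>M2)"
    proof (rule AE_I2)
      fix x assume "x \<in> space M1"
      then have "(g x)\<^sup>2 \<le> (\<integral>y. (f x y)\<^sup>2 \<partial>M2)"
        unfolding g_def by (intro M2.expectation_square_le ix) simp_all
      then show "norm ((g x)\<^sup>2) \<le> norm (\<integral>y. (f x y)\<^sup>2 \<partial>M2)" by simp
    qed
  qed simp
  have sq: "(a - b)\<^sup>2 \<le> 2 * a\<^sup>2 + 2 * b\<^sup>2" for a b :: real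
    using zero_le_power2[of "a + b"] by (simp add: power2_eq_square algebra_simps)
  have F2: "integrable (M1 \<Otimes>\<^sub>M M2) (\<lambda>(x, y). (f x y - h y)\<^sup>2)"
  proof (rule Bochner_Integration.integrable_bound)
    show "integrable (M1 \<Otimes>\<^sub>M M2) (\<lambda>p. 2 * (case_prod f p)\<^sup>2 + 2 * (h (snd p))\<^sup>2)"
      using i2' integrable_comp_snd[OF h2] by simp
  qed (auto simp: sq)
  have Fx: "integrable M2 (\<lambda>y. (f x y - h y)\<^sup>2)" if "x \<in> space M1" for x
    by (rule Bochner_Integration.integrable_bound[of _ "\<lambda>y. 2 * (f x y)\<^sup>2 + 2 * (h y)\<^sup>2"])
       (use ix[OF that] h2 that in \<open>auto simp: sq\<close>)
  have "(\<integral>x. (g x)\<^sup>2 \<partial>M1) - m\<^sup>2 = (\<integral>x. (g x - m)\<^sup>2 \<partial>M1)"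
    using M1.variance_eq[OF g_int g2] by (simp add: m_def)
  also have "\<dots> \<le> (\<integral>x. (\<integral>y. (f x y - h y)\<^sup>2 \<partial>M2) \<partial>M1)"
  proof (rule integral_mono')
    show "integrable M1 (\<lambda>x. \<integral>y. (f x y - h y)\<^sup>2 \<partial>M2)"
      by (rule integrable_fst[OF F2])
    fix x assume x: "x \<in> space M1"
    have "g x - m = (\<integral>y. f x y - h y \<partial>M2)"
      using ix1[OF x] h_int by (simp add: g_def h_m)
    then show "(g x - m)\<^sup>2 \<le> (\<integral>y. (f x y - h y)\<^sup>2 \<partial>M2)"
      using M2.expectation_square_le[OF Fx[OF x]] x by simp
  qed simp
  also have "\<dots> = (\<integral>y. (\<integral>x. (f x y - h y)\<^sup>2 \<partial>M1) \<partial>M2)"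
    by (rule Fubini_integral[OF F2, symmetric])
  also have "\<dots> = (\<integral>y. (\<integral>x. (f x y)\<^sup>2 \<partial>M1) - (h y)\<^sup>2 \<partial>M2)"
  proof (rule Bochner_Integration.integral_cong[OF refl])
    fix y assume "y \<in> space M2"
    then show "(\<integral>x. (f x y - h y)\<^sup>2 \<partial>M1) = (\<integral>x. (f x y)\<^sup>2 \<partial>M1) - (h y)\<^sup>2"
      using M1.variance_eq[OF iy1 iy] by (simp add: h_def)
  qed
  finally show ?thesis
    by (simp add: m_def h_def g_def)
qed

text \<open>Tailored to induction over coordinates: the measure lives on the whole space, but only
  the derivatives in the directions of \<open>I\<close> are paid for. The bound on the gradient
  makes \<open>f\<close> Lipschitz, so the second moment of \<open>norm x\<close> keeps every
  integral finite.\<close>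

definition poincare :: "'a::euclidean_space set \<Rightarrow> 'a measure \<Rightarrow> bool" where
  "poincare I \<mu> \<longleftrightarrow> prob_space \<mu> \<and> sets \<mu> = sets borel \<and> integrable \<mu> (\<lambda>x. (norm x)\<^sup>2) \<and>
     (\<forall>f G. (\<forall>x. (f has_derivative (\<lambda>h. G x \<bullet> h)) (at x)) \<longrightarrow> continuous_on UNIV G \<longrightarrow>
        (\<forall>x. norm (G x) \<le> 1) \<longrightarrow>
        (\<integral>x. (f x)\<^sup>2 \<partial>\<mu>) - (\<integral>x. f x \<partial>\<mu>)\<^sup>2 \<le> (\<integral>x. (\<Sum>i\<in>I. (G x \<bullet> i)\<^sup>2) \<partial>\<mu>))"

lemma gradient_lipschitz:
  fixes f :: "'a::euclidean_space \<Rightarrow> real"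
  assumes f: "\<And>x. (f has_derivative (\<lambda>h. G x \<bullet> h)) (at x)" and G: "\<And>x. norm (G x) \<le> 1"
  shows "\<bar>f x - f y\<bar> \<le> norm (x - y)"
proof -
  have "norm (f x - f y) \<le> 1 * norm (x - y)"
  proof (rule differentiable_bound[of UNIV])
    show "onorm (\<lambda>h. G z \<bullet> h) \<le> 1" for z
    proof (rule onorm_le)
      fix h
      have "\<bar>G z \<bullet> h\<bar> \<le> norm (G z) * norm h" by (rule Cauchy_Schwarz_ineq2)
      also have "\<dots> \<le> 1 * norm h" using G by (intro mult_right_mono) auto
      finally show "norm (G z \<bullet> h) \<le> 1 * norm h" by simp
    qed
  qed (use f in auto)
  then show ?thesis by simp
qed

text \<open>The variance of \<open>f (t e + y)\<close> is the mean over \<open>t\<close> of the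
  variance in \<open>y\<close>, paid for by the hypothesis on \<open>\<mu>\<close>, plus the
  variance in \<open>t\<close> of the mean over \<open>y\<close>. The latter is at most the average
  over \<open>y\<close> of the variance in \<open>t\<close>, where the one-dimensional inequality
  yields the derivative along \<open>e\<close>.\<close>

lemma poincare_insert:
  fixes \<mu> :: "'a::euclidean_space measure"
  assumes P: "poincare I \<mu>" and e: "norm e = 1" "e \<notin> I" and I: "finite I"
  shows "poincare (insert e I) (distr (std_normal \<Otimes>\<^sub>M \<mu>) borel (\<lambda>(t, y). t *\<^sub>R e + y))"
proof -
  interpret N: prob_space std_normal by (rule prob_space_std_normal)
  interpret \<mu>: prob_space \<mu> using P by (simp add: poincare_def)
  interpret pair_prob_space std_normal \<mu> ..
  have sets_\<mu> [simp, measurable_cong]: "sets \<mu> = sets borel" using P by (simp add: poincare_def)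
  have [simp]: "space \<mu> = UNIV" using sets_eq_imp_space_eq[OF sets_\<mu>] by simp
  have n2: "integrable \<mu> (\<lambda>x. (norm x)\<^sup>2)" using P by (simp add: poincare_def)
  let ?\<Phi> = "\<lambda>(t, y). t *\<^sub>R e + y"
  have \<Phi> [measurable]: "?\<Phi> \<in> borel_measurable (std_normal \<Otimes>\<^sub>M \<mu>)" by measurable
  have tri: "(a + b)\<^sup>2 \<le> 2 * a\<^sup>2 + 2 * b\<^sup>2" for a b :: real
    using zero_le_power2[of "a - b"] by (simp add: power2_eq_square algebra_simps)
  have tri2: "(norm (t *\<^sub>R e + y))\<^sup>2 \<le> 2 * t\<^sup>2 + 2 * (norm y)\<^sup>2" for t y
  proof -
    have "(norm (t *\<^sub>R e + y))\<^sup>2 \<le> (\<bar>t\<bar> + norm y)\<^sup>2"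
      using norm_triangle_ineq[of "t *\<^sub>R e" y] e by (intro power_mono) auto
    also have "\<dots> \<le> 2 * \<bar>t\<bar>\<^sup>2 + 2 * (norm y)\<^sup>2" by (rule tri)
    finally show ?thesis by simp
  qed
  have t2: "integrable std_normal (\<lambda>t. t\<^sup>2)" by (rule integrable_std_normal_power)
  have N2: "integrable (std_normal \<Otimes>\<^sub>M \<mu>) (\<lambda>p. 2 * (fst p)\<^sup>2 + 2 * (norm (snd p))\<^sup>2)"
    using integrable_comp_fst[OF t2] integrable_comp_snd[OF n2] by simp
  have norm2: "integrable (std_normal \<Otimes>\<^sub>M \<mu>) (\<lambda>p. (norm (?\<Phi> p))\<^sup>2)"
    by (rule Bochner_Integration.integrable_bound[OF N2]) (auto simp: tri2)
  have var: "(\<integral>p. (f (?\<Phi> p))\<^sup>2 \<partial>(std_normal \<Otimes>\<^sub>M \<mu>)) - (\<integral>p. f (?\<Phi> p) \<partial>(std_normal \<Otimes>\<^sub>M \<mu>))\<^sup>2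
     \<le> (\<integral>p. (\<Sum>i\<in>insert e I. (G (?\<Phi> p) \<bullet> i)\<^sup>2) \<partial>(std_normal \<Otimes>\<^sub>M \<mu>))"
    if f: "\<And>x. (f has_derivative (\<lambda>h. G x \<bullet> h)) (at x)" and contG: "continuous_on UNIV G"
      and G: "\<And>x. norm (G x) \<le> 1" for f G
  proof -
    have contf: "continuous_on UNIV f"
      using f by (meson has_derivative_continuous continuous_at_imp_continuous_on)
    have [measurable]: "f \<in> borel_measurable borel" "G \<in> borel_measurable borel"
      using contf contG by (auto intro: borel_measurable_continuous_onI)
    have f_bnd: "(f x)\<^sup>2 \<le> 2 * (f 0)\<^sup>2 + 2 * (norm x)\<^sup>2" for x
    proof -
      have "\<bar>f x\<bar> \<le> \<bar>f 0\<bar> + norm x"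
        using gradient_lipschitz[OF f G, of x 0] by simp
      then have "(f x)\<^sup>2 \<le> (\<bar>f 0\<bar> + norm x)\<^sup>2"
        by (metis abs_ge_zero power2_abs power_mono)
      then show ?thesis using tri[of "\<bar>f 0\<bar>" "norm x"] by simp
    qed
    have f_bnd2: "(f (t *\<^sub>R e + y))\<^sup>2 \<le> 2 * (f 0)\<^sup>2 + 4 * t\<^sup>2 + 4 * (norm y)\<^sup>2" for t y
      using f_bnd[of "t *\<^sub>R e + y"] tri2[of t y] by linarith
    have bess: "(G x \<bullet> i)\<^sup>2 \<le> (norm i)\<^sup>2" for x i
    proof -
      have "\<bar>G x \<bullet> i\<bar> \<le> 1 * norm i"
        using Cauchy_Schwarz_ineq2[of "G x" i] mult_right_mono[OF G[of x] norm_ge_zero[of i]] by linarith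
      then show ?thesis by (metis abs_ge_zero mult_1 power2_abs power_mono)
    qed
    have f2: "integrable (std_normal \<Otimes>\<^sub>M \<mu>) (\<lambda>(t, y). (f (t *\<^sub>R e + y))\<^sup>2)"
    proof (rule Bochner_Integration.integrable_bound)
      show "integrable (std_normal \<Otimes>\<^sub>M \<mu>) (\<lambda>p. 2 * (f 0)\<^sup>2 + 2 * (norm (?\<Phi> p))\<^sup>2)"
        using norm2 by simp
    qed (auto simp: f_bnd)
    have ft: "integrable \<mu> (\<lambda>y. (f (t *\<^sub>R e + y))\<^sup>2)" for t
    proof (rule Bochner_Integration.integrable_bound)
      show "integrable \<mu> (\<lambda>y. 2 * (f 0)\<^sup>2 + 4 * t\<^sup>2 + 4 * (norm y)\<^sup>2)"
        using n2 by simp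
    qed (auto simp: f_bnd2)
    have fy: "integrable std_normal (\<lambda>t. (f (t *\<^sub>R e + y))\<^sup>2)" for y
    proof (rule Bochner_Integration.integrable_bound)
      show "integrable std_normal (\<lambda>t. 2 * (f 0)\<^sup>2 + 4 * t\<^sup>2 + 4 * (norm y)\<^sup>2)"
        using t2 by simp
    qed (auto simp: f_bnd2)
    have f1: "integrable (std_normal \<Otimes>\<^sub>M \<mu>) (\<lambda>(t, y). f (t *\<^sub>R e + y))"
      by (rule P.square_integrable_imp_integrable) (use f2 in \<open>simp_all add: case_prod_beta'\<close>)
    have Gi: "integrable (std_normal \<Otimes>\<^sub>M \<mu>) (\<lambda>(t, y). (G (t *\<^sub>R e + y) \<bullet> i)\<^sup>2)" for i
      by (rule P.integrable_const_bound[of _ "(norm i)\<^sup>2"]) (auto simp: bess)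
    have GI: "integrable (std_normal \<Otimes>\<^sub>M \<mu>) (\<lambda>(t, y). \<Sum>i\<in>I. (G (t *\<^sub>R e + y) \<bullet> i)\<^sup>2)"
      using Gi by (simp add: case_prod_beta')
    have mean2: "integrable std_normal (\<lambda>t. (\<integral>y. f (t *\<^sub>R e + y) \<partial>\<mu>)\<^sup>2)"
    proof (rule Bochner_Integration.integrable_bound[OF integrable_fst[OF f2]])
      show "AE t in std_normal. norm ((\<integral>y. f (t *\<^sub>R e + y) \<partial>\<mu>)\<^sup>2) \<le> norm (\<integral>y. (f (t *\<^sub>R e + y))\<^sup>2 \<partial>\<mu>)"
        using \<mu>.expectation_square_le[OF ft] by (simp add: abs_of_nonneg integral_nonneg)
    qed simp
    have slice_y: "(\<integral>y. (f (t *\<^sub>R e + y))\<^sup>2 \<partial>\<mu>) - (\<integral>y. f (t *\<^sub>R e + y) \<partial>\<mu>)\<^sup>2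
        \<le> (\<integral>y. (\<Sum>i\<in>I. (G (t *\<^sub>R e + y) \<bullet> i)\<^sup>2) \<partial>\<mu>)" for t
    proof -
      have "((\<lambda>y. f (t *\<^sub>R e + y)) has_derivative (\<lambda>h. G (t *\<^sub>R e + y) \<bullet> h)) (at y)" for y
        using has_derivative_compose[OF has_derivative_add[OF has_derivative_const has_derivative_ident] f,
            of "t *\<^sub>R e" y UNIV] by simp
      moreover have "continuous_on UNIV (\<lambda>y. G (t *\<^sub>R e + y))"
        by (intro continuous_on_compose2[OF contG] continuous_intros) auto
      ultimately show ?thesis
        using P G by (simp add: poincare_def)
    qed
    have slice_t: "(\<integral>t. (f (t *\<^sub>R e + y))\<^sup>2 \<partial>std_normal) - (\<integral>t. f (t *\<^sub>R e + y) \<partial>std_normal)\<^sup>2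
        \<le> (\<integral>t. (G (t *\<^sub>R e + y) \<bullet> e)\<^sup>2 \<partial>std_normal)" for y
    proof (rule std_normal_poincare)
      show "((\<lambda>t. f (t *\<^sub>R e + y)) has_real_derivative G (t *\<^sub>R e + y) \<bullet> e) (at t)" for t
        using has_derivative_compose[OF has_derivative_add[OF has_derivative_scaleR_left[OF has_derivative_ident]
              has_derivative_const] f, of e y t UNIV]
        by (simp add: has_field_derivative_def mult_commute_abs)
      show "continuous_on UNIV (\<lambda>t. G (t *\<^sub>R e + y) \<bullet> e)"
        by (intro continuous_intros continuous_on_compose2[OF contG]) auto
      show "\<bar>G (t *\<^sub>R e + y) \<bullet> e\<bar> \<le> 1" for t
        using bess[of "t *\<^sub>R e + y" e] e by (simp add: abs_square_le_1)
    qed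
    have "(\<integral>t. (\<integral>y. f (t *\<^sub>R e + y) \<partial>\<mu>)\<^sup>2 \<partial>std_normal) - (\<integral>t. \<integral>y. f (t *\<^sub>R e + y) \<partial>\<mu> \<partial>std_normal)\<^sup>2
      \<le> (\<integral>y. (\<integral>t. (f (t *\<^sub>R e + y))\<^sup>2 \<partial>std_normal) - (\<integral>t. f (t *\<^sub>R e + y) \<partial>std_normal)\<^sup>2 \<partial>\<mu>)"
      by (rule variance_of_mean_le) (use f2 ft fy in auto)
    also have "\<dots> \<le> (\<integral>y. (\<integral>t. (G (t *\<^sub>R e + y) \<bullet> e)\<^sup>2 \<partial>std_normal) \<partial>\<mu>)"
      by (rule integral_mono') (use slice_t integrable_snd[OF Gi] in \<open>auto intro!: integral_nonneg\<close>)
    also have "\<dots> = (\<integral>p. (G (?\<Phi> p) \<bullet> e)\<^sup>2 \<partial>(std_normal \<Otimes>\<^sub>M \<mu>))"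
      using integral_snd[OF Gi] by (simp add: case_prod_beta')
    finally have A: "(\<integral>t. (\<integral>y. f (t *\<^sub>R e + y) \<partial>\<mu>)\<^sup>2 \<partial>std_normal) - (\<integral>t. \<integral>y. f (t *\<^sub>R e + y) \<partial>\<mu> \<partial>std_normal)\<^sup>2
      \<le> (\<integral>p. (G (?\<Phi> p) \<bullet> e)\<^sup>2 \<partial>(std_normal \<Otimes>\<^sub>M \<mu>))" .
    have "(\<integral>t. (\<integral>y. (f (t *\<^sub>R e + y))\<^sup>2 \<partial>\<mu>) \<partial>std_normal) - (\<integral>t. (\<integral>y. f (t *\<^sub>R e + y) \<partial>\<mu>)\<^sup>2 \<partial>std_normal)
      = (\<integral>t. (\<integral>y. (f (t *\<^sub>R e + y))\<^sup>2 \<partial>\<mu>) - (\<integral>y. f (t *\<^sub>R e + y) \<partial>\<mu>)\<^sup>2 \<partial>std_normal)"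
      using integrable_fst[OF f2] mean2 by simp
    also have "\<dots> \<le> (\<integral>t. (\<integral>y. (\<Sum>i\<in>I. (G (t *\<^sub>R e + y) \<bullet> i)\<^sup>2) \<partial>\<mu>) \<partial>std_normal)"
      by (rule integral_mono') (use slice_y integrable_fst[OF GI] in \<open>auto intro!: Bochner_Integration.integral_nonneg sum_nonneg\<close>)
    also have "\<dots> = (\<integral>p. (\<Sum>i\<in>I. (G (?\<Phi> p) \<bullet> i)\<^sup>2) \<partial>(std_normal \<Otimes>\<^sub>M \<mu>))"
      using integral_fst[OF GI] by (simp add: case_prod_beta')
    finally have B: "(\<integral>t. (\<integral>y. (f (t *\<^sub>R e + y))\<^sup>2 \<partial>\<mu>) \<partial>std_normal) - (\<integral>t. (\<integral>y. f (t *\<^sub>R e + y) \<partial>\<mu>)\<^sup>2 \<partial>std_normal)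
      \<le> (\<integral>p. (\<Sum>i\<in>I. (G (?\<Phi> p) \<bullet> i)\<^sup>2) \<partial>(std_normal \<Otimes>\<^sub>M \<mu>))" .
    have s1: "(\<integral>p. (\<Sum>i\<in>insert e I. (G (?\<Phi> p) \<bullet> i)\<^sup>2) \<partial>(std_normal \<Otimes>\<^sub>M \<mu>))
       = (\<integral>p. (G (?\<Phi> p) \<bullet> e)\<^sup>2 \<partial>(std_normal \<Otimes>\<^sub>M \<mu>)) + (\<integral>p. (\<Sum>i\<in>I. (G (?\<Phi> p) \<bullet> i)\<^sup>2) \<partial>(std_normal \<Otimes>\<^sub>M \<mu>))"
      using Gi[of e] GI e I by (simp add: case_prod_beta')
    have s2: "(\<integral>t. (\<integral>y. (f (t *\<^sub>R e + y))\<^sup>2 \<partial>\<mu>) \<partial>std_normal) = (\<integral>p. (f (?\<Phi> p))\<^sup>2 \<partial>(std_normal \<Otimes>\<^sub>M \<mu>))"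
      using integral_fst[OF f2] by (simp add: case_prod_beta')
    have s3: "(\<integral>t. \<integral>y. f (t *\<^sub>R e + y) \<partial>\<mu> \<partial>std_normal) = (\<integral>p. f (?\<Phi> p) \<partial>(std_normal \<Otimes>\<^sub>M \<mu>))"
      using integral_fst[OF f1] by (simp add: case_prod_beta')
    \<comment> \<open>The second moment of the means over \<open>y\<close> occurs with opposite
      signs in \<open>A\<close> and \<open>B\<close> and cancels in their sum.\<close>
    show ?thesis using A B unfolding s1 s2 s3 by linarith
  qed
  show ?thesis
    unfolding poincare_def
  proof (intro conjI allI impI)
    show "prob_space (distr (std_normal \<Otimes>\<^sub>M \<mu>) borel ?\<Phi>)"
      by (rule P.prob_space_distr) measurable
    show "integrable (distr (std_normal \<Otimes>\<^sub>M \<mu>) borel ?\<Phi>) (\<lambda>x. (norm x)\<^sup>2)"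
      by (subst integrable_distr_eq) (simp_all add: norm2)
    fix f G
    assume f: "\<forall>x. (f has_derivative (\<lambda>h. G x \<bullet> h)) (at x)" and G: "continuous_on UNIV G" "\<forall>x. norm (G x :: 'a) \<le> 1"
    have [measurable]: "f \<in> borel_measurable borel"
      using f by (meson borel_measurable_continuous_onI has_derivative_continuous continuous_at_imp_continuous_on)
    have [measurable]: "G \<in> borel_measurable borel"
      using G by (simp add: borel_measurable_continuous_onI)
    show "(\<integral>x. (f x)\<^sup>2 \<partial>distr (std_normal \<Otimes>\<^sub>M \<mu>) borel ?\<Phi>) - (\<integral>x. f x \<partial>distr (std_normal \<Otimes>\<^sub>M \<mu>) borel ?\<Phi>)\<^sup>2
      \<le> (\<integral>x. (\<Sum>i\<in>insert e I. (G x \<bullet> i)\<^sup>2) \<partial>distr (std_normal \<Otimes>\<^sub>M \<mu>) borel ?\<Phi>)"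
      using var[OF f[rule_format] G(1) G(2)[rule_format]]
      by (subst (1 2 3) integral_distr) simp_all
  qed simp
qed

lemma distr_PiM_sum_insert:
  fixes I :: "'a::euclidean_space set"
  assumes "finite I" "e \<notin> I"
  shows "distr (\<Pi>\<^sub>M b\<in>insert e I. std_normal) borel (\<lambda>f. \<Sum>b\<in>insert e I. f b *\<^sub>R b)
    = distr (std_normal \<Otimes>\<^sub>M distr (\<Pi>\<^sub>M b\<in>I. std_normal) borel (\<lambda>f. \<Sum>b\<in>I. f b *\<^sub>R b)) borel (\<lambda>(t, y). t *\<^sub>R e + y)"
proof -
  let ?s = "\<lambda>I f. \<Sum>b\<in>I. f b *\<^sub>R b :: 'a"
  let ?P = "\<lambda>I::'a set. \<Pi>\<^sub>M b\<in>I. std_normal"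
  interpret N: prob_space std_normal by (rule prob_space_std_normal)
  interpret P: prob_space "?P I"
    by (intro prob_space_PiM prob_space_std_normal)
  let ?L = "distr (?P I) borel (?s I)"
  interpret L: prob_space ?L by (rule P.prob_space_distr) measurable
  have upd: "?s (insert e I) (X(e := t)) = t *\<^sub>R e + ?s I X" for t X
  proof -
    have "?s I (X(e := t)) = ?s I X" using assms by (intro sum.cong) auto
    then show ?thesis using assms by simp
  qed
  have meas: "(\<lambda>(t, X). X(e := t)) \<in> std_normal \<Otimes>\<^sub>M ?P I \<rightarrow>\<^sub>M ?P (insert e I)"
  proof (rule measurable_PiM_single')
    fix i assume "i \<in> insert e I"
    then show "(\<lambda>\<omega>. (case \<omega> of (t, X) \<Rightarrow> X(e := t)) i) \<in> std_normal \<Otimes>\<^sub>M ?P I \<rightarrow>\<^sub>M std_normal"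
      using measurable_compose[OF measurable_snd measurable_component_singleton[of i I "\<lambda>_. std_normal"]]
      by (cases "i = e") (simp_all add: case_prod_beta')
  qed (auto simp: space_pair_measure space_PiM PiE_def extensional_def Pi_def)
  have sm [measurable]: "?s J \<in> borel_measurable (?P J)" if "finite J" for J
    by measurable
  have "distr (?P (insert e I)) borel (?s (insert e I))
    = distr (distr (std_normal \<Otimes>\<^sub>M ?P I) (?P (insert e I)) (\<lambda>(t, X). X(e := t))) borel (?s (insert e I))"
    using distr_pair_PiM_eq_PiM[of I "\<lambda>_. std_normal" e] prob_space_std_normal by simp
  also have "\<dots> = distr (std_normal \<Otimes>\<^sub>M ?P I) borel (?s (insert e I) \<circ> (\<lambda>(t, X). X(e := t)))"
    by (rule distr_distr[OF sm meas]) (use assms in simp)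
  also have "?s (insert e I) \<circ> (\<lambda>(t, X). X(e := t)) = (\<lambda>(t, y). t *\<^sub>R e + y) \<circ> (\<lambda>(t, X). (t, ?s I X))"
    by (simp add: fun_eq_iff upd case_prod_beta' del: fun_upd_apply)
  also have "distr (std_normal \<Otimes>\<^sub>M ?P I) borel \<dots>
    = distr (distr (std_normal \<Otimes>\<^sub>M ?P I) (std_normal \<Otimes>\<^sub>M borel) (\<lambda>(t, X). (t, ?s I X))) borel (\<lambda>(t, y). t *\<^sub>R e + y)"
    by (rule distr_distr[symmetric]) measurable
  also have "distr (std_normal \<Otimes>\<^sub>M ?P I) (std_normal \<Otimes>\<^sub>M borel) (\<lambda>(t, X). (t, ?s I X))
     = distr std_normal std_normal (\<lambda>t. t) \<Otimes>\<^sub>M ?L"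
    by (rule pair_measure_distr[symmetric]) (auto intro: L.sigma_finite_measure_axioms)
  finally show ?thesis by (simp add: distr_id2)
qed

text \<open>Coordinates are switched on one at a time. With none, the measure is the point mass at
  0, where every variance vanishes.\<close>

lemma poincare_gauss_aux:
  fixes I :: "'a::euclidean_space set"
  assumes "finite I" "\<And>i. i \<in> I \<Longrightarrow> norm i = 1"
  shows "poincare I (distr (\<Pi>\<^sub>M b\<in>I. std_normal) borel (\<lambda>f. \<Sum>b\<in>I. f b *\<^sub>R b))"
  using assms
proof (induction I)
  case empty
  interpret P: prob_space "\<Pi>\<^sub>M b\<in>({}::'a set). std_normal"
    by (intro prob_space_PiM prob_space_std_normal)
  define \<delta> where "\<delta> = distr (\<Pi>\<^sub>M b\<in>({}::'a set). std_normal) borel (\<lambda>f. 0 :: 'a)"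
  have \<delta>: "(\<integral>x. f x \<partial>\<delta>) = f 0" if "f \<in> borel_measurable borel" for f :: "'a \<Rightarrow> real"
    using that by (simp add: \<delta>_def integral_return)
  have "poincare {} \<delta>"
    unfolding poincare_def
  proof (intro conjI allI impI)
    show "prob_space \<delta>" unfolding \<delta>_def by (rule P.prob_space_distr) simp
    show "sets \<delta> = sets borel" by (simp add: \<delta>_def)
    show "integrable \<delta> (\<lambda>x. (norm x)\<^sup>2)"
      unfolding \<delta>_def by (subst integrable_distr_eq) auto
    fix f :: "'a \<Rightarrow> real" and G
    assume "\<forall>x. (f has_derivative (\<lambda>h. G x \<bullet> h)) (at x)"
    then have "f \<in> borel_measurable borel"
      by (meson borel_measurable_continuous_onI has_derivative_continuous continuous_at_imp_continuous_on)
    then show "(\<integral>x. (f x)\<^sup>2 \<partial>\<delta>) - (\<integral>x. f x \<partial>\<delta>)\<^sup>2 \<le> (\<integral>x. (\<Sum>i\<in>{}. (G x \<bullet> i)\<^sup>2) \<partial>\<delta>)"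
      by (simp add: \<delta>)
  qed
  then show ?case
    by (simp only: \<delta>_def sum.empty)
next
  case (insert e I)
  then show ?case
    using poincare_insert[OF insert.IH, of e] unfolding distr_PiM_sum_insert[OF insert.hyps] by simp
qed

lemma poincare_gauss: "poincare Basis (gauss :: 'a::euclidean_space measure)"
  unfolding gauss_def by (rule poincare_gauss_aux) auto

lemma integrable_norm2_gauss: "integrable (gauss :: 'a::euclidean_space measure) (\<lambda>x. (norm x)\<^sup>2)"
  using poincare_gauss[where 'a='a] by (simp add: poincare_def)

lemma gauss_poincare:
  fixes f :: "'a::euclidean_space \<Rightarrow> real"
  assumes f: "\<And>x. (f has_derivative (\<lambda>h. G x \<bullet> h)) (at x)" and contG: "continuous_on UNIV G"
    and G: "\<And>x. norm (G x) \<le> 1"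
  shows "(\<integral>x. (f x)\<^sup>2 \<partial>gauss) - (\<integral>x. f x \<partial>gauss)\<^sup>2 \<le> 1"
proof -
  interpret prob_space "gauss :: 'a measure" by (rule prob_space_gauss)
  have le: "(\<Sum>i\<in>Basis. (G x \<bullet> i)\<^sup>2) \<le> 1" for x
  proof -
    have "(\<Sum>i\<in>Basis. (G x \<bullet> i)\<^sup>2) = (norm (G x))\<^sup>2"
      unfolding power2_norm_eq_inner euclidean_inner[of "G x" "G x"] by (simp add: power2_eq_square)
    then show ?thesis using G[of x] by (simp add: abs_square_le_1)
  qed
  have "(\<integral>x. (f x)\<^sup>2 \<partial>gauss) - (\<integral>x. f x \<partial>gauss)\<^sup>2 \<le> (\<integral>x. (\<Sum>i\<in>Basis. (G x \<bullet> i)\<^sup>2) \<partial>gauss)"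
    using poincare_gauss[where 'a='a] f contG G unfolding poincare_def by blast
  also have "\<dots> \<le> (\<integral>x. 1 \<partial>(gauss :: 'a measure))"
    by (rule integral_mono') (use le in auto)
  finally show ?thesis using prob_space by simp
qed

text \<open>A norm and a maximum are not differentiable, so the inequality is extended to uniform
  limits of continuously differentiable functions with gradient at most 1. An approximation within
  \<open>d\<close> gives variance at most \<open>(1 + d)\<^sup>2\<close>; then \<open>d\<close>
  tends to 0.\<close>

lemma gauss_variance_le_limit:
  fixes f :: "'a::euclidean_space \<Rightarrow> real"
  assumes [measurable]: "f \<in> borel_measurable borel"
    and appr: "\<And>d. d > 0 \<Longrightarrow> \<exists>h G. (\<forall>x. (h has_derivative (\<lambda>v. G x \<bullet> v)) (at x)) \<and> continuous_on UNIV G \<and>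
        (\<forall>x. norm (G x) \<le> 1) \<and> (\<forall>x. \<bar>f x - h x\<bar> \<le> d)"
  shows "integrable gauss (\<lambda>x. (f x)\<^sup>2)" (is ?int) and "integrable gauss f"
    and "(\<integral>x. (f x)\<^sup>2 \<partial>gauss) - (\<integral>x. f x \<partial>gauss)\<^sup>2 \<le> 1"
proof -
  interpret prob_space "gauss :: 'a measure" by (rule prob_space_gauss)
  have tri: "(a + b)\<^sup>2 \<le> 2 * a\<^sup>2 + 2 * b\<^sup>2" for a b :: real
    using zero_le_power2[of "a - b"] by (simp add: power2_eq_square algebra_simps)
  have sq_int: "integrable gauss (\<lambda>x. (h x)\<^sup>2)" 
    if h: "\<And>x. \<bar>h x\<bar> \<le> c + norm x" "h \<in> borel_measurable borel" for h :: "'a \<Rightarrow> real" and c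
  proof (rule Bochner_Integration.integrable_bound)
    show "integrable gauss (\<lambda>x::'a. 2 * c\<^sup>2 + 2 * (norm x)\<^sup>2)"
      using integrable_norm2_gauss[where 'a='a] by simp
    have "(h x)\<^sup>2 \<le> 2 * c\<^sup>2 + 2 * (norm x)\<^sup>2" for x
      using power_mono[OF h(1)[of x] abs_ge_zero, of 2] tri[of c "norm x"] by simp
    then show "AE x in gauss. norm ((h x)\<^sup>2) \<le> norm (2 * c\<^sup>2 + 2 * (norm x)\<^sup>2)"
      by simp
  qed (use h in measurable)
  have bnd: "\<bar>f x\<bar> \<le> d + \<bar>h 0\<bar> + norm x"
    if "\<forall>x. (h has_derivative (\<lambda>v. G x \<bullet> v)) (at x)" "\<forall>x. norm (G x) \<le> 1" "\<forall>x. \<bar>f x - h x\<bar> \<le> d" 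
    for h G d x
    using gradient_lipschitz[of h G x 0] that(1,2) that(3)[rule_format, of x] by auto
  obtain h G where "\<forall>x. (h has_derivative (\<lambda>v. G x \<bullet> v)) (at x)" "\<forall>x. norm (G x) \<le> 1" "\<forall>x. \<bar>f x - h x\<bar> \<le> 1"
    using appr[of 1] by auto
  from bnd[OF this] show f2: ?int
    by (rule sq_int) simp
  then show f1: "integrable gauss f"
    by (rule square_integrable_imp_integrable[rotated]) simp
  have main: "variance f \<le> (1 + d)\<^sup>2" if d: "d > 0" for d
  proof -
    obtain h G where h: "\<And>x. (h has_derivative (\<lambda>v. G x \<bullet> v)) (at x)" "continuous_on UNIV G"
        "\<And>x. norm (G x) \<le> 1" "\<And>x. \<bar>f x - h x\<bar> \<le> d"
      using appr[OF d] by metis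
    have [measurable]: "h \<in> borel_measurable borel"
      using h(1) by (meson borel_measurable_continuous_onI has_derivative_continuous continuous_at_imp_continuous_on)
    have "\<bar>h x\<bar> \<le> \<bar>h 0\<bar> + norm x" for x
      using gradient_lipschitz[OF h(1,3), of x 0] by simp
    then have h2: "integrable gauss (\<lambda>x. (h x)\<^sup>2)" by (rule sq_int) simp
    then have h1: "integrable gauss h"
      by (rule square_integrable_imp_integrable[rotated]) simp
    \<comment> \<open>Centering at the mean of \<open>h\<close> instead of that of \<open>f\<close>
      can only increase the second moment, and it brings in the variance of
      \<open>h\<close>.\<close>
    define m where "m = expectation h"
    have "0 \<le> (expectation f - m)\<^sup>2" by simp
    then have "variance f \<le> expectation (\<lambda>x. (f x)\<^sup>2) - 2 * m * expectation f + m\<^sup>2"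
      unfolding variance_eq[OF f1 f2] by (simp add: power2_eq_square algebra_simps)
    also have "\<dots> = expectation (\<lambda>x. (f x)\<^sup>2 - 2 * m * f x + m\<^sup>2)"
      using f1 f2 prob_space by simp
    also have "\<dots> \<le> expectation (\<lambda>x. (1 + d) * (h x - m)\<^sup>2 + (1 + 1 / d) * d\<^sup>2)"
    proof (rule integral_mono)
      show "integrable gauss (\<lambda>x. (f x)\<^sup>2 - 2 * m * f x + m\<^sup>2)" using f1 f2 by simp
      show "integrable gauss (\<lambda>x. (1 + d) * (h x - m)\<^sup>2 + (1 + 1 / d) * d\<^sup>2)"
        using h1 h2 by (simp add: power2_diff)
      fix x
      have "(f x - h x)\<^sup>2 \<le> d\<^sup>2"
        using h(4)[of x] by (metis abs_ge_zero power2_abs power_mono)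
      then have k: "(1 + 1 / d) * (f x - h x)\<^sup>2 \<le> (1 + 1 / d) * d\<^sup>2"
        using d by (intro mult_left_mono) auto
      \<comment> \<open>Young's inequality with weight \<open>d\<close>: \<open>(p + q)\<^sup>2
        \<le> (1 + d) p\<^sup>2 + (1 + 1 / d) q\<^sup>2\<close>. With \<open>q\<close> at most
        \<open>d\<close>, the total \<open>(1 + d) + (1 + 1 / d) d\<^sup>2\<close> is exactly
        \<open>(1 + d)\<^sup>2\<close>.\<close>
      have "0 \<le> (d * (h x - m) - (f x - h x))\<^sup>2 / d" using d by simp
      also have "\<dots> = (1 + d) * (h x - m)\<^sup>2 + (1 + 1 / d) * (f x - h x)\<^sup>2 - (f x - m)\<^sup>2"
        using d by (simp add: field_simps power2_eq_square)
      finally show "(f x)\<^sup>2 - 2 * m * f x + m\<^sup>2 \<le> (1 + d) * (h x - m)\<^sup>2 + (1 + 1 / d) * d\<^sup>2"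
        using k by (simp add: power2_eq_square algebra_simps)
    qed
    also have "\<dots> = (1 + d) * variance h + (1 + 1 / d) * d\<^sup>2"
    proof -
      have "integrable gauss (\<lambda>x. (h x - m)\<^sup>2)" using h1 h2 by (simp add: power2_diff)
      then show ?thesis using prob_space by (simp add: m_def)
    qed
    also have "\<dots> \<le> (1 + d) * 1 + (1 + 1 / d) * d\<^sup>2"
      using gauss_poincare[OF h(1-3)] d unfolding variance_eq[OF h1 h2]
      by (intro add_right_mono mult_left_mono) auto
    also have "\<dots> = (1 + d)\<^sup>2"
      using d by (simp add: field_simps power2_eq_square)
    finally show ?thesis .
  qed
  have "variance f \<le> 1"
  proof (rule tendsto_lowerbound)
    show "((\<lambda>d::real. (1 + d)\<^sup>2) \<longlongrightarrow> 1) (at_right 0)"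
      by (auto intro!: tendsto_eq_intros)
    show "\<forall>\<^sub>F d in at_right 0. variance f \<le> (1 + d)\<^sup>2"
      using main by (auto simp: eventually_at_right_field intro: exI[of _ 1])
  qed simp
  then show "(\<integral>x. (f x)\<^sup>2 \<partial>gauss) - (\<integral>x. f x \<partial>gauss)\<^sup>2 \<le> 1"
    using variance_eq[OF f1 f2] by simp
qed

subsection \<open>Gaussian moments\<close>

lemma gauss_real: "(gauss :: real measure) = std_normal_distribution"
  unfolding gauss_density by (simp add: std_normal_density_def)

lemma distr_gauss_inner:
  fixes u :: "'a::euclidean_space"
  assumes "norm u = 1"
  shows "distr gauss borel (\<lambda>z. z \<bullet> u) = std_normal_distribution"
proof -
  have "distr gauss borel (\<lambda>z. z \<bullet> u) = (gauss :: real measure)"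
    using assms
    by (intro gauss_coisometry[where T' = "\<lambda>t. t *\<^sub>R u"])
       (auto intro!: linearI simp: inner_simps dot_square_norm)
  then show ?thesis by (simp add: gauss_real)
qed

lemma gauss_inner_moments:
  fixes u :: "'a::euclidean_space"
  assumes u: "norm u = 1"
  shows "integrable gauss (\<lambda>z. z \<bullet> u)" and "(\<integral>z. z \<bullet> u \<partial>gauss) = 0"
    and "integrable gauss (\<lambda>z. (z \<bullet> u)\<^sup>2)" and "(\<integral>z. (z \<bullet> u)\<^sup>2 \<partial>gauss) = 1"
proof -
  have eq: "(\<integral>z. f (z \<bullet> u) \<partial>gauss) = (\<integral>t. f t \<partial>std_normal_distribution)"
    "integrable gauss (\<lambda>z. f (z \<bullet> u)) \<longleftrightarrow> integrable std_normal_distribution f"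
    if "f \<in> borel_measurable borel" for f :: "real \<Rightarrow> real"
    using that unfolding distr_gauss_inner[OF u, symmetric]
    by (auto simp: integral_distr integrable_distr_eq)
  show "integrable gauss (\<lambda>z. z \<bullet> u)"
    using eq(2)[of "\<lambda>t. t"] integrable_std_normal_power[of 1] by simp
  show "integrable gauss (\<lambda>z. (z \<bullet> u)\<^sup>2)"
    using eq(2)[of "\<lambda>t. t\<^sup>2"] integrable_std_normal_power[of 2] by simp
  show "(\<integral>z. z \<bullet> u \<partial>gauss) = 0"
    using eq(1)[of "\<lambda>t. t"] integral_std_normal_moment_odd[of 0] by (simp add: integral_std_normal)
  show "(\<integral>z. (z \<bullet> u)\<^sup>2 \<partial>gauss) = 1"
    using eq(1)[of "\<lambda>t. t\<^sup>2"] integral_std_normal_moment_even[of 1]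
    by (simp add: integral_std_normal fact_2)
qed

lemma gauss_norm_moment:
  "(\<integral>z. (norm z)\<^sup>2 \<partial>(gauss :: 'a::euclidean_space measure)) = DIM('a)"
proof -
  have "(norm z)\<^sup>2 = (\<Sum>b\<in>Basis. (z \<bullet> b)\<^sup>2)" for z :: 'a
    unfolding power2_norm_eq_inner euclidean_inner[of z z] by (simp add: power2_eq_square)
  then show ?thesis
    by (simp add: gauss_inner_moments)
qed

text \<open>Serves twice: two tied codewords, and a residual that vanishes exactly, each confine the
  design to a hyperplane.\<close>

lemma AE_gauss_hyperplane:
  fixes v :: "'a::euclidean_space"
  assumes "v \<noteq> 0"
  shows "AE z in gauss. v \<bullet> z \<noteq> k"
proof -
  have "negligible {z. v \<bullet> z = k}"
    using assms by (intro negligible_hyperplane) auto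
  then have "{z. v \<bullet> z = k} \<in> null_sets lborel"
    by (simp add: negligible_iff_null_sets null_sets_completion_iff)
  then have "AE z in lborel. v \<bullet> z \<noteq> k"
    using AE_not_in by fastforce
  then show ?thesis
    unfolding gauss_density by (subst AE_density) auto
qed

definition orth_part :: "'a::real_inner \<Rightarrow> 'a \<Rightarrow> 'a" where
  "orth_part u g = g - (u \<bullet> g) *\<^sub>R u"

lemma norm_orth_part:
  assumes "norm u = 1"
  shows "(norm (orth_part u g))\<^sup>2 = (norm g)\<^sup>2 - (u \<bullet> g)\<^sup>2"
  using assms unfolding power2_norm_eq_inner orth_part_def
  by (simp add: inner_simps inner_commute power2_eq_square norm_eq_1)

lemma orth_part_inner:
  assumes "norm u = 1"
  shows "u \<bullet> orth_part u g = 0"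
  using assms by (simp add: orth_part_def inner_simps norm_eq_1)

lemma orth_part_measurable [measurable]:
  "orth_part u \<in> borel_measurable (borel :: 'a::euclidean_space measure)"
  unfolding orth_part_def[abs_def] by measurable

lemma gauss_orth_part_second_moment:
  fixes u :: "'a::euclidean_space"
  assumes u: "norm u = 1"
  shows "(\<integral>g. (norm (orth_part u g))\<^sup>2 \<partial>gauss) = real DIM('a) - 1"
  using gauss_inner_moments(3,4)[OF u] integrable_norm2_gauss[where 'a='a]
  by (simp add: norm_orth_part[OF u] gauss_norm_moment inner_commute[of u])

text \<open>The squared mean is the second moment \<open>DIM('a) - 1\<close> minus the variance, and
  the variance is at most 1 because projection and norm are both 1-Lipschitz.\<close>

lemma gauss_orth_part_mean:
  fixes u :: "'a::euclidean_space"
  assumes u: "norm u = 1"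
  shows "integrable gauss (\<lambda>g. norm (orth_part u g))"
    and "integrable gauss (\<lambda>g. (norm (orth_part u g))\<^sup>2)"
    and "real DIM('a) - 2 \<le> (\<integral>g. norm (orth_part u g) \<partial>gauss)\<^sup>2"
proof -
  let ?f = "\<lambda>g. norm (orth_part u g)"
  have appr: "\<exists>h G. (\<forall>x. (h has_derivative (\<lambda>v. G x \<bullet> v)) (at x)) \<and> continuous_on UNIV G \<and>
        (\<forall>x. norm (G x) \<le> 1) \<and> (\<forall>x. \<bar>?f x - h x\<bar> \<le> d)" if d: "d > 0" for d
  proof -
    \<comment> \<open>Adding \<open>d\<^sup>2\<close> under the root smooths the norm at the points
      where the orthogonal part vanishes and shifts it by at most \<open>d\<close>.\<close>
    define q where "q = (\<lambda>g. g \<bullet> g - (u \<bullet> g)\<^sup>2 + d\<^sup>2)"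
    have q: "q g = (?f g)\<^sup>2 + d\<^sup>2" for g
      using norm_orth_part[OF u, of g] by (simp add: q_def power2_norm_eq_inner)
    have q_pos: "q g > 0" for g using d by (simp add: q add_nonneg_pos)
    define h where "h = (\<lambda>g. sqrt (q g))"
    define G where "G = (\<lambda>g. (1 / h g) *\<^sub>R orth_part u g)"
    have h_pos: "h g > 0" for g using q_pos by (simp add: h_def)
    have le_h: "?f g \<le> h g" for g
      unfolding h_def q by (rule real_le_rsqrt) simp
    have h_le: "h g \<le> ?f g + d" for g
      unfolding h_def q using d by (intro real_le_lsqrt) (auto simp: power2_sum)
    have "\<bar>?f g - h g\<bar> \<le> d" for g
      using le_h[of g] h_le[of g] by (simp add: abs_le_iff)
    moreover have "(h has_derivative (\<lambda>v. G g \<bullet> v)) (at g)" for g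
    proof -
      have "(q has_derivative (\<lambda>v. 2 * (orth_part u g \<bullet> v))) (at g)"
        unfolding q_def
        by (auto intro!: derivative_eq_intros simp: orth_part_def inner_simps inner_commute algebra_simps)
      then have "((\<lambda>g. sqrt (q g)) has_derivative (\<lambda>v. 2 * (orth_part u g \<bullet> v) * (inverse (sqrt (q g)) / 2))) (at g)"
        using q_pos[of g] by (auto intro!: derivative_eq_intros)
      then show ?thesis
        by (simp add: h_def G_def field_simps)
    qed
    moreover have "continuous_on UNIV G"
      unfolding G_def h_def q_def orth_part_def
      by (intro continuous_intros) (use q_pos in \<open>auto simp: q_def less_le\<close>)
    moreover have "norm (G g) \<le> 1" for g
      using le_h[of g] h_pos[of g] by (simp add: G_def field_simps)
    ultimately show ?thesis by blast
  qed
  have meas: "?f \<in> borel_measurable borel" by measurable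
  note V = gauss_variance_le_limit[OF meas appr]
  show "integrable gauss ?f" "integrable gauss (\<lambda>g. (?f g)\<^sup>2)" by (rule V; assumption)+
  show "real DIM('a) - 2 \<le> (\<integral>g. ?f g \<partial>gauss)\<^sup>2"
    using V(3) gauss_orth_part_second_moment[OF u] by simp
qed

text \<open>The maximum is approximated by \<open>ln (\<Sum>b\<in>S. exp (k * (z \<bullet> b))) / k\<close>, whose gradient is a
  convex combination of \<open>S\<close>.\<close>

lemma gauss_max_second_moment:
  fixes S :: "'a::euclidean_space set"
  assumes S: "finite S" "S \<noteq> {}" and nrm: "\<And>b. b \<in> S \<Longrightarrow> norm b = 1"
  defines "f \<equiv> \<lambda>z. Max ((\<lambda>b. z \<bullet> b) ` S)"
  shows "integrable gauss f" and "integrable gauss (\<lambda>z. (f z)\<^sup>2)"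
    and "(\<integral>z. (f z)\<^sup>2 \<partial>gauss) \<le> (\<integral>z. f z \<partial>gauss)\<^sup>2 + 1" and "0 \<le> (\<integral>z. f z \<partial>gauss)"
proof -
  have meas: "f \<in> borel_measurable borel"
    unfolding f_def using S by (intro borel_measurable_Max) auto
  have appr: "\<exists>h G. (\<forall>x. (h has_derivative (\<lambda>v. G x \<bullet> v)) (at x)) \<and> continuous_on UNIV G \<and>
        (\<forall>x. norm (G x) \<le> 1) \<and> (\<forall>x. \<bar>f x - h x\<bar> \<le> d)" if d: "d > 0" for d
  proof -
    have card: "1 \<le> real (card S)"
      using S by (simp add: Suc_leI card_gt_0_iff)
    \<comment> \<open>The soft maximum exceeds the maximum by at most
      \<open>ln (card S) / k\<close>; the added 1 keeps \<open>k\<close> positive when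
      \<open>S\<close> is a singleton.\<close>
    define k where "k = (ln (card S) + 1) / d"
    have k: "k > 0" using d card by (simp add: k_def add_nonneg_pos)
    have kd: "ln (card S) \<le> k * d" using d by (simp add: k_def)
    define w :: "'a \<Rightarrow> 'a \<Rightarrow> real" where "w = (\<lambda>b z. exp (k * (z \<bullet> b)))"
    define Z where "Z = (\<lambda>z. \<Sum>b\<in>S. w b z)"
    define h where "h = (\<lambda>z. ln (Z z) / k)"
    define G where "G = (\<lambda>z. (1 / Z z) *\<^sub>R (\<Sum>b\<in>S. w b z *\<^sub>R b))"
    have Z_pos: "Z z > 0" for z unfolding Z_def w_def using S by (intro sum_pos) auto
    have "(h has_derivative (\<lambda>v. G z \<bullet> v)) (at z)" for z
    proof -
      have "(Z has_derivative (\<lambda>v. \<Sum>b\<in>S. w b z * (k * (v \<bullet> b)))) (at z)"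
        unfolding Z_def w_def
        by (auto intro!: derivative_eq_intros sum.cong simp: mult_ac)
      then have "((\<lambda>z. ln (Z z)) has_derivative (\<lambda>v. (\<Sum>b\<in>S. w b z * (k * (v \<bullet> b))) * inverse (Z z))) (at z)"
        using Z_pos[of z] by (rule has_derivative_ln[rotated])
      then have "((\<lambda>z. ln (Z z) * (1 / k)) has_derivative (\<lambda>v. (\<Sum>b\<in>S. w b z * (k * (v \<bullet> b))) * inverse (Z z) * (1 / k))) (at z)"
        by (rule has_derivative_mult_left)
      moreover have "(\<Sum>b\<in>S. w b z * (k * (v \<bullet> b))) * inverse (Z z) * (1 / k) = G z \<bullet> v" for v
      proof -
        have "(\<Sum>b\<in>S. w b z * (k * (v \<bullet> b))) = k * ((\<Sum>b\<in>S. w b z *\<^sub>R b) \<bullet> v)"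
          by (simp add: inner_sum_left sum_distrib_left inner_commute[of v] mult_ac)
        then show ?thesis
          using k by (simp add: G_def field_simps)
      qed
      ultimately show ?thesis
        by (simp add: h_def)
    qed
    moreover have "continuous_on UNIV G"
      unfolding G_def Z_def w_def
      by (intro continuous_intros) (use Z_pos in \<open>auto simp: Z_def w_def less_le\<close>)
    moreover have "norm (G z) \<le> 1" for z
    proof -
      have "norm (\<Sum>b\<in>S. w b z *\<^sub>R b) \<le> (\<Sum>b\<in>S. w b z)"
        by (rule sum_norm_le) (simp add: nrm w_def)
      then show ?thesis using Z_pos[of z] by (simp add: G_def Z_def field_simps)
    qed
    moreover have "\<bar>f z - h z\<bar> \<le> d" for z
    proof -
      have "f z \<in> (\<lambda>b. z \<bullet> b) ` S" unfolding f_def using S by (intro Max_in) auto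
      then obtain b where b: "b \<in> S" "f z = z \<bullet> b" by auto
      have le: "z \<bullet> b' \<le> f z" if "b' \<in> S" for b' using that S by (simp add: f_def)
      have "exp (k * f z) \<le> Z z"
        unfolding Z_def w_def b(2) using S b by (intro member_le_sum) auto
      then have 1: "k * f z \<le> ln (Z z)" using Z_pos[of z] by (simp add: ln_ge_iff)
      have "Z z \<le> (\<Sum>b\<in>S. exp (k * f z))"
        unfolding Z_def w_def using le k by (intro sum_mono) simp
      also have "\<dots> = card S * exp (k * f z)" by simp
      finally have "ln (Z z) \<le> ln (card S * exp (k * f z))"
        using Z_pos[of z] card by (subst ln_le_cancel_iff) auto
      also have "\<dots> = ln (card S) + k * f z"
        using card by (subst ln_mult) auto
      also have "\<dots> \<le> k * d + k * f z" using kd by simp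
      finally have "ln (Z z) / k \<le> d + f z" using k by (simp add: field_simps)
      moreover have "f z \<le> ln (Z z) / k" using 1 k by (simp add: field_simps)
      ultimately show ?thesis by (simp add: h_def)
    qed
    ultimately show ?thesis by blast
  qed
  note V = gauss_variance_le_limit[OF meas appr]
  show f1: "integrable gauss f" and "integrable gauss (\<lambda>z. (f z)\<^sup>2)" by (rule V; assumption)+
  show "(\<integral>z. (f z)\<^sup>2 \<partial>gauss) \<le> (\<integral>z. f z \<partial>gauss)\<^sup>2 + 1"
    using V(3) by simp
  obtain b where b: "b \<in> S" using S by auto
  have "(\<integral>z. z \<bullet> b \<partial>gauss) \<le> (\<integral>z. f z \<partial>gauss)"
    using b S by (intro integral_mono gauss_inner_moments nrm f1) (auto simp: f_def)
  then show "0 \<le> (\<integral>z. f z \<partial>gauss)"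
    using gauss_inner_moments(2)[OF nrm[OF b]] by simp
qed

subsection \<open>Gaussian vectors and matrices\<close>

text \<open>Coordinates may be indexed by any set \<open>K\<close> in bijection with the basis: by
  positions for vectors, by pairs of indices for matrices. Reindexing does not affect the law of a
  product.\<close>

lemma distr_PiM_std_normal_eq_gauss:
  fixes e :: "'k \<Rightarrow> 'a::euclidean_space"
  assumes bij: "bij_betw e K Basis" and V: "\<And>f k. k \<in> K \<Longrightarrow> V f \<bullet> e k = f k"
  shows "distr (\<Pi>\<^sub>M k\<in>K. std_normal_distribution) borel V = gauss"
proof -
  have fin: "finite K" using bij_betw_finite[OF bij] by simp
  have V_eq: "V f = (\<Sum>k\<in>K. f k *\<^sub>R e k)" for f
  proof -
    have "V f = (\<Sum>b\<in>Basis. (V f \<bullet> b) *\<^sub>R b)" by (simp add: euclidean_representation)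
    also have "\<dots> = (\<Sum>k\<in>K. (V f \<bullet> e k) *\<^sub>R e k)"
      by (rule sum.reindex_bij_betw[OF bij, symmetric])
    finally show ?thesis by (simp add: V)
  qed
  have [measurable]: "V \<in> borel_measurable (\<Pi>\<^sub>M k\<in>K. std_normal_distribution)"
    unfolding V_eq[abs_def] by measurable
  let ?re = "\<lambda>\<omega>. \<lambda>k\<in>K. \<omega> (e k)"
  have [measurable]: "?re \<in> (\<Pi>\<^sub>M b\<in>(Basis::'a set). std_normal_distribution) \<rightarrow>\<^sub>M (\<Pi>\<^sub>M k\<in>K. std_normal_distribution)"
    using bij by (intro measurable_restrict measurable_component_singleton) (auto simp: bij_betw_def)
  have "(\<Pi>\<^sub>M k\<in>K. std_normal_distribution) =
      distr (\<Pi>\<^sub>M b\<in>(Basis::'a set). std_normal_distribution) (\<Pi>\<^sub>M k\<in>K. std_normal_distribution) ?re"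
    using bij by (intro distr_PiM_reindex[symmetric]) (auto simp: bij_betw_def prob_space_std_normal)
  then have "distr (\<Pi>\<^sub>M k\<in>K. std_normal_distribution) borel V =
      distr (distr (\<Pi>\<^sub>M b\<in>(Basis::'a set). std_normal_distribution) (\<Pi>\<^sub>M k\<in>K. std_normal_distribution) ?re) borel V"
    by simp
  also have "\<dots> = distr (\<Pi>\<^sub>M b\<in>(Basis::'a set). std_normal_distribution) borel (\<lambda>\<omega>. V (?re \<omega>))"
    by (subst distr_distr) (simp_all add: comp_def)
  also have "(\<lambda>\<omega>. V (?re \<omega>)) = (\<lambda>\<omega>. \<Sum>b\<in>Basis. \<omega> b *\<^sub>R b)"
    by (simp add: V_eq fun_eq_iff sum.reindex_bij_betw[OF bij, where g="\<lambda>b. _ b *\<^sub>R b", symmetric])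
  finally show ?thesis by (simp add: gauss_def)
qed

lemma std_gaussian_eq_gauss: "(std_gaussian :: (real ^ 'N) measure) = gauss"
  unfolding std_gaussian_def
proof (rule distr_PiM_std_normal_eq_gauss)
  show "bij_betw (\<lambda>i. axis i 1 :: real ^ 'N) UNIV Basis"
    by (auto simp: bij_betw_def inj_on_def axis_eq_axis Basis_vec_def)
qed (simp add: inner_axis)

text \<open>Bridge from the entrywise hypothesis to a single law: independence and standard normal
  marginals say that the family of entries has product law, and \<open>V\<close> assembles the
  matrix from its entries.\<close>

lemma distr_gaussian_design:
  fixes A :: "'w \<Rightarrow> real ^ 'N ^ 'n"
  assumes "gaussian_design M A"
  shows "A \<in> borel_measurable M" and "distr M borel A = gauss"
proof -
  let ?X = "\<lambda>(i, j) w. A w $ i $ j"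
  interpret prob_space M using assms by (simp add: gaussian_design_def)
  have ind: "indep_vars (\<lambda>_. borel) ?X UNIV" and d: "\<And>i j. distributed M lborel (\<lambda>w. A w $ i $ j) std_normal_density"
    using assms by (auto simp: gaussian_design_def)
  have X [measurable]: "?X k \<in> borel_measurable M" for k
    using d by (cases k) (auto simp: distributed_def)
  have dX: "distr M borel (?X k) = std_normal_distribution" for k
  proof (cases k)
    case (Pair i j)
    have "distr M lborel (\<lambda>w. A w $ i $ j) = std_normal_distribution"
      using d[of i j] by (rule distributed_distr_eq_density)
    moreover have "distr M lborel (\<lambda>w. A w $ i $ j) = distr M borel (\<lambda>w. A w $ i $ j)"
      by (rule distr_cong) auto
    ultimately show ?thesis by (simp add: Pair)
  qed
  define V :: "('n \<times> 'N \<Rightarrow> real) \<Rightarrow> real ^ 'N ^ 'n" where "V = (\<lambda>f. \<chi> i j. f (i, j))"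
  define e :: "'n \<times> 'N \<Rightarrow> real ^ 'N ^ 'n" where "e = (\<lambda>(i, j). axis i (axis j 1))"
  have e: "bij_betw e UNIV Basis"
    by (auto simp: e_def bij_betw_def inj_on_def axis_eq_axis Basis_vec_def image_iff)
  have Ve: "V f \<bullet> e k = f k" for f k
    by (cases k) (simp add: V_def e_def inner_axis)
  have law: "distr M (\<Pi>\<^sub>M k\<in>UNIV. borel) (\<lambda>w. \<lambda>k\<in>UNIV. ?X k w) = (\<Pi>\<^sub>M k\<in>UNIV. std_normal_distribution)"
    using ind by (subst (asm) indep_vars_iff_distr_eq_PiM) (simp_all add: dX X)
  have A_eq: "A w = V (\<lambda>k\<in>UNIV. ?X k w)" for w
    by (simp add: V_def vec_eq_iff)
  have V_eq: "V f = (\<Sum>k\<in>UNIV. f k *\<^sub>R e k)" for f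
  proof -
    have "V f = (\<Sum>b\<in>Basis. (V f \<bullet> b) *\<^sub>R b)" by (simp add: euclidean_representation)
    also have "\<dots> = (\<Sum>k\<in>UNIV. (V f \<bullet> e k) *\<^sub>R e k)"
      by (rule sum.reindex_bij_betw[OF e, symmetric])
    finally show ?thesis by (simp add: Ve)
  qed
  have [measurable]: "V \<in> borel_measurable (\<Pi>\<^sub>M k\<in>UNIV. borel)"
    unfolding V_eq[abs_def] by measurable
  have [measurable]: "(\<lambda>w. \<lambda>k\<in>UNIV. ?X k w) \<in> M \<rightarrow>\<^sub>M (\<Pi>\<^sub>M k\<in>UNIV. borel)"
    by (intro measurable_restrict X)
  have "(\<lambda>w. V (\<lambda>k\<in>UNIV. ?X k w)) \<in> borel_measurable M"
    by measurable
  then show A: "A \<in> borel_measurable M"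
    by (simp only: A_eq[symmetric])
  have "distr M borel A = distr (distr M (\<Pi>\<^sub>M k\<in>UNIV. borel) (\<lambda>w. \<lambda>k\<in>UNIV. ?X k w)) borel V"
    by (subst distr_distr) (simp_all only: comp_def A_eq[symmetric], measurable)
  also have "\<dots> = gauss"
    unfolding law by (rule distr_PiM_std_normal_eq_gauss[OF e]) (simp add: Ve)
  finally show "distr M borel A = gauss" .
qed

text \<open>The rank-one matrix of \<open>u\<close> and \<open>z\<close>. The adjoint of
  \<open>\<lambda>a. a *v b\<close> is \<open>\<lambda>y. outer y b\<close>, that of
  \<open>\<lambda>a. u v* a\<close> is \<open>outer u\<close>; these are the adjoints that
  \<open>gauss_coisometry\<close> asks for.\<close>

definition outer :: "real ^ 'n \<Rightarrow> real ^ 'N \<Rightarrow> real ^ 'N ^ 'n" where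
  "outer u z = (\<chi> i. (u $ i) *\<^sub>R z)"

lemma outer_mult_vec: "outer u z *v b = (z \<bullet> b) *\<^sub>R u"
  by (simp add: outer_def vec_eq_iff matrix_vector_mult_def inner_vec_def sum_distrib_left mult_ac)

lemma inner_outer: "a \<bullet> outer u z = u \<bullet> (a *v z)"
  by (simp add: outer_def inner_vec_def matrix_vector_mult_def sum_distrib_left mult_ac)

lemma outer_eq_0_iff: "outer u z = 0 \<longleftrightarrow> u = 0 \<or> z = 0"
  by (auto simp: outer_def vec_eq_iff)

lemma norm_matrix_vector_mult_le:
  fixes a :: "real ^ 'N ^ 'n"
  shows "norm (a *v b) \<le> norm a * norm b"
proof -
  have "norm (a *v b) = L2_set (\<lambda>i. norm (a $ i \<bullet> b)) UNIV"
    by (simp add: norm_vec_def matrix_vector_mult_def inner_vec_def)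
  also have "\<dots> \<le> L2_set (\<lambda>i. norm (a $ i) * norm b) UNIV"
    by (intro L2_set_mono) (simp_all add: Cauchy_Schwarz_ineq2)
  also have "\<dots> = norm a * norm b"
    by (simp add: norm_vec_def[of a] L2_set_left_distrib)
  finally show ?thesis .
qed

lemma measurable_matrix_vector_mult [measurable (raw)]:
  fixes f :: "'w \<Rightarrow> real ^ 'N ^ 'n"
  assumes "f \<in> borel_measurable M" "g \<in> borel_measurable M"
  shows "(\<lambda>w. f w *v g w) \<in> borel_measurable M"
proof (rule borel_measurable_continuous_Pair[OF assms])
  show "continuous_on UNIV (\<lambda>p :: (real ^ 'N ^ 'n) \<times> (real ^ 'N). fst p *v snd p)"
    unfolding matrix_vector_mult_def by (intro continuous_intros)
qed

lemma measurable_vector_matrix_mult [measurable]: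
  "(\<lambda>a :: real ^ 'N ^ 'n. u v* a) \<in> borel_measurable borel"
proof (rule borel_measurable_continuous_onI)
  show "continuous_on UNIV (\<lambda>a :: real ^ 'N ^ 'n. u v* a)"
    unfolding vector_matrix_mult_def by (intro continuous_intros)
qed

lemma distr_gauss_mult_vec:
  assumes "norm b = 1"
  shows "distr (gauss :: (real ^ 'N ^ 'n) measure) borel (\<lambda>a. a *v b) = gauss"
proof (rule gauss_coisometry[where T' = "\<lambda>y. outer y b"])
  show "linear (\<lambda>a :: real ^ 'N ^ 'n. a *v b)"
    by (intro linearI) (simp_all add: matrix_vector_mult_add_rdistrib scaleR_matrix_vector_assoc)
qed (use assms in \<open>simp_all add: inner_outer outer_mult_vec inner_commute norm_eq_1\<close>)

lemma inner_vector_matrix: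
  fixes a :: "real ^ 'N ^ 'n"
  shows "(u v* a) \<bullet> z = u \<bullet> (a *v z)"
  by (rule dot_lmul_matrix)

lemma distr_gauss_vec_mult:
  assumes "norm u = 1"
  shows "distr (gauss :: (real ^ 'N ^ 'n) measure) borel (\<lambda>a. u v* a) = gauss"
proof (rule gauss_coisometry[where T' = "outer u"])
  show "linear (\<lambda>a :: real ^ 'N ^ 'n. u v* a)"
    by (intro linearI) (simp_all add: vec_eq_iff vector_matrix_mult_def algebra_simps sum.distrib sum_distrib_left)
  show "u v* outer u y = y" for y :: "real ^ 'N"
    by (rule vector_eq_rdot[THEN iffD1]) (use assms in \<open>simp add: inner_vector_matrix outer_mult_vec norm_eq_1\<close>)
qed (simp add: inner_vector_matrix inner_outer)

subsection \<open>A single greedy step\<close>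

text \<open>Images of vectors under the result take their component along \<open>u\<close> from the
  first matrix and the orthogonal rest from the second, so all scores against \<open>u\<close> are
  functions of the first copy alone.\<close>

definition split_at :: "real ^ 'n \<Rightarrow> (real ^ 'N ^ 'n) \<times> (real ^ 'N ^ 'n) \<Rightarrow> real ^ 'N ^ 'n" where
  "split_at u = (\<lambda>(a, a'). outer u (u v* a) + (a' - outer u (u v* a')))"

lemma split_at_mult_vec:
  "split_at u (a, a') *v b = (u \<bullet> (a *v b)) *\<^sub>R u + orth_part u (a' *v b)"
  by (simp add: split_at_def matrix_vector_mult_add_rdistrib matrix_vector_mult_diff_rdistrib
      outer_mult_vec inner_vector_matrix orth_part_def)

text \<open>The adjoint sends \<open>c\<close> to the pair of its two complementary pieces, which
  \<open>split_at\<close> adds up again; so the map is a coisometry.\<close>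

lemma gauss_split_at:
  fixes u :: "real ^ 'n"
  assumes u: "norm u = 1"
  shows "distr gauss borel (split_at u) = (gauss :: (real ^ 'N ^ 'n) measure)"
    and "split_at u \<in> borel_measurable (borel :: ((real ^ 'N ^ 'n) \<times> (real ^ 'N ^ 'n)) measure)"
proof -
  have add: "u v* (a + b) = u v* a + u v* b" and scale: "u v* (r *\<^sub>R a) = r *\<^sub>R (u v* a)"
    for a b :: "real ^ 'N ^ 'n" and r
    by (simp_all add: vec_eq_iff vector_matrix_mult_def algebra_simps sum.distrib sum_distrib_left)
  have oadd: "outer u (y + z) = outer u y + outer u z" and oscale: "outer u (r *\<^sub>R z) = r *\<^sub>R outer u z"
    for y z :: "real ^ 'N" and r
    by (simp_all add: vec_eq_iff outer_def algebra_simps)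
  have lin: "linear (split_at u :: (real ^ 'N ^ 'n) \<times> _ \<Rightarrow> _)"
    unfolding split_at_def by (rule linearI) (auto simp: add scale oadd oscale algebra_simps)
  then show "split_at u \<in> borel_measurable (borel :: ((real ^ 'N ^ 'n) \<times> (real ^ 'N ^ 'n)) measure)"
    by (simp add: borel_measurable_continuous_onI linear_continuous_on linear_linear)
  have uo: "u v* outer u z = z" for z :: "real ^ 'N"
    by (rule vector_eq_rdot[THEN iffD1]) (use u in \<open>simp add: inner_vector_matrix outer_mult_vec norm_eq_1\<close>)
  have ad: "outer u z \<bullet> c = z \<bullet> (u v* c)" for z and c :: "real ^ 'N ^ 'n"
    using inner_outer[of c u z] inner_vector_matrix[of u c z] by (simp add: inner_commute)
  have usub: "u v* (a - b) = u v* a - u v* b" for a b :: "real ^ 'N ^ 'n"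
    using add[of "a - b" b] by (simp add: algebra_simps)
  show "distr gauss borel (split_at u) = (gauss :: (real ^ 'N ^ 'n) measure)"
  proof (rule gauss_coisometry[OF lin, where T' = "\<lambda>c. (outer u (u v* c), c - outer u (u v* c))"])
    show "split_at u p \<bullet> c = p \<bullet> (outer u (u v* c), c - outer u (u v* c))"
      for p and c :: "real ^ 'N ^ 'n"
    proof -
      have 1: "outer u (u v* a) \<bullet> c = a \<bullet> outer u (u v* c)" for a
        by (metis ad inner_commute)
      show ?thesis
        by (cases p) (simp add: split_at_def inner_simps 1)
    qed
    show "split_at u (outer u (u v* y), y - outer u (u v* y)) = y" for y :: "real ^ 'N ^ 'n"
      by (simp add: split_at_def uo usub outer_eq_0_iff)
  qed
qed

lemma gaussian_width_eq:
  "gaussian_width S = (\<integral>z. Max ((\<lambda>b. z \<bullet> b) ` (\<lambda>b. b /\<^sub>R norm b) ` S) \<partial>gauss)"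
  by (simp add: gaussian_width_def std_gaussian_eq_gauss image_image divide_inverse mult.commute)

text \<open>A tie between \<open>b\<close> and \<open>b'\<close> places \<open>a\<close> on the
  hyperplane orthogonal to \<open>outer u (b - b')\<close>, and a finite set has finitely many
  pairs.\<close>

lemma AE_no_ties:
  fixes S :: "(real ^ 'N) set" and u :: "real ^ 'n"
  assumes "finite S" "u \<noteq> 0"
  shows "AE a in gauss. \<forall>b\<in>S. \<forall>b'\<in>S. b \<noteq> b' \<longrightarrow> u \<bullet> (a *v b) \<noteq> u \<bullet> (a *v b')"
proof -
  have "AE a in gauss. u \<bullet> (a *v b) \<noteq> u \<bullet> (a *v b')" if "b \<noteq> b'" for b b' :: "real ^ 'N"
  proof -
    have "AE a in gauss. outer u (b - b') \<bullet> a \<noteq> 0"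
      using assms that by (intro AE_gauss_hyperplane) (simp add: outer_eq_0_iff)
    then show ?thesis
      by (simp add: inner_commute[of "outer _ _"] inner_outer matrix_vector_mult_diff_distrib inner_diff_right)
  qed
  then show ?thesis
    using assms(1) by (intro AE_finite_allI) (auto simp: AE_all_countable intro!: AE_finite_allI)
qed

text \<open>One step with the residual \<open>r\<close> frozen. The selector \<open>k\<close> may
  depend on the whole matrix \<open>a\<close>, so that any tie-breaking rule is covered; all that is
  known is that it picks a maximizer, measurably.\<close>

locale greedy_step =
  fixes S :: "(real ^ 'N) set" and c :: real and r :: "real ^ 'n"
    and k :: "real ^ 'N ^ 'n \<Rightarrow> real ^ 'N"
  assumes S: "finite S" "S \<noteq> {}" and c: "c > 0" and nrm: "\<And>b. b \<in> S \<Longrightarrow> norm b = c"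
    and n: "CARD('n) > 2"
    and k_meas [measurable]: "k \<in> borel_measurable borel"
    and k_in: "\<And>a. k a \<in> S" and k_max: "\<And>a b. b \<in> S \<Longrightarrow> r \<bullet> (a *v b) \<le> r \<bullet> (a *v k a)"
begin

definition "\<omega> = gaussian_width S"
definition "f a = norm (r - a *v k a)"
definition "m z = Max ((\<lambda>b. z \<bullet> b) ` (\<lambda>b. b /\<^sub>R norm b) ` S)" for z :: "real ^ 'N"

lemma f_measurable [measurable]: "f \<in> borel_measurable borel"
  unfolding f_def[abs_def] by measurable

lemma m_moments:
  "integrable gauss m" "integrable gauss (\<lambda>z. (m z)\<^sup>2)"
  "(\<integral>z. m z \<partial>gauss) = \<omega>" "(\<integral>z. (m z)\<^sup>2 \<partial>gauss) \<le> \<omega>\<^sup>2 + 1" "0 \<le> \<omega>"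
proof -
  have "norm b = 1" if "b \<in> (\<lambda>b. b /\<^sub>R norm b) ` S" for b
    using that nrm c by auto
  note G = gauss_max_second_moment[of "(\<lambda>b. b /\<^sub>R norm b) ` S", OF _ _ this, folded m_def[abs_def]]
  show "integrable gauss m" "integrable gauss (\<lambda>z. (m z)\<^sup>2)"
    using G(1,2) S by (simp_all add: m_def)
  show w: "(\<integral>z. m z \<partial>gauss) = \<omega>" 
    by (simp add: \<omega>_def gaussian_width_eq m_def)
  show "(\<integral>z. (m z)\<^sup>2 \<partial>gauss) \<le> \<omega>\<^sup>2 + 1" "0 \<le> \<omega>"
    unfolding w[symmetric] using G(3,4) S by (simp_all add: m_def)
qed

lemma m_measurable [measurable]: "m \<in> borel_measurable borel"
  using m_moments(1) by (auto simp: integrable_iff_bounded)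

lemma f_le: "f a \<le> norm r + c * norm a"
  using norm_triangle_ineq4[of r "a *v k a"] norm_matrix_vector_mult_le[of a "k a"] nrm[OF k_in[of a]]
  by (simp add: f_def mult.commute)

lemma integrable_f2: "integrable gauss (\<lambda>a. (f a)\<^sup>2)"
proof (rule Bochner_Integration.integrable_bound)
  interpret prob_space "gauss :: (real ^ 'N ^ 'n) measure" by (rule prob_space_gauss)
  show "integrable gauss (\<lambda>a :: real ^ 'N ^ 'n. 2 * (norm r)\<^sup>2 + 2 * c\<^sup>2 * (norm a)\<^sup>2)"
    using integrable_norm2_gauss[where 'a = "real ^ 'N ^ 'n"] by simp
  show "AE a in gauss. norm ((f a)\<^sup>2) \<le> norm (2 * (norm r)\<^sup>2 + 2 * c\<^sup>2 * (norm a)\<^sup>2)"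
  proof (rule AE_I2)
    fix a
    have "(f a)\<^sup>2 \<le> (norm r + c * norm a)\<^sup>2"
      using f_le[of a] by (intro power_mono) (simp_all add: f_def)
    also have "\<dots> \<le> 2 * (norm r)\<^sup>2 + 2 * c\<^sup>2 * (norm a)\<^sup>2"
      using zero_le_power2[of "norm r - c * norm a"] by (simp add: power2_eq_square algebra_simps)
    finally show "norm ((f a)\<^sup>2) \<le> norm (2 * (norm r)\<^sup>2 + 2 * c\<^sup>2 * (norm a)\<^sup>2)"
      by simp
  qed
qed simp

lemma integrable_f: "integrable gauss f"
proof -
  interpret prob_space "gauss :: (real ^ 'N ^ 'n) measure" by (rule prob_space_gauss)
  show ?thesis by (rule square_integrable_imp_integrable[OF _ integrable_f2]) simp
qed

context
  assumes r: "r \<noteq> 0"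
begin

definition "u = r /\<^sub>R norm r"

lemma u: "norm u = 1" and r_eq: "r = norm r *\<^sub>R u"
  using r by (simp_all add: u_def)

abbreviation "T \<equiv> split_at u :: (real ^ 'N ^ 'n) \<times> (real ^ 'N ^ 'n) \<Rightarrow> _"

lemmas T = gauss_split_at[OF u] split_at_mult_vec[of u]

lemma T_measurable [measurable]: "T \<in> borel_measurable borel" by (rule T)

text \<open>Along \<open>u\<close> the step subtracts \<open>c\<close> times a Gaussian maximum; the component orthogonal
  to \<open>u\<close> is independent of the choice of \<open>b\<close>.\<close>

lemma f_T:
  "AE a in gauss. \<exists>b\<in>S. \<forall>a'. (f (T (a, a')))\<^sup>2 = (norm r - c * m (u v* a))\<^sup>2 + (norm (orth_part u (a' *v b)))\<^sup>2"
proof -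
  have "AE a in gauss. \<forall>b\<in>S. \<forall>b'\<in>S. b \<noteq> b' \<longrightarrow> u \<bullet> (a *v b) \<noteq> u \<bullet> (a *v b')"
    using S u by (intro AE_no_ties) auto
  then show ?thesis
  proof eventually_elim
    case (elim a)
    \<comment> \<open>Scores do not see the second copy, since orthogonal parts are invisible to
      \<open>u\<close>.\<close>
    have uT: "u \<bullet> (T (a, a') *v b) = u \<bullet> (a *v b)" for a' b
      using u by (simp add: T(3) inner_add_right orth_part_inner norm_eq_1)
    have max: "u \<bullet> (a *v b) \<le> u \<bullet> (a *v k (T (a, a')))" if "b \<in> S" for a' b
    proof -
      have "norm r * (u \<bullet> (T (a, a') *v b)) \<le> norm r * (u \<bullet> (T (a, a') *v k (T (a, a'))))"
        using k_max[OF that, of "T (a, a')"] r_eq by (metis inner_scaleR_left)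
      then show ?thesis using r by (simp add: uT)
    qed
    \<comment> \<open>The codeword chosen at \<open>a' = 0\<close> serves as reference; any other
      \<open>a'\<close> yields a maximizer of the same scores, hence the same codeword when there
      are no ties.\<close>
    define b where "b = k (T (a, 0))"
    have b: "b \<in> S" by (simp add: b_def k_in)
    have k_eq: "k (T (a, a')) = b" for a'
    proof (rule ccontr)
      assume "k (T (a, a')) \<noteq> b"
      then have "u \<bullet> (a *v k (T (a, a'))) \<noteq> u \<bullet> (a *v b)"
        using elim b k_in by blast
      moreover have "u \<bullet> (a *v k (T (a, a'))) \<le> u \<bullet> (a *v b)"
        using max[OF k_in, of _ 0] by (simp add: b_def)
      ultimately show False
        using max[OF b, of a'] by simp
    qed
    have "m (u v* a) = u \<bullet> (a *v b) / c"
      unfolding m_def image_image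
    proof (rule Max_eqI)
      show "finite ((\<lambda>b. (u v* a) \<bullet> (b /\<^sub>R norm b)) ` S)" using S by simp
      show "u \<bullet> (a *v b) / c \<in> (\<lambda>b. (u v* a) \<bullet> (b /\<^sub>R norm b)) ` S"
        using b nrm[OF b] by (intro image_eqI[of _ _ b]) (simp_all add: inner_vector_matrix divide_inverse)
      fix y assume "y \<in> (\<lambda>b. (u v* a) \<bullet> (b /\<^sub>R norm b)) ` S"
      then obtain b' where b': "b' \<in> S" "y = (u \<bullet> (a *v b')) / c"
        using nrm by (auto simp: inner_vector_matrix divide_inverse)
      show "y \<le> u \<bullet> (a *v b) / c"
        using max[OF b'(1), of 0] c unfolding b'(2) b_def by (intro divide_right_mono) auto
    qed
    then have m: "u \<bullet> (a *v b) = c * m (u v* a)" using c by simp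
    have "(f (T (a, a')))\<^sup>2 = (norm r - c * m (u v* a))\<^sup>2 + (norm (orth_part u (a' *v b)))\<^sup>2" for a'
    proof -
      have "r - T (a, a') *v b = (norm r - c * m (u v* a)) *\<^sub>R u - orth_part u (a' *v b)"
        by (subst r_eq) (simp add: T(3) m algebra_simps)
      then show ?thesis
        using u orth_part_inner[OF u, of "a' *v b"]
        unfolding f_def k_eq power2_norm_eq_inner
        by (simp add: inner_simps inner_commute norm_eq_1 power2_eq_square)
    qed
    then show ?case using b by blast
  qed
qed

lemma integral_T:
  assumes "integrable gauss (g :: real ^ 'N ^ 'n \<Rightarrow> real)"
  shows "(\<integral>a. g a \<partial>gauss) = (\<integral>a. \<integral>a'. g (T (a, a')) \<partial>gauss \<partial>gauss)"
    and "integrable gauss (\<lambda>a. \<integral>a'. g (T (a, a')) \<partial>gauss)"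
    and "AE a in gauss. integrable gauss (\<lambda>a'. g (T (a, a')))"
proof -
  interpret prob_space "gauss :: (real ^ 'N ^ 'n) measure" by (rule prob_space_gauss)
  interpret pair_prob_space "gauss :: (real ^ 'N ^ 'n) measure" "gauss :: (real ^ 'N ^ 'n) measure" ..
  have [measurable]: "g \<in> borel_measurable borel" using assms by (auto simp: integrable_iff_bounded)
  have int: "integrable (gauss \<Otimes>\<^sub>M gauss) (\<lambda>p. g (T p))"
    using assms unfolding gauss_prod[symmetric]
    by (subst (asm) T(1)[symmetric], subst (asm) integrable_distr_eq) simp_all
  have "(\<integral>a. g a \<partial>gauss) = (\<integral>p. g (T p) \<partial>gauss)"
    by (subst T(1)[symmetric], subst integral_distr) simp_all
  then show "(\<integral>a. g a \<partial>gauss) = (\<integral>a. \<integral>a'. g (T (a, a')) \<partial>gauss \<partial>gauss)"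
    using integral_fst'[OF int] by (simp add: gauss_prod)
  show "integrable gauss (\<lambda>a. \<integral>a'. g (T (a, a')) \<partial>gauss)"
    by (rule integrable_fst'[OF int])
  show "AE a in gauss. integrable gauss (\<lambda>a'. g (T (a, a')))"
    by (rule AE_integrable_fst'[OF int])
qed

lemma orth_part_scale:
  assumes "b \<in> S"
  shows "norm (orth_part u (a *v b)) = c * norm (orth_part u (a *v (b /\<^sub>R c)))"
proof -
  have "a *v b = c *\<^sub>R (a *v (b /\<^sub>R c))"
    using c matrix_vector_mult_scaleR[of a c "b /\<^sub>R c"] by simp
  moreover have "orth_part u (c *\<^sub>R v) = c *\<^sub>R orth_part u v" for v
    by (simp add: orth_part_def algebra_simps)
  ultimately show ?thesis using c by simp
qed

text \<open>For a codeword that does not depend on \<open>a\<close>, the image of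
  \<open>b /\<^sub>R c\<close> is a standard Gaussian vector, so the moments are those of a
  projected Gaussian scaled by \<open>c\<close>.\<close>

lemma orth_part_moments:
  assumes b: "b \<in> S"
  shows "(\<integral>a. (norm (orth_part u (a *v b)))\<^sup>2 \<partial>gauss) = c\<^sup>2 * (real CARD('n) - 1)"
    and "integrable gauss (\<lambda>a. (norm (orth_part u (a *v b)))\<^sup>2)"
    and "integrable gauss (\<lambda>a. norm (orth_part u (a *v b)))"
    and "c * sqrt (real CARD('n) - 2) \<le> (\<integral>a. norm (orth_part u (a *v b)) \<partial>gauss)"
proof -
  have b1: "norm (b /\<^sub>R c) = 1" using nrm[OF b] c by simp
  note G = distr_gauss_mult_vec[OF b1, where 'n = 'n]
  have eq: "(\<integral>a. h (a *v (b /\<^sub>R c)) \<partial>(gauss :: (real ^ 'N ^ 'n) measure)) = (\<integral>g. h g \<partial>gauss)"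
    "integrable (gauss :: (real ^ 'N ^ 'n) measure) (\<lambda>a. h (a *v (b /\<^sub>R c))) \<longleftrightarrow> integrable gauss h"
    if "h \<in> borel_measurable borel" for h :: "real ^ 'n \<Rightarrow> real"
    using that unfolding G[symmetric] by (simp_all add: integral_distr integrable_distr_eq)
  have m1: "(\<lambda>g :: real ^ 'n. norm (orth_part u g)) \<in> borel_measurable borel"
    and m2: "(\<lambda>g :: real ^ 'n. (norm (orth_part u g))\<^sup>2) \<in> borel_measurable borel"
    by measurable
  note M = gauss_orth_part_mean[OF u]
  show "(\<integral>a. (norm (orth_part u (a *v b)))\<^sup>2 \<partial>gauss) = c\<^sup>2 * (real CARD('n) - 1)"
    unfolding orth_part_scale[OF b] power_mult_distrib
    using eq(1)[OF m2] gauss_orth_part_second_moment[OF u] by simp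
  show "integrable gauss (\<lambda>a. (norm (orth_part u (a *v b)))\<^sup>2)"
    unfolding orth_part_scale[OF b] power_mult_distrib
    using eq(2)[OF m2] M(2) by simp
  show "integrable gauss (\<lambda>a. norm (orth_part u (a *v b)))"
    unfolding orth_part_scale[OF b]
    using eq(2)[OF m1] M(1) by simp
  have "sqrt (real CARD('n) - 2) \<le> (\<integral>g. norm (orth_part u g) \<partial>gauss)"
    using M(3) by (intro real_le_lsqrt) auto
  then show "c * sqrt (real CARD('n) - 2) \<le> (\<integral>a. norm (orth_part u (a *v b)) \<partial>gauss)"
    unfolding orth_part_scale[OF b]
    using eq(1)[OF m1] c by simp
qed

lemma m_transfer:
  assumes "h \<in> borel_measurable borel"
  shows "(\<integral>a. h (u v* a) \<partial>(gauss :: (real ^ 'N ^ 'n) measure)) = (\<integral>z. h z \<partial>gauss)"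
    and "integrable (gauss :: (real ^ 'N ^ 'n) measure) (\<lambda>a. h (u v* a) :: real) \<longleftrightarrow> integrable gauss h"
  using assms unfolding distr_gauss_vec_mult[OF u, where 'N = 'N, symmetric]
  by (simp_all add: integral_distr integrable_distr_eq)

text \<open>The square splits into a term along \<open>u\<close> and an orthogonal one. The latter
  has mean \<open>c\<^sup>2 (n - 1)\<close>, and the variance of the maximum adds at most
  \<open>c\<^sup>2\<close>, which completes the full dimension on the right.\<close>

lemma second_moment_le:
  "(\<integral>a. (f a)\<^sup>2 \<partial>gauss) \<le> (norm r)\<^sup>2 - 2 * c * \<omega> * norm r + c\<^sup>2 * (\<omega>\<^sup>2 + real CARD('n))"
proof -
  interpret prob_space "gauss :: (real ^ 'N ^ 'n) measure" by (rule prob_space_gauss)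
  interpret Z: prob_space "gauss :: (real ^ 'N) measure" by (rule prob_space_gauss)
  let ?N = "c\<^sup>2 * (real CARD('n) - 1)"
  have "(\<integral>a. (f a)\<^sup>2 \<partial>gauss) = (\<integral>a. \<integral>a'. (f (T (a, a')))\<^sup>2 \<partial>gauss \<partial>gauss)"
    by (rule integral_T(1)[OF integrable_f2])
  also have "\<dots> = (\<integral>a. (norm r - c * m (u v* a))\<^sup>2 + ?N \<partial>(gauss :: (real ^ 'N ^ 'n) measure))"
  proof (rule integral_cong_AE)
    show "AE a in gauss. (\<integral>a'. (f (T (a, a')))\<^sup>2 \<partial>gauss) = (norm r - c * m (u v* a))\<^sup>2 + ?N"
      using f_T
    proof eventually_elim
      case (elim a)
      then obtain b where b: "b \<in> S" "\<And>a'. (f (T (a, a')))\<^sup>2 = (norm r - c * m (u v* a))\<^sup>2 + (norm (orth_part u (a' *v b)))\<^sup>2"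
        by blast
      then show ?case
        using orth_part_moments(1,2)[OF b(1)] prob_space by simp
    qed
    show "(\<lambda>a. \<integral>a'. (f (T (a, a')))\<^sup>2 \<partial>gauss) \<in> borel_measurable gauss"
      using integral_T(2)[OF integrable_f2] by (rule borel_measurable_integrable)
  qed measurable
  also have "\<dots> = (\<integral>z. (norm r - c * m z)\<^sup>2 + ?N \<partial>gauss)"
    by (rule m_transfer(1)) measurable
  also have "\<dots> = (\<integral>z. ((norm r)\<^sup>2 + ?N) - 2 * c * norm r * m z + c\<^sup>2 * (m z)\<^sup>2 \<partial>gauss)"
    by (simp add: power2_eq_square algebra_simps)
  also have "\<dots> = ((norm r)\<^sup>2 + ?N) - 2 * c * norm r * \<omega> + c\<^sup>2 * (\<integral>z. (m z)\<^sup>2 \<partial>gauss)"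
    using m_moments(1-3) Z.prob_space by simp
  also have "\<dots> \<le> ((norm r)\<^sup>2 + ?N) - 2 * c * norm r * \<omega> + c\<^sup>2 * (\<omega>\<^sup>2 + 1)"
    using m_moments(4) by (intro add_left_mono mult_left_mono) auto
  finally show ?thesis by (simp add: algebra_simps)
qed

end

text \<open>By Cauchy--Schwarz, \<open>f\<close> dominates the combination of its two components with coefficients
  \<open>s / D\<close> and \<open>\<omega> / D\<close>, chosen such that \<open>c\<close> cancels in the mean.\<close>

lemma mean_ge:
  "sqrt ((real CARD('n) - 2) / (real CARD('n) - 2 + \<omega>\<^sup>2)) * norm r \<le> (\<integral>a. f a \<partial>gauss)"
proof (cases "r = 0")
  case True
  have "0 \<le> (\<integral>a. f a \<partial>gauss)"
    by (rule Bochner_Integration.integral_nonneg) (simp add: f_def)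
  then show ?thesis by (simp add: True)
next
  case r: False
  interpret prob_space "gauss :: (real ^ 'N ^ 'n) measure" by (rule prob_space_gauss)
  interpret Z: prob_space "gauss :: (real ^ 'N) measure" by (rule prob_space_gauss)
  define s where "s = sqrt (real CARD('n) - 2)"
  define D where "D = sqrt (real CARD('n) - 2 + \<omega>\<^sup>2)"
  have pos: "real CARD('n) - 2 > 0" using n by simp
  have s: "s > 0" "s\<^sup>2 = real CARD('n) - 2" and D: "D > 0" "D\<^sup>2 = real CARD('n) - 2 + \<omega>\<^sup>2"
    using pos by (simp_all add: s_def D_def add_pos_nonneg)
  have w: "0 \<le> \<omega>" by (rule m_moments)
  \<comment> \<open>The coefficients form a unit vector, so the combination of the two components is
    bounded by their Euclidean length, which is \<open>f\<close>.\<close>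
  have unit: "(s / D)\<^sup>2 + (\<omega> / D)\<^sup>2 = 1"
    using D(1) by (simp add: power_divide add_divide_distrib[symmetric] s(2) D(2)[symmetric])
  note [measurable] = T_measurable[OF r]
  let ?l = "\<lambda>a. s / D * (norm r - c * m (u v* a)) + \<omega> / D * (c * s)"
  have "(\<integral>a. ?l a \<partial>(gauss :: (real ^ 'N ^ 'n) measure)) = (\<integral>z. s / D * (norm r - c * m z) + \<omega> / D * (c * s) \<partial>gauss)"
    by (rule m_transfer(1)[OF r]) measurable
  also have "\<dots> = s / D * (norm r - c * \<omega>) + \<omega> / D * (c * s)"
    using m_moments(1,3) Z.prob_space by simp
  also have "\<dots> = s / D * norm r" by (simp add: algebra_simps)
  finally have mean: "(\<integral>a. ?l a \<partial>(gauss :: (real ^ 'N ^ 'n) measure)) = s / D * norm r" .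
  have "(\<integral>a. ?l a \<partial>gauss) \<le> (\<integral>a. \<integral>a'. f (T (a, a')) \<partial>gauss \<partial>gauss)"
  proof (rule integral_mono_AE)
    have "integrable gauss (\<lambda>z. s / D * (norm r - c * m z) + \<omega> / D * (c * s))"
      using m_moments(1) by simp
    then show "integrable gauss ?l"
      by (subst m_transfer(2)[OF r]) simp_all
    show "integrable gauss (\<lambda>a. \<integral>a'. f (T (a, a')) \<partial>gauss)"
      by (rule integral_T(2)[OF r integrable_f])
    show "AE a in gauss. ?l a \<le> (\<integral>a'. f (T (a, a')) \<partial>gauss)"
      using f_T[OF r] integral_T(3)[OF r integrable_f]
    proof eventually_elim
      case (elim a)
      then obtain b where b: "b \<in> S" and
        fT: "\<And>a'. (f (T (a, a')))\<^sup>2 = (norm r - c * m (u v* a))\<^sup>2 + (norm (orth_part u (a' *v b)))\<^sup>2"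
        by blast
      note O = orth_part_moments(3,4)[OF r b]
      \<comment> \<open>\<open>c * s\<close> is a lower bound for the mean length of the orthogonal
        component; its coefficient has to be nonnegative, which is where
        \<open>0 \<le> \<omega>\<close> enters.\<close>
      have "?l a \<le> s / D * (norm r - c * m (u v* a)) + \<omega> / D * (\<integral>a'. norm (orth_part u (a' *v b)) \<partial>gauss)"
        using O(2) w D by (intro add_left_mono mult_left_mono) (auto simp: s_def)
      also have "\<dots> = (\<integral>a'. s / D * (norm r - c * m (u v* a)) + \<omega> / D * norm (orth_part u (a' *v b)) \<partial>gauss)"
        using O(1) prob_space by simp
      also have "\<dots> \<le> (\<integral>a'. f (T (a, a')) \<partial>gauss)"
      proof (rule integral_mono)
        show "integrable gauss (\<lambda>a'. s / D * (norm r - c * m (u v* a)) + \<omega> / D * norm (orth_part u (a' *v b)))"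
          using O(1) by simp
        fix a'
        let ?p = "norm r - c * m (u v* a)" and ?q = "norm (orth_part u (a' *v b))"
        have "(s / D * ?p + \<omega> / D * ?q)\<^sup>2 \<le> ((s / D)\<^sup>2 + (\<omega> / D)\<^sup>2) * (?p\<^sup>2 + ?q\<^sup>2)"
          using zero_le_power2[of "s / D * ?q - \<omega> / D * ?p"] by (simp add: power2_eq_square algebra_simps)
        then have "(s / D * ?p + \<omega> / D * ?q)\<^sup>2 \<le> (f (T (a, a')))\<^sup>2"
          by (simp add: unit fT)
        then show "s / D * ?p + \<omega> / D * ?q \<le> f (T (a, a'))"
          by (rule power2_le_imp_le) (simp add: f_def)
      qed (use elim in simp)
      finally show ?case .
    qed
  qed
  also have "\<dots> = (\<integral>a. f a \<partial>gauss)"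
    by (rule integral_T(1)[OF r integrable_f, symmetric])
  finally show ?thesis
    unfolding mean by (simp add: s_def D_def real_sqrt_divide)
qed

end

subsection \<open>Resampling the part of the design not used so far\<close>

text \<open>\<open>p\<close> is the orthogonal projection to the span of \<open>U\<close>, written
  in an orthonormal basis of that span. \<open>U\<close> will be the codewords of the blocks already
  visited and \<open>W\<close> the block to come.\<close>

lemma exists_orthogonal_projection:
  fixes U W :: "'a::euclidean_space set"
  assumes orth: "\<And>b b'. b \<in> U \<Longrightarrow> b' \<in> W \<Longrightarrow> b \<bullet> b' = 0"
  obtains p where "linear p" "\<And>v w. p v \<bullet> w = v \<bullet> p w" "\<And>v. p (p v) = p v"
    "\<And>b. b \<in> U \<Longrightarrow> p b = b" "\<And>b. b \<in> W \<Longrightarrow> p b = 0"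
proof -
  obtain Q where Q: "Q \<subseteq> span U" "pairwise orthogonal Q" "\<And>q. q \<in> Q \<Longrightarrow> norm q = 1"
    "independent Q" "span Q = span U"
    using orthonormal_basis_subspace[of "span U"] by (metis subspace_span)
  have fin: "finite Q" using Q(4) independent_imp_finite by blast
  define p where "p = (\<lambda>v. \<Sum>q\<in>Q. (v \<bullet> q) *\<^sub>R q)"
  have lin: "linear p"
    unfolding p_def by (rule linearI) (simp_all add: inner_simps sum.distrib algebra_simps scaleR_sum_right)
  have "p q = q" if "q \<in> Q" for q
  proof -
    have "p q = (\<Sum>q'\<in>Q. if q' = q then q else 0)"
      unfolding p_def
    proof (rule sum.cong[OF refl])
      fix q' assume "q' \<in> Q"
      then show "(q \<bullet> q') *\<^sub>R q' = (if q' = q then q else 0)"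
        using that Q(2,3) by (auto simp: pairwise_def orthogonal_def norm_eq_1)
    qed
    then show ?thesis using that fin by simp
  qed
  then have fix_span: "p v = v" if "v \<in> span U" for v
    using linear_eq_on_span[OF lin linear_ident, of Q v] that Q(5) by simp
  have range: "p v \<in> span U" for v
    unfolding p_def using Q(1) by (intro span_sum span_scale) auto
  show ?thesis
  proof (rule that[OF lin])
    show "p v \<bullet> w = v \<bullet> p w" for v w
      by (simp add: p_def inner_sum_left inner_sum_right inner_commute mult.commute)
    show "p (p v) = p v" for v by (rule fix_span[OF range])
    show "p b = b" if "b \<in> U" for b by (rule fix_span) (use that in \<open>simp add: span_base\<close>)
    show "p b = 0" if b: "b \<in> W" for b
    proof -
      have "b \<bullet> q = 0" if "q \<in> Q" for q
      proof -
        have "orthogonal b q"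
          by (rule orthogonal_to_span[of q U]) (use that Q(1) orth b in \<open>auto simp: orthogonal_def inner_commute\<close>)
        then show ?thesis by (simp add: orthogonal_def)
      qed
      then show ?thesis by (simp add: p_def)
    qed
  qed
qed

text \<open>With \<open>P\<close> the matrix of an orthogonal projection \<open>p\<close> this is
  \<open>a P + a' (I - P)\<close>: the first copy acts on the range of \<open>p\<close>, the second
  on its orthogonal complement.\<close>

definition resample ::
    "(real ^ 'N \<Rightarrow> real ^ 'N) \<Rightarrow> (real ^ 'N ^ 'n) \<times> (real ^ 'N ^ 'n) \<Rightarrow> real ^ 'N ^ 'n" where
  "resample p = (\<lambda>(a, a'). \<chi> i. p (a $ i) + (a' $ i - p (a' $ i)))"

context
  fixes p :: "real ^ 'N \<Rightarrow> real ^ 'N"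
  assumes lin: "linear p" and adj: "\<And>v w. p v \<bullet> w = v \<bullet> p w" and idem: "\<And>v. p (p v) = p v"
begin

lemma resample_mult_vec:
  "resample p (a, a') *v b = a *v p b + a' *v (b - p b)"
proof -
  have mv: "(a *v v) $ i = a $ i \<bullet> v" for a :: "real ^ 'N ^ 'n" and v i
    by (simp add: matrix_vector_mult_def inner_vec_def)
  show ?thesis
    by (simp add: vec_eq_iff mv resample_def inner_simps adj)
qed

lemma linear_resample: "linear (resample p :: (real ^ 'N ^ 'n) \<times> _ \<Rightarrow> _)"
  unfolding resample_def
  by (rule linearI) (auto simp: vec_eq_iff linear_add[OF lin] linear_scale[OF lin] algebra_simps)

lemma measurable_resample [measurable]:
  "resample p \<in> borel_measurable (borel :: ((real ^ 'N ^ 'n) \<times> (real ^ 'N ^ 'n)) measure)"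
  by (rule borel_measurable_continuous_onI, rule linear_continuous_on) (simp add: linear_linear linear_resample)

lemma distr_resample: "distr gauss borel (resample p) = (gauss :: (real ^ 'N ^ 'n) measure)"
proof (rule gauss_coisometry[OF linear_resample,
      where T' = "\<lambda>a. (\<chi> i. p (a $ i), \<chi> i. a $ i - p (a $ i))"])
  show "resample p v \<bullet> a = v \<bullet> (\<chi> i. p (a $ i), \<chi> i. a $ i - p (a $ i))" for v and a :: "real ^ 'N ^ 'n"
    by (cases v) (simp add: resample_def inner_vec_def[where 'a = "real ^ 'N"] inner_simps adj sum.distrib[symmetric])
  show "resample p (\<chi> i. p (a $ i), \<chi> i. a $ i - p (a $ i)) = a" for a :: "real ^ 'N ^ 'n"
    by (simp add: resample_def vec_eq_iff idem linear_diff[OF lin])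
qed

end

subsection \<open>The greedy encoder\<close>

locale greedy_encoding =
  fixes L :: nat and c :: "nat \<Rightarrow> real" and B :: "nat \<Rightarrow> (real ^ 'N) set"
    and sel :: "nat \<Rightarrow> real ^ 'n \<Rightarrow> (real ^ 'N \<Rightarrow> real ^ 'n) \<Rightarrow> real ^ 'N" and x :: "real ^ 'n"
  assumes code: "additive_orthogonal_code L c B" and rule: "greedy_rule L B sel"
    and n: "CARD('n) > 2" and x: "x \<noteq> 0"
begin

abbreviation choice :: "nat \<Rightarrow> real ^ 'n \<Rightarrow> real ^ 'N ^ 'n \<Rightarrow> real ^ 'N" where
  "choice l r a \<equiv> sel l r (restrict (\<lambda>b. a *v b) (B l))"

abbreviation \<beta> :: "nat \<Rightarrow> real ^ 'N ^ 'n \<Rightarrow> real ^ 'N" where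
  "\<beta> l a \<equiv> greedy_beta B sel a x l"

abbreviation res :: "nat \<Rightarrow> real ^ 'N ^ 'n \<Rightarrow> real ^ 'n" where
  "res l a \<equiv> residual B sel a x l"

definition step :: "nat \<Rightarrow> real ^ 'n \<Rightarrow> real ^ 'N ^ 'n \<Rightarrow> real ^ 'n" where
  "step l r a = r - a *v choice l r a"

lemma B:
  assumes "l \<in> {1..L}"
  shows "finite (B l)" "B l \<noteq> {}" "c l > 0" "\<And>b. b \<in> B l \<Longrightarrow> norm b = c l"
  using code assms by (auto simp: additive_orthogonal_code_def)

lemma res_0: "res 0 a = x"
  by (simp add: residual_def)

lemma \<beta>_Suc: "\<beta> (Suc l) a = \<beta> l a + choice (Suc l) (res l a) a"
  by (simp add: residual_def)

lemma res_Suc: "res (Suc l) a = step (Suc l) (res l a) a"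
  by (simp add: residual_def step_def matrix_vector_right_distrib)

lemma
  assumes l: "l \<in> {1..L}"
  shows choice_in: "choice l r a \<in> B l"
    and choice_max: "b \<in> B l \<Longrightarrow> r \<bullet> (a *v b) \<le> r \<bullet> (a *v choice l r a)"
proof -
  have *: "is_arg_max (\<lambda>b. r \<bullet> restrict (\<lambda>b. a *v b) (B l) b) (\<lambda>b. b \<in> B l) (choice l r a)"
  proof -
    have "\<forall>r. \<forall>g\<in>B l \<rightarrow>\<^sub>E UNIV. is_arg_max (\<lambda>b. r \<bullet> g b) (\<lambda>b. b \<in> B l) (sel l r g)"
      using rule l unfolding greedy_rule_def by blast
    moreover have "restrict (\<lambda>b. a *v b) (B l) \<in> B l \<rightarrow>\<^sub>E UNIV" by simp
    ultimately show ?thesis by blast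
  qed
  then show "choice l r a \<in> B l" by (simp add: is_arg_max_def)
  then show "r \<bullet> (a *v b) \<le> r \<bullet> (a *v choice l r a)" if "b \<in> B l"
    using * that by (auto simp: is_arg_max_def not_less)
qed

lemma measurable_choice:
  assumes l: "l \<in> {1..L}" and [measurable]: "f \<in> borel_measurable M" "g \<in> borel_measurable M"
  shows "(\<lambda>w. choice l (f w) (g w)) \<in> borel_measurable M"
proof -
  have sel: "(\<lambda>(r, g). sel l r g) \<in> borel \<Otimes>\<^sub>M (\<Pi>\<^sub>M b\<in>B l. borel) \<rightarrow>\<^sub>M count_space (B l)"
    using rule l by (simp add: greedy_rule_def)
  have "(\<lambda>w. (f w, restrict (\<lambda>b. g w *v b) (B l))) \<in> M \<rightarrow>\<^sub>M borel \<Otimes>\<^sub>M (\<Pi>\<^sub>M b\<in>B l. borel)"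
    by measurable
  from measurable_compose[OF this sel]
  have "(\<lambda>w. choice l (f w) (g w)) \<in> M \<rightarrow>\<^sub>M count_space (B l)" by simp
  then show ?thesis
    by (rule measurable_compose) simp
qed

lemma measurable_\<beta>: "l \<le> L \<Longrightarrow> \<beta> l \<in> borel_measurable borel"
proof (induction l)
  case (Suc l)
  then have [measurable]: "\<beta> l \<in> borel_measurable borel" by simp
  have [measurable]: "(\<lambda>a. choice (Suc l) (res l a) a) \<in> borel_measurable borel"
    by (rule measurable_choice) (use Suc.prems in \<open>simp_all add: residual_def\<close>)
  show ?case
    unfolding \<beta>_Suc[abs_def] by measurable
qed simp

lemma measurable_res: "l \<le> L \<Longrightarrow> res l \<in> borel_measurable borel"
  using measurable_\<beta>[of l] unfolding residual_def by measurable

lemma norm_\<beta>_le: "l \<le> L \<Longrightarrow> norm (\<beta> l a) \<le> (\<Sum>k=1..l. c k)"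
proof (induction l)
  case (Suc l)
  have "norm (\<beta> (Suc l) a) \<le> norm (\<beta> l a) + norm (choice (Suc l) (res l a) a)"
    unfolding \<beta>_Suc by (rule norm_triangle_ineq)
  also have "norm (choice (Suc l) (res l a) a) = c (Suc l)"
    using Suc.prems by (intro B choice_in) auto
  finally show ?case using Suc by simp
qed simp

lemma integrable_res2:
  assumes "l \<le> L"
  shows "integrable gauss (\<lambda>a. (norm (res l a))\<^sup>2)"
proof (rule Bochner_Integration.integrable_bound)
  interpret prob_space "gauss :: (real ^ 'N ^ 'n) measure" by (rule prob_space_gauss)
  let ?C = "\<Sum>k=1..l. c k"
  show "integrable gauss (\<lambda>a :: real ^ 'N ^ 'n. 2 * (norm x)\<^sup>2 + 2 * ?C\<^sup>2 * (norm a)\<^sup>2)"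
    using integrable_norm2_gauss[where 'a = "real ^ 'N ^ 'n"] by simp
  show "(\<lambda>a. (norm (res l a))\<^sup>2) \<in> borel_measurable gauss"
    using measurable_res[OF assms] by measurable
  show "AE a in gauss. norm ((norm (res l a))\<^sup>2) \<le> norm (2 * (norm x)\<^sup>2 + 2 * ?C\<^sup>2 * (norm a)\<^sup>2)"
  proof (rule AE_I2)
    fix a
    have "norm (res l a) \<le> norm x + norm a * norm (\<beta> l a)"
      unfolding residual_def
      by (rule order_trans[OF norm_triangle_ineq4 add_left_mono[OF norm_matrix_vector_mult_le]])
    also have "\<dots> \<le> norm x + norm a * ?C"
      using norm_\<beta>_le[OF assms, of a] by (intro add_left_mono mult_left_mono) auto
    finally have "(norm (res l a))\<^sup>2 \<le> (norm x + norm a * ?C)\<^sup>2"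
      by (rule power_mono) simp
    also have "\<dots> \<le> 2 * (norm x)\<^sup>2 + 2 * ?C\<^sup>2 * (norm a)\<^sup>2"
      using zero_le_power2[of "norm x - norm a * ?C"] by (simp add: power2_eq_square algebra_simps)
    finally show "norm ((norm (res l a))\<^sup>2) \<le> norm (2 * (norm x)\<^sup>2 + 2 * ?C\<^sup>2 * (norm a)\<^sup>2)"
      by simp
  qed
qed

lemma integrable_res:
  assumes "l \<le> L"
  shows "integrable gauss (\<lambda>a. norm (res l a))"
proof -
  interpret prob_space "gauss :: (real ^ 'N ^ 'n) measure" by (rule prob_space_gauss)
  show ?thesis
    by (rule square_integrable_imp_integrable[OF _ integrable_res2[OF assms]])
       (use measurable_res[OF assms] in measurable)
qed

lemma finite_range_\<beta>: "l \<le> L \<Longrightarrow> finite (range (\<beta> l))"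
proof (induction l)
  case (Suc l)
  have "range (\<beta> (Suc l)) \<subseteq> (\<lambda>(b, b'). b + b') ` (range (\<beta> l) \<times> B (Suc l))"
    using choice_in[of "Suc l"] Suc.prems by (auto simp: \<beta>_Suc image_iff)
  moreover have "finite (range (\<beta> l) \<times> B (Suc l))"
    using Suc B(1)[of "Suc l"] by simp
  ultimately show ?case by (meson finite_imageI finite_subset)
qed simp

text \<open>At \<open>r = 0\<close> all codewords tie, the choice may depend on all of the design,
  and \<open>second_moment_le\<close> does not apply. A vanishing residual means
  \<open>a *v b = x\<close> for one of finitely many \<open>b\<close>; pairing with \<open>x\<close>
  confines \<open>a\<close> to a hyperplane unless \<open>b = 0\<close>, which is
  impossible.\<close>

lemma AE_res_nonzero:
  assumes "l \<le> L"
  shows "AE a in gauss. res l a \<noteq> 0"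
proof -
  have "AE a in gauss. a *v b \<noteq> x" for b
  proof (cases "b = 0")
    case False
    then have "AE a in gauss. outer x b \<bullet> a \<noteq> x \<bullet> x"
      using x by (intro AE_gauss_hyperplane) (simp add: outer_eq_0_iff)
    then show ?thesis
      by eventually_elim (auto simp: inner_commute[of "outer _ _"] inner_outer)
  qed (use x in simp)
  then have "AE a in gauss. \<forall>b\<in>range (\<beta> l). a *v b \<noteq> x"
    by (intro AE_finite_allI finite_range_\<beta> assms)
  then show ?thesis
    by eventually_elim (auto simp: residual_def dest: sym)
qed

text \<open>The rule receives only the residual and the images of the current block, so the encoder
  learns about the design through the images of the blocks visited and nothing else.\<close>

lemma \<beta>_cong:
  assumes "\<And>k b. k \<in> {1..l} \<Longrightarrow> b \<in> B k \<Longrightarrow> a *v b = a' *v b" and "l \<le> L"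
  shows "\<beta> l a = \<beta> l a' \<and> res l a = res l a'"
  using assms
proof (induction l)
  case (Suc l)
  have "\<beta> l a = \<beta> l a' \<and> res l a = res l a'"
  proof (rule Suc.IH)
    fix k b assume "k \<in> {1..l}" and b: "b \<in> B k"
    then have "k \<in> {1..Suc l}" by simp
    then show "a *v b = a' *v b" using b by (rule Suc.prems(1))
  qed (use Suc.prems(2) in simp)
  then have IH: "\<beta> l a = \<beta> l a'" "res l a = res l a'" by simp_all
  have "restrict (\<lambda>b. a *v b) (B (Suc l)) = restrict (\<lambda>b. a' *v b) (B (Suc l))"
    using Suc.prems by (intro restrict_ext) auto
  then have ch: "choice (Suc l) (res l a) a = choice (Suc l) (res l a') a'"
    using IH by simp
  moreover have "a *v choice (Suc l) (res l a') a' = a' *v choice (Suc l) (res l a') a'"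
    using Suc.prems choice_in[of "Suc l"] by auto
  ultimately show ?case
    unfolding res_Suc step_def \<beta>_Suc using IH by simp
qed (simp add: residual_def)

text \<open>The residual \<open>res l a\<close> only depends on the image of \<open>B 1 \<union> \<dots> \<union> B l\<close>, so that the
  action of the design on \<open>B (Suc l)\<close> can be replaced by that of an independent copy.\<close>

lemma integral_res_Suc:
  fixes \<psi> :: "real ^ 'n \<Rightarrow> real"
  assumes l: "Suc l \<le> L" and [measurable]: "\<psi> \<in> borel_measurable borel"
    and int: "integrable gauss (\<lambda>a. \<psi> (res (Suc l) a))"
  shows "(\<integral>a. \<psi> (res (Suc l) a) \<partial>gauss) = (\<integral>a. \<integral>a'. \<psi> (step (Suc l) (res l a) a') \<partial>gauss \<partial>gauss)"
    and "integrable gauss (\<lambda>a. \<integral>a'. \<psi> (step (Suc l) (res l a) a') \<partial>gauss)"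
proof -
  interpret prob_space "gauss :: (real ^ 'N ^ 'n) measure" by (rule prob_space_gauss)
  interpret pair_prob_space "gauss :: (real ^ 'N ^ 'n) measure" "gauss :: (real ^ 'N ^ 'n) measure" ..
  have "b \<bullet> b' = 0" if b: "b \<in> (\<Union>k\<in>{1..l}. B k)" and b': "b' \<in> B (Suc l)" for b b'
  proof -
    obtain k where k: "k \<in> {1..l}" "b \<in> B k" using b by blast
    then have "k \<in> {1..L}" "Suc l \<in> {1..L}" "k \<noteq> Suc l" using l by auto
    then show ?thesis
      using code k(2) b' unfolding additive_orthogonal_code_def by blast
  qed
  then obtain p where p: "linear p" "\<And>v w. p v \<bullet> w = v \<bullet> p w" "\<And>v. p (p v) = p v"
    and pU: "\<And>b. b \<in> (\<Union>k\<in>{1..l}. B k) \<Longrightarrow> p b = b" and pW: "\<And>b. b \<in> B (Suc l) \<Longrightarrow> p b = 0"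
    using exists_orthogonal_projection[of "\<Union>k\<in>{1..l}. B k" "B (Suc l)"] by blast
  note [measurable] = measurable_resample[OF p, where 'n = 'n] measurable_res[OF l]
  \<comment> \<open>\<open>p\<close> fixes the codewords of blocks 1 to \<open>l\<close> and kills
    those of block \<open>Suc l\<close>: the history is computed from \<open>a\<close>, the new step
    from \<open>a'\<close>.\<close>
  have T: "res (Suc l) (resample p (a, a')) = step (Suc l) (res l a) a'" for a a'
  proof -
    have "res l (resample p (a, a')) = res l a"
    proof (rule \<beta>_cong[THEN conjunct2])
      fix k b assume "k \<in> {1..l}" "b \<in> B k"
      then have "p b = b" by (intro pU) blast
      then show "resample p (a, a') *v b = a *v b" by (simp add: resample_mult_vec[OF p])
    qed (use l in simp)
    moreover have mv: "resample p (a, a') *v b = a' *v b" if "b \<in> B (Suc l)" for b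
      using that by (simp add: resample_mult_vec[OF p] pW)
    moreover have "restrict (\<lambda>b. resample p (a, a') *v b) (B (Suc l)) = restrict (\<lambda>b. a' *v b) (B (Suc l))"
      using mv by (intro restrict_ext) auto
    moreover have "choice (Suc l) (res l a) a' \<in> B (Suc l)"
      using l by (intro choice_in) auto
    ultimately show ?thesis
      unfolding res_Suc step_def by simp
  qed
  have int': "integrable (gauss \<Otimes>\<^sub>M gauss) (\<lambda>(a, a'). \<psi> (step (Suc l) (res l a) a'))"
  proof -
    have "integrable gauss (\<lambda>v. \<psi> (res (Suc l) (resample p v)))"
      using int by (subst (asm) distr_resample[OF p, symmetric], subst (asm) integrable_distr_eq) simp_all
    then show ?thesis
      by (simp add: gauss_prod T[symmetric] case_prod_beta')
  qed
  have "(\<integral>a. \<psi> (res (Suc l) a) \<partial>gauss) = (\<integral>v. \<psi> (res (Suc l) (resample p v)) \<partial>gauss)"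
    by (subst distr_resample[OF p, symmetric], subst integral_distr) simp_all
  also have "\<dots> = (\<integral>(a, a'). \<psi> (step (Suc l) (res l a) a') \<partial>(gauss \<Otimes>\<^sub>M gauss))"
    by (simp add: gauss_prod T[symmetric] case_prod_beta')
  finally show "(\<integral>a. \<psi> (res (Suc l) a) \<partial>gauss) = (\<integral>a. \<integral>a'. \<psi> (step (Suc l) (res l a) a') \<partial>gauss \<partial>gauss)"
    using integral_fst[OF int'] by simp
  show "integrable gauss (\<lambda>a. \<integral>a'. \<psi> (step (Suc l) (res l a) a') \<partial>gauss)"
    by (rule integrable_fst[OF int'])
qed

section \<open>Recursions for the first two moments of the residual norm\<close>

definition "R l = (\<integral>a. norm (res l a) \<partial>gauss)"
definition "V l = (\<integral>a. (norm (res l a))\<^sup>2 \<partial>gauss)"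
definition "w l = gaussian_width (B l)"

lemma greedy_step_choice:
  assumes l: "l \<in> {1..L}"
  shows "greedy_step (B l) (c l) r (choice l r)"
proof
  show "choice l r \<in> borel_measurable borel"
    by (rule measurable_choice[OF l]) simp_all
qed (use B[OF l] n choice_in[OF l] choice_max[OF l] in auto)

text \<open>\<open>mean_ge\<close> holds for each value of the residual and is linear in its norm,
  so it can be integrated over the past; since \<open>c\<close> has cancelled, this recursion for
  \<open>R\<close> is closed.\<close>

lemma R_Suc:
  assumes l: "Suc l \<le> L"
  shows "sqrt ((real CARD('n) - 2) / (real CARD('n) - 2 + (w (Suc l))\<^sup>2)) * R l \<le> R (Suc l)"
proof -
  let ?q = "sqrt ((real CARD('n) - 2) / (real CARD('n) - 2 + (w (Suc l))\<^sup>2))"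
  have "?q * R l = (\<integral>a. ?q * norm (res l a) \<partial>gauss)"
    by (simp add: R_def)
  also have "\<dots> \<le> (\<integral>a. \<integral>a'. norm (step (Suc l) (res l a) a') \<partial>gauss \<partial>gauss)"
  proof (rule integral_mono)
    show "integrable gauss (\<lambda>a. ?q * norm (res l a))"
      using integrable_res[of l] l by simp
    show "integrable gauss (\<lambda>a. \<integral>a'. norm (step (Suc l) (res l a) a') \<partial>gauss)"
      by (rule integral_res_Suc(2)[OF l _ integrable_res[OF l]]) simp
    fix a
    interpret greedy_step "B (Suc l)" "c (Suc l)" "res l a" "choice (Suc l) (res l a)"
      using l by (intro greedy_step_choice) auto
    show "?q * norm (res l a) \<le> (\<integral>a'. norm (step (Suc l) (res l a) a') \<partial>gauss)"
      using mean_ge by (simp add: f_def \<omega>_def step_def w_def)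
  qed
  also have "\<dots> = R (Suc l)"
    unfolding R_def by (rule integral_res_Suc(1)[OF l _ integrable_res[OF l], symmetric]) simp
  finally show ?thesis .
qed

text \<open>The cross term is linear in the norm of the residual and integrates to the first moment
  \<open>R l\<close>. An upper bound on \<open>V\<close> therefore rests on the lower bound for
  \<open>R\<close>.\<close>

lemma V_Suc:
  assumes l: "Suc l \<le> L"
  shows "V (Suc l) \<le> V l - 2 * c (Suc l) * w (Suc l) * R l + (c (Suc l))\<^sup>2 * ((w (Suc l))\<^sup>2 + real CARD('n))"
proof -
  interpret prob_space "gauss :: (real ^ 'N ^ 'n) measure" by (rule prob_space_gauss)
  let ?K = "(c (Suc l))\<^sup>2 * ((w (Suc l))\<^sup>2 + real CARD('n))"
  let ?l = "\<lambda>a. (norm (res l a))\<^sup>2 - 2 * c (Suc l) * w (Suc l) * norm (res l a) + ?K"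
  have int: "integrable gauss (\<lambda>a. norm (res l a))" "integrable gauss (\<lambda>a. (norm (res l a))\<^sup>2)"
    using l by (auto intro: integrable_res integrable_res2)
  have "V (Suc l) = (\<integral>a. \<integral>a'. (norm (step (Suc l) (res l a) a'))\<^sup>2 \<partial>gauss \<partial>gauss)"
    unfolding V_def by (rule integral_res_Suc(1)[OF l _ integrable_res2[OF l]]) simp
  also have "\<dots> \<le> (\<integral>a. ?l a \<partial>gauss)"
  proof (rule integral_mono_AE)
    show "integrable gauss (\<lambda>a. \<integral>a'. (norm (step (Suc l) (res l a) a'))\<^sup>2 \<partial>gauss)"
      by (rule integral_res_Suc(2)[OF l _ integrable_res2[OF l]]) simp
    show "integrable gauss ?l"
      using int by simp
    show "AE a in gauss. (\<integral>a'. (norm (step (Suc l) (res l a) a'))\<^sup>2 \<partial>gauss) \<le> ?l a"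
      using AE_res_nonzero[OF Suc_leD[OF l]]
    proof eventually_elim
      case (elim a)
      interpret greedy_step "B (Suc l)" "c (Suc l)" "res l a" "choice (Suc l) (res l a)"
        using l by (intro greedy_step_choice) auto
      show ?case
        using second_moment_le[OF elim] by (simp add: f_def \<omega>_def step_def w_def)
    qed
  qed
  also have "\<dots> = V l - 2 * c (Suc l) * w (Suc l) * R l + ?K"
    using int prob_space by (simp add: V_def R_def)
  finally show ?thesis .
qed

lemma R_0: "R 0 = norm x" and V_0: "V 0 = (norm x)\<^sup>2"
proof -
  interpret prob_space "gauss :: (real ^ 'N ^ 'n) measure" by (rule prob_space_gauss)
  show "R 0 = norm x" "V 0 = (norm x)\<^sup>2"
    using prob_space by (simp_all add: R_def V_def res_0)
qed

lemma w_nonneg: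
  assumes "l \<in> {1..L}"
  shows "0 \<le> w l"
proof -
  interpret greedy_step "B l" "c l" x "choice l x"
    by (rule greedy_step_choice[OF assms])
  show ?thesis using m_moments(5) by (simp add: \<omega>_def w_def)
qed

lemma R_square_le_V:
  assumes "l \<le> L"
  shows "(R l)\<^sup>2 \<le> V l"
proof -
  interpret prob_space "gauss :: (real ^ 'N ^ 'n) measure" by (rule prob_space_gauss)
  show ?thesis
    unfolding R_def V_def
    by (rule expectation_square_le[OF integrable_res2[OF assms]])
       (use measurable_res[OF assms] in measurable)
qed

lemma R_ge:
  assumes "l \<le> L"
  shows "norm x * sqrt (\<Prod>k=1..l. (real CARD('n) - 2) / (real CARD('n) - 2 + (w k)\<^sup>2)) \<le> R l"
  using assms
proof (induction l)
  case 0
  then show ?case by (simp add: R_0)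
next
  case (Suc l)
  let ?q = "\<lambda>k. (real CARD('n) - 2) / (real CARD('n) - 2 + (w k)\<^sup>2)"
  have "norm x * sqrt (\<Prod>k=1..Suc l. ?q k) = sqrt (?q (Suc l)) * (norm x * sqrt (\<Prod>k=1..l. ?q k))"
  proof -
    have "(\<Prod>k=1..Suc l. ?q k) = ?q (Suc l) * (\<Prod>k=1..l. ?q k)" by simp
    then show ?thesis by (simp only: real_sqrt_mult mult_ac)
  qed
  also have "\<dots> \<le> sqrt (?q (Suc l)) * R l"
    using Suc n by (intro mult_left_mono) auto
  also have "\<dots> \<le> R (Suc l)"
    by (rule R_Suc[OF Suc.prems])
  finally show ?case .
qed

lemma det_centering_eq:
  assumes "gaussian_design M A" "l \<le> L"
  shows "det_centering M A B sel x l = (R l)\<^sup>2 / real CARD('n)"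
proof -
  have "R l = (\<integral>w. norm (residual B sel (A w) x l) \<partial>M)"
    unfolding R_def distr_gaussian_design(2)[OF assms(1), symmetric]
    using distr_gaussian_design(1)[OF assms(1)] measurable_res[OF assms(2)]
    by (subst integral_distr) simp_all
  then show ?thesis by (simp add: det_centering_def)
qed

end

subsection \<open>Solving the recursion\<close>

text \<open>Relative gap between the shrinkage \<open>(n - 2) / (n - 2 + w\<^sup>2)\<close> proved
  for one step and the ideal factor \<open>n / (n + w\<^sup>2)\<close>: their quotient is
  \<open>1 - eps_term n w\<close>.\<close>

definition eps_term :: "nat \<Rightarrow> real \<Rightarrow> real" where
  "eps_term n w = 2 / real n * (w\<^sup>2 / (real n - 2 + w\<^sup>2))"

context
  fixes n :: nat and \<omega> :: "nat \<Rightarrow> real"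
  assumes n: "n > 2"
begin

lemma shrink_denom_pos: "0 < real n - 2 + w\<^sup>2" "0 < real n + w\<^sup>2" for w :: real
  using n by (auto intro: add_pos_nonneg)

lemma eps_factor:
  "((real n - 2) * (real n + w\<^sup>2)) / (real n * (real n - 2 + w\<^sup>2)) = 1 - eps_term n w"
proof -
  have "(real n - 2) * (real n + w\<^sup>2) = real n * (real n - 2 + w\<^sup>2) - 2 * w\<^sup>2"
    by (simp add: algebra_simps)
  moreover have "real n * (real n - 2 + w\<^sup>2) \<noteq> 0"
    using n shrink_denom_pos(1)[of w] by simp
  ultimately show ?thesis
    by (simp add: eps_term_def diff_divide_distrib)
qed

lemma eps_term_bounds: "0 \<le> eps_term n w" "eps_term n w \<le> 1"
proof -
  have 1: "w\<^sup>2 / (real n - 2 + w\<^sup>2) \<le> 1" "0 \<le> w\<^sup>2 / (real n - 2 + w\<^sup>2)"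
    using n shrink_denom_pos(1)[of w] by simp_all
  have 2: "2 / real n \<le> 1" "0 \<le> 2 / real n" using n by simp_all
  show "0 \<le> eps_term n w"
    unfolding eps_term_def by (rule mult_nonneg_nonneg[OF 2(2) 1(2)])
  show "eps_term n w \<le> 1"
    unfolding eps_term_def by (rule mult_le_one[OF 2(1) 1(2) 1(1)])
qed

lemma eps_corr_alt: "eps_corr n \<omega> l = 1 - (\<Prod>k=1..l. 1 - eps_term n (\<omega> k))"
  by (simp only: eps_corr_def eps_factor)

lemma eps_corr_le:
  "eps_corr n \<omega> l \<le> 2 / real n * (\<Sum>k=1..l. (\<omega> k)\<^sup>2 / (real n - 2 + (\<omega> k)\<^sup>2))"
proof -
  have "1 - (\<Sum>k=1..l. eps_term n (\<omega> k)) \<le> (\<Prod>k=1..l. 1 - eps_term n (\<omega> k))"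
    by (rule Weierstrass_prod_ineq) (simp add: eps_term_bounds)
  then show ?thesis
    by (simp add: eps_corr_alt eps_term_def sum_distrib_left)
qed

lemma eps_corr_bounds: "0 \<le> eps_corr n \<omega> l" "eps_corr n \<omega> l \<le> 1"
  by (auto simp: eps_corr_alt eps_term_bounds intro!: prod_nonneg prod_le_1)

lemma eps_corr_mono: "eps_corr n \<omega> l \<le> eps_corr n \<omega> (Suc l)"
proof -
  have "(\<Prod>k=1..l. 1 - eps_term n (\<omega> k)) * (1 - eps_term n (\<omega> (Suc l))) \<le> (\<Prod>k=1..l. 1 - eps_term n (\<omega> k))"
    by (rule mult_left_le) (auto simp: eps_term_bounds intro!: prod_nonneg)
  then show ?thesis by (simp add: eps_corr_alt)
qed

text \<open>The ideal product corrected by \<open>1 - eps_corr\<close> is the product of the proved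
  shrinkages. For a source of squared norm \<open>n \<sigma>\<^sup>2\<close> this is the square of
  the bound in \<open>R_ge\<close> divided by \<open>n\<close>.\<close>

lemma Delta_corr_eps:
  "Delta_corr n \<sigma> \<omega> l * (1 - eps_corr n \<omega> l) = \<sigma>\<^sup>2 * (\<Prod>k=1..l. (real n - 2) / (real n - 2 + (\<omega> k)\<^sup>2))"
proof -
  have "(real n / (real n + (\<omega> k)\<^sup>2)) * (((real n - 2) * (real n + (\<omega> k)\<^sup>2)) / (real n * (real n - 2 + (\<omega> k)\<^sup>2)))
     = (real n - 2) / (real n - 2 + (\<omega> k)\<^sup>2)" for k
    using n shrink_denom_pos[of "\<omega> k"] by simp
  then show ?thesis
    by (simp add: Delta_corr_def eps_corr_def prod.distrib[symmetric] mult.assoc)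
qed

lemma Delta_corr_bounds:
  assumes "\<sigma> > 0"
  shows "0 < Delta_corr n \<sigma> \<omega> l" "Delta_corr n \<sigma> \<omega> l \<le> \<sigma>\<^sup>2"
proof -
  have "0 < (\<Prod>k=1..l. real n / (real n + (\<omega> k)\<^sup>2))"
    using n shrink_denom_pos by (intro prod_pos) simp
  then show "0 < Delta_corr n \<sigma> \<omega> l" using assms by (simp add: Delta_corr_def)
  have "(\<Prod>k=1..l. real n / (real n + (\<omega> k)\<^sup>2)) \<le> 1"
    using n shrink_denom_pos by (intro prod_le_1) (simp add: add_nonneg_nonneg)
  then show "Delta_corr n \<sigma> \<omega> l \<le> \<sigma>\<^sup>2"
    unfolding Delta_corr_def by (rule mult_left_le) simp
qed

lemma Delta_corr_Suc:
  "Delta_corr n \<sigma> \<omega> (Suc l) = Delta_corr n \<sigma> \<omega> l * (real n / (real n + (\<omega> (Suc l))\<^sup>2))"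
  by (simp add: Delta_corr_def)

text \<open>\<open>V\<close> stands for \<open>E |r\<^sub>l|\<^sup>2\<close> and \<open>R\<close> for \<open>E |r\<^sub>l|\<close>. The power \<open>c\<close> minimizes the right-hand side of
  the recursion for \<open>V\<close> at \<open>R\<^sup>2 = V = n \<Delta>\<^sub>l\<close>.\<close>

lemma recursion_step:
  fixes V V' R c :: real
  assumes \<sigma>: "\<sigma> > 0" and c: "c > 0" and w: "0 \<le> \<omega> (Suc l)"
    and c2: "c\<^sup>2 = \<sigma>\<^sup>2 * (\<omega> (Suc l))\<^sup>2 / (real n + (\<omega> (Suc l))\<^sup>2) * (\<Prod>k=1..Suc l. real n / (real n + (\<omega> k)\<^sup>2))"
    and R: "sqrt (real n) * \<sigma> * sqrt (\<Prod>k=1..l. (real n - 2) / (real n - 2 + (\<omega> k)\<^sup>2)) \<le> R"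
    and V': "V' \<le> V - 2 * c * \<omega> (Suc l) * R + c\<^sup>2 * ((\<omega> (Suc l))\<^sup>2 + real n)"
    and V: "V / real n \<le> Delta_corr n \<sigma> \<omega> l + 2 * (\<sigma>\<^sup>2 - Delta_corr n \<sigma> \<omega> l) * eps_corr n \<omega> (l - 1)"
  shows "V' / real n \<le> Delta_corr n \<sigma> \<omega> (Suc l) + 2 * (\<sigma>\<^sup>2 - Delta_corr n \<sigma> \<omega> (Suc l)) * eps_corr n \<omega> l"
proof -
  define w where "w = \<omega> (Suc l)"
  define D where "D = Delta_corr n \<sigma> \<omega> l"
  define D' where "D' = Delta_corr n \<sigma> \<omega> (Suc l)"
  define e where "e = eps_corr n \<omega> l"
  define N where "N = real n"
  have N: "N > 2" using n by (simp add: N_def)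
  have w0: "0 \<le> w" using w by (simp add: w_def)
  have pos: "N + w\<^sup>2 > 0" using N by (simp add: add_pos_nonneg)
  have D: "0 < D" "D \<le> \<sigma>\<^sup>2" unfolding D_def by (rule Delta_corr_bounds[OF \<sigma>])+
  have D': "D' = D * (N / (N + w\<^sup>2))" unfolding D'_def D_def N_def w_def by (rule Delta_corr_Suc)
  have e: "0 \<le> e" "e \<le> 1" unfolding e_def by (rule eps_corr_bounds)+
  have diff: "D - D' = D * w\<^sup>2 / (N + w\<^sup>2)" using pos by (simp add: D' field_simps)
  have c2': "c\<^sup>2 = D' * w\<^sup>2 / (N + w\<^sup>2)"
    unfolding c2 D'_def Delta_corr_def w_def N_def by simp
  \<comment> \<open>Expressing \<open>D'\<close> by \<open>D\<close> turns the allocation into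
    \<open>c\<^sup>2 = N D w\<^sup>2 / (N + w\<^sup>2)\<^sup>2\<close>, whose root is
    explicit.\<close>
  have c_eq: "c = sqrt (N * D) * w / (N + w\<^sup>2)"
  proof -
    have "c\<^sup>2 = (sqrt (N * D) * w / (N + w\<^sup>2))\<^sup>2"
      using N D(1) unfolding c2' D' by (simp add: power_divide power_mult_distrib power2_eq_square)
    then show ?thesis
      by (rule power2_eq_imp_eq) (use c w0 N D(1) pos in simp_all)
  qed
  \<comment> \<open>Weakening \<open>sqrt (1 - e)\<close> to \<open>1 - e\<close> makes the error
    linear in \<open>e\<close>, so that it can be summed over the steps.\<close>
  have "sqrt (N * D) * (1 - e) \<le> R"
  proof -
    have "1 - e \<le> sqrt (1 - e)"
      using e by (intro real_le_rsqrt) (simp add: power2_eq_square mult_left_le)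
    then have "sqrt (N * D) * (1 - e) \<le> sqrt (N * D) * sqrt (1 - e)"
      using N D(1) by (intro mult_left_mono) auto
    also have "\<dots> = sqrt (N * (D * (1 - e)))"
      by (simp add: real_sqrt_mult mult.assoc)
    also have "\<dots> = sqrt N * \<sigma> * sqrt (\<Prod>k=1..l. (real n - 2) / (real n - 2 + (\<omega> k)\<^sup>2))"
      unfolding D_def e_def Delta_corr_eps using \<sigma> by (simp add: real_sqrt_mult)
    finally show ?thesis using R by (simp add: N_def)
  qed
  then have "2 * c * w * (sqrt (N * D) * (1 - e)) \<le> 2 * c * w * R"
    using c w0 by (intro mult_left_mono) auto
  moreover have "2 * c * w * (sqrt (N * D) * (1 - e)) = N * (2 * (D - D') * (1 - e))"
  proof -
    have "2 * c * w * (sqrt (N * D) * (1 - e)) = 2 * (sqrt (N * D))\<^sup>2 * w\<^sup>2 / (N + w\<^sup>2) * (1 - e)"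
      unfolding c_eq by (simp only: power2_eq_square times_divide_eq_left times_divide_eq_right mult_ac)
    also have "(sqrt (N * D))\<^sup>2 = N * D" using N D(1) by simp
    finally have "2 * c * w * (sqrt (N * D) * (1 - e)) = 2 * (N * D) * w\<^sup>2 / (N + w\<^sup>2) * (1 - e)" .
    then show ?thesis by (simp add: diff)
  qed
  moreover have "c\<^sup>2 * (w\<^sup>2 + N) = N * (D - D')"
  proof -
    have "c\<^sup>2 * (w\<^sup>2 + N) = D' * w\<^sup>2"
      unfolding c2' using pos by (simp add: add.commute[of "w\<^sup>2"])
    then show ?thesis unfolding diff by (simp add: D')
  qed
  moreover have div: "v / N \<le> X" if "v \<le> N * X" for v X
    using that N by (simp add: pos_divide_le_eq mult.commute)
  ultimately have "V' \<le> V - N * (2 * (D - D') * (1 - e)) + N * (D - D')"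
    using V' unfolding w_def[symmetric] N_def[symmetric] by linarith
  also have "\<dots> = N * (V / N - 2 * (D - D') * (1 - e) + (D - D'))"
    using N by (simp add: field_simps)
  finally have "V' / N \<le> V / N - 2 * (D - D') * (1 - e) + (D - D')"
    by (rule div)
  \<comment> \<open>Monotonicity of \<open>eps_corr\<close> replaces the earlier error by the
    current \<open>e\<close>; a common \<open>e\<close> is what lets the errors telescope.\<close>
  moreover have "V / N \<le> D + 2 * (\<sigma>\<^sup>2 - D) * e"
  proof -
    have "eps_corr n \<omega> (l - 1) \<le> e"
      unfolding e_def using eps_corr_mono[of "l - 1"] by (cases l) auto
    then have "2 * (\<sigma>\<^sup>2 - D) * eps_corr n \<omega> (l - 1) \<le> 2 * (\<sigma>\<^sup>2 - D) * e"
      using D by (intro mult_left_mono) auto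
    then show ?thesis using V unfolding D_def[symmetric] N_def[symmetric] by linarith
  qed
  \<comment> \<open>The gain is \<open>(D - D') (1 - 2 e)\<close>, hence the step adds the error
    \<open>2 (D - D') e\<close>, and \<open>(\<sigma>\<^sup>2 - D) + (D - D')\<close> telescopes to
    \<open>\<sigma>\<^sup>2 - D'\<close>.\<close>
  ultimately have "V' / N \<le> D' + 2 * (\<sigma>\<^sup>2 - D') * e"
    by (simp add: algebra_simps)
  then show ?thesis by (simp add: N_def D'_def e_def)
qed

end

theorem theorem3:
  fixes M :: "'w measure"
    and A :: "'w \<Rightarrow> real ^ 'N ^ 'n"
    and B :: "nat \<Rightarrow> (real ^ 'N) set"
    and c \<omega> :: "nat \<Rightarrow> real"
    and sel :: "nat \<Rightarrow> real ^ 'n \<Rightarrow> (real ^ 'N \<Rightarrow> real ^ 'n) \<Rightarrow> real ^ 'N"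
    and x :: "real ^ 'n"
    and \<sigma> :: real
    and n L :: nat
  assumes n_def: "n = CARD('n)" and n_gt: "n > 2"
    and code: "additive_orthogonal_code L c B"
    and width: "\<And>l. l \<in> {1..L} \<Longrightarrow> \<omega> l = gaussian_width (B l)"
    and design: "gaussian_design M A"
    and rule: "greedy_rule L B sel"
    and sigma: "\<sigma> > 0"
    and source: "norm x = sqrt (real n) * \<sigma>"
  shows "(\<forall>l\<in>{0..L}. eps_corr n \<omega> l
            \<le> 2 / real n * (\<Sum>k=1..l. (\<omega> k)\<^sup>2 / (real n - 2 + (\<omega> k)\<^sup>2))) \<and>
         (\<forall>l\<in>{1..L}.
            ((\<forall>j\<in>{1..L}. (c j)\<^sup>2 = \<sigma>\<^sup>2 * (\<omega> j)\<^sup>2 / (real n + (\<omega> j)\<^sup>2)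
                 * (\<Prod>k=1..j. real n / (real n + (\<omega> k)\<^sup>2))) \<longrightarrow>
               det_centering M A B sel x l
                 \<le> Delta_corr n \<sigma> \<omega> l
                   + 2 * (\<sigma>\<^sup>2 - Delta_corr n \<sigma> \<omega> l) * eps_corr n \<omega> (l - 1)) \<and>
            det_centering M A B sel x l \<ge> Delta_corr n \<sigma> \<omega> l * (1 - eps_corr n \<omega> l))"
proof -
  have "norm x > 0" using source sigma n_gt by simp
  then interpret greedy_encoding L c B sel x
    using code rule n_def n_gt by unfold_locales auto
  have w: "w k = \<omega> k" if "k \<in> {1..L}" for k
    using width[OF that] by (simp add: w_def)
  have R: "sqrt (real n) * \<sigma> * sqrt (\<Prod>k=1..l. (real n - 2) / (real n - 2 + (\<omega> k)\<^sup>2)) \<le> R l"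
    if "l \<le> L" for l
  proof -
    have "(\<Prod>k=1..l. (real n - 2) / (real n - 2 + (w k)\<^sup>2)) = (\<Prod>k=1..l. (real n - 2) / (real n - 2 + (\<omega> k)\<^sup>2))"
      using that by (intro prod.cong refl) (simp add: w)
    then show ?thesis
      using R_ge[OF that] by (simp add: source n_def[symmetric])
  qed
  have lower: "Delta_corr n \<sigma> \<omega> l * (1 - eps_corr n \<omega> l) \<le> det_centering M A B sel x l" if "l \<le> L" for l
  proof -
    let ?P = "\<Prod>k=1..l. (real n - 2) / (real n - 2 + (\<omega> k)\<^sup>2)"
    have P: "0 \<le> ?P"
      using n_gt by (intro prod_nonneg) (auto intro!: divide_nonneg_nonneg add_nonneg_nonneg)
    have "(sqrt (real n) * \<sigma> * sqrt ?P)\<^sup>2 \<le> (R l)\<^sup>2"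
      using R[OF that] sigma P by (intro power_mono) auto
    then have "real n * (\<sigma>\<^sup>2 * ?P) \<le> (R l)\<^sup>2"
      using P by (simp add: power_mult_distrib)
    then have "\<sigma>\<^sup>2 * ?P \<le> (R l)\<^sup>2 / real n"
      using n_gt by (simp add: field_simps)
    then show ?thesis
      by (simp add: det_centering_eq[OF design that] Delta_corr_eps[OF n_gt] n_def[symmetric])
  qed
  \<comment> \<open>Stated for \<open>V\<close> and not for the centering, since the induction needs
    the second moment. At \<open>l = 0\<close> the factor
    \<open>\<sigma>\<^sup>2 - Delta_corr\<close> vanishes, so the truncated index
    \<open>l - 1\<close> does no harm.\<close>
  have upper: "V l / real n \<le> Delta_corr n \<sigma> \<omega> l + 2 * (\<sigma>\<^sup>2 - Delta_corr n \<sigma> \<omega> l) * eps_corr n \<omega> (l - 1)"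
    if "l \<le> L" and power: "\<And>j. j \<in> {1..L} \<Longrightarrow> (c j)\<^sup>2 = \<sigma>\<^sup>2 * (\<omega> j)\<^sup>2 / (real n + (\<omega> j)\<^sup>2)
                 * (\<Prod>k=1..j. real n / (real n + (\<omega> k)\<^sup>2))" for l
    using that(1)
  proof (induction l)
    case 0
    then show ?case
      using n_gt by (simp add: V_0 source power_mult_distrib Delta_corr_def)
  next
    case (Suc l)
    then have l: "l \<le> L" "Suc l \<in> {1..L}" by auto
    have "V (Suc l) / real n \<le> Delta_corr n \<sigma> \<omega> (Suc l)
        + 2 * (\<sigma>\<^sup>2 - Delta_corr n \<sigma> \<omega> (Suc l)) * eps_corr n \<omega> l"
    proof (rule recursion_step[OF n_gt sigma _ _ power[OF l(2)] R[OF l(1)] _ Suc.IH[OF l(1)]])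
      show "c (Suc l) > 0" using B(3)[OF l(2)] .
      show "0 \<le> \<omega> (Suc l)" using w_nonneg[OF l(2)] w[OF l(2)] by simp
      show "V (Suc l) \<le> V l - 2 * c (Suc l) * \<omega> (Suc l) * R l + (c (Suc l))\<^sup>2 * ((\<omega> (Suc l))\<^sup>2 + real n)"
        using V_Suc[OF Suc.prems] w[OF l(2)] by (simp add: n_def[symmetric])
    qed
    then show ?case by simp
  qed
  \<comment> \<open>Jensen relates the two moments once the recursion is complete.\<close>
  have "det_centering M A B sel x l \<le> V l / real n" if "l \<le> L" for l
    using R_square_le_V[OF that]
    by (simp add: det_centering_eq[OF design that] n_def[symmetric] divide_right_mono)
  note upper' = order_trans[OF this upper]
  show ?thesis
  proof (intro conjI ballI impI)
    fix l assume "l \<in> {1..L}"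
    then have l: "l \<le> L" by simp
    show "Delta_corr n \<sigma> \<omega> l * (1 - eps_corr n \<omega> l) \<le> det_centering M A B sel x l"
      by (rule lower[OF l])
    assume "\<forall>j\<in>{1..L}. (c j)\<^sup>2 = \<sigma>\<^sup>2 * (\<omega> j)\<^sup>2 / (real n + (\<omega> j)\<^sup>2)
        * (\<Prod>k=1..j. real n / (real n + (\<omega> k)\<^sup>2))"
    then show "det_centering M A B sel x l
        \<le> Delta_corr n \<sigma> \<omega> l + 2 * (\<sigma>\<^sup>2 - Delta_corr n \<sigma> \<omega> l) * eps_corr n \<omega> (l - 1)"
      by (intro upper'[OF l l]) blast
  qed (rule eps_corr_le[OF n_gt])
qed

end
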